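(* Let $F:=f+g$ on $\mathbb{R}^n$ be closed and level-bounded, where $f:\mathbb{R}^n\to\mathbb{R}$ is $\mathcal{C}^2$-smooth with $L_f$-Lipschitz continuous gradient and $g:\mathbb{R}^n\to\mathbb{R}\cup\{\infty\}$ is closed and $\sigma$-weakly convex ($\sigma>0$). Let $\beta\in(0,\min\{\sigma^{-1},L_f^{-1}\})$, $\delta\in(0,2)$, and define the Douglas–Rachford mapping $H=S_\beta:\mathbb{R}^n\to\mathbb{R}^n$ by $$R_\beta(z)=\mathrm{prox}_{\beta g}\big(2\,\mathrm{prox}_{\beta f}(z)-z\big),\qquad S_\beta(z)=z+\delta\big(R_\beta(z)-\mathrm{prox}_{\beta f}(z)\big).$$ Let $x^*$ be a critical point of $F$ and let $z^*$ be the corresponding fixed point of $H$, i.e. $H(z^* )=z^*$ and $x^*=\mathrm{prox}_{\beta f}(z^* )$. Suppose that $g$ admits a $\mathcal{C}^3$-active manifold $\mathcal{M}$ at $x^*$, that $f$ is $\mathcal{C}^4$-smooth near $x^*$, and that $0\in\mathrm{rint}(\partial F(x^* ))$. Then: (i) $H$ is $\mathcal{C}^2$-smooth around $z^*$, and both $H$ and $\nabla H$ are Lipschitz continuous around $z^*$. (ii) Suppose in addition that there are $\rho>0$ and $\gamma\in(0,1)$ with $\|H(z)-H(z')\|\le\gamma\|z-z'\|$ for all $z,z'$ in the closed ball $\mathcal{B}_{z^*}(\rho)$, and that there is a constant $M_\alpha$ such that the Anderson acceleration coefficients satisfy $\sum_{i=0}^{m_k}|\alpha^k_i|\le M_\alpha$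 for all $k\in\mathbb{N}$. Then, if the initial point $z^0$ is sufficiently close to $z^*$, the iterates $\{z^k\}$ produced by Anderson acceleration (memory $m\ge1$) applied to $H$ from $z^0$ converge to $z^*$ R-linearly with some $\hat\gamma\in(\gamma,1)$; namely, for all $k\ge0$, $$\|H(z^k)-z^k\|\le\hat\gamma^k\|H(z^0)-z^0\|\quad\text{and}\quad\|z^k-z^*\|\le\frac{1+\gamma}{1-\gamma}\,\hat\gamma^k\|z^0-z^*\|.$$
   Context: $\|\cdot\|$ is the Euclidean norm; $\mathcal{B}_x(\rho)$ and $\hat{\mathcal{B}}_x(\rho)$ are the closed and open balls of radius $\rho$ around $x$; $\mathrm{rint}$ denotes relative interior; $\mathrm{prox}_{\beta\varphi}(x)=\arg\min_y\{\varphi(y)+\frac1{2\beta}\|y-x\|^2\}$. A function $g$ is $\sigma$-weakly convex if $x\mapsto g(x)+\frac\sigma2\|x\|^2$ is convex. Subdifferentials. For a set $Q$ and $x\in Q$, the regular normal cone is $N_Q(x)=\{\nu:\limsup_{y\to x,\,y\in Q}\langle\nu,y-x\rangle/\|y-x\|\le0\}$; the limiting normal cone consists of all limits of $\nu_i\in N_Q(x_i)$ with $x_i\in Q$, $x_i\to x$; the Clarke normal cone $N^c_Q(x)$ is the closed convex hull of the limiting normal cone. For $\varphi$ finite at $x$, $\partial\varphi(x)=\{\nu:(\nu,-1)\in N_{\mathrm{epi}\varphi}(x,\varphi(x))\}$ and $\partial_c\varphi(x)=\{\nu:(\nu,-1)\in N^c_{\mathrm{epi}\varphi}(x,\varphi(x))\}$.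 A critical point of $\varphi$ is $x$ with $0\in\partial\varphi(x)$. The function $\varphi$ is regular at $x$ if $\mathrm{epi}\varphi$ is locally closed around $(x,\varphi(x))$ and $N_{\mathrm{epi}\varphi}(x,\varphi(x))=N^c_{\mathrm{epi}\varphi}(x,\varphi(x))$. The subderivative is $d\varphi(x)(\bar\nu)=\liminf_{\tau\downarrow0,\ \nu\to\bar\nu}\frac{\varphi(x+\tau\nu)-\varphi(x)}{\tau}$. Smooth manifold. $\mathcal{M}\subset\mathbb{R}^n$ is a $\mathcal{C}^p$-smooth manifold of dimension $r$ around $\bar x\in\mathcal{M}$ if there are $\epsilon>0$ and a $\mathcal{C}^p$-smooth $G:\mathbb{R}^n\to\mathbb{R}^{n-r}$ with $\nabla G(\bar x)$ of full row rank and $\mathcal{M}\cap\hat{\mathcal{B}}_{\bar x}(\epsilon)=\{x\in\hat{\mathcal{B}}_{\bar x}(\epsilon):G(x)=0\}$. Tangent and normal spaces: $T_{\mathcal{M}}(x)=\ker\nabla G(x)$, $N_{\mathcal{M}}(x)=T_{\mathcal{M}}(x)^\perp$. Active manifold. A closed function $\varphi$ admits a $\mathcal{C}^p$-active manifold $\mathcal{M}\ni\bar x$ at $\bar x$ if: (1) near $\bar x$, $\mathcal{M}$ is a $\mathcal{C}^p$-smooth manifold and the restriction of $\varphi$ to $\mathcal{M}$ is $\mathcal{C}^p$-smooth; (2) for all $x\in\mathcal{M}$ near $\bar x$, $\varphi$ is regular at $x$ and has a subgradient there; (3) $d\varphi(\bar x)(-\nu)>-d\varphi(\bar x)(\nu)$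 for all nonzero $\nu\in N_{\mathcal{M}}(\bar x)$; (4) the set-valued map $\partial_c\varphi$ is continuous at $\bar x$ relative to $\mathcal{M}$. Anderson acceleration with memory $m\ge1$ for a mapping $H$, started at $z^0$: put $H^k=H(z^k)$, $r^k=H^k-z^k$, $m_k=\min(m,k)$. For $k=0,1,2,\dots$ let $\alpha^k=(\alpha^k_0,\dots,\alpha^k_{m_k})$ be a minimizer of $\big\|\sum_{i=0}^{m_k}\alpha_i r^{k-m_k+i}\big\|^2$ over $\alpha\in\mathbb{R}^{m_k+1}$ with $\sum_i\alpha_i=1$, and set $z^{k+1}=\sum_{i=0}^{m_k}\alpha^k_iH^{k-m_k+i}$. "Sufficiently close" may depend on $M_\alpha$, $m$ and $H$. *)

theory Defs
  imports "HOL-Analysis.Analysis"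
begin

section \<open>Smooth functions\<close>

text \<open>Continuous differentiability of order \<open>p\<close> on an open set: all iterated directional
  derivatives up to order \<open>p\<close> come from Frechet derivatives, and those of order \<open>p\<close> are
  continuous. Meaningful for open \<open>S\<close> only.\<close>

primrec C_smooth_on ::
  "nat \<Rightarrow> 'a set \<Rightarrow> ('a::euclidean_space \<Rightarrow> 'b::real_normed_vector) \<Rightarrow> bool" where
  "C_smooth_on 0 S h \<longleftrightarrow> continuous_on S h"
| "C_smooth_on (Suc p) S h \<longleftrightarrow>
     (\<forall>x\<in>S. h differentiable (at x)) \<and>
     (\<forall>v. C_smooth_on p S (\<lambda>x. frechet_derivative h (at x) v))"

definition C_smooth_near ::
  "nat \<Rightarrow> ('a::euclidean_space \<Rightarrow> 'b::real_normed_vector) \<Rightarrow> 'a \<Rightarrow> bool" where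
  "C_smooth_near p h x \<longleftrightarrow> (\<exists>\<epsilon>>0. C_smooth_on p (ball x \<epsilon>) h)"

definition grad :: "('a::euclidean_space \<Rightarrow> real) \<Rightarrow> 'a \<Rightarrow> 'a" where
  "grad h x = (THE D. GDERIV h x :> D)"

section \<open>Extended-real-valued functions\<close>

definition epi :: "('a \<Rightarrow> ereal) \<Rightarrow> ('a \<times> real) set" where
  "epi \<phi> = {(x, t). \<phi> x \<le> ereal t}"

definition closed_fun :: "('a::euclidean_space \<Rightarrow> ereal) \<Rightarrow> bool" where
  "closed_fun \<phi> \<longleftrightarrow> closed (epi \<phi>)"

definition level_bounded :: "('a::euclidean_space \<Rightarrow> ereal) \<Rightarrow> bool" where
  "level_bounded \<phi> \<longleftrightarrow> (\<forall>c::real. bounded {x. \<phi> x \<le> ereal c})"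

definition convex_fun :: "('a::euclidean_space \<Rightarrow> ereal) \<Rightarrow> bool" where
  "convex_fun \<phi> \<longleftrightarrow> convex (epi \<phi>)"

definition weakly_convex :: "real \<Rightarrow> ('a::euclidean_space \<Rightarrow> ereal) \<Rightarrow> bool" where
  "weakly_convex \<sigma> \<phi> \<longleftrightarrow> convex_fun (\<lambda>x. \<phi> x + ereal (\<sigma> / 2 * (norm x)\<^sup>2))"

text \<open>The value is a selected minimizer; it is unspecified when no minimizer exists.\<close>

definition prox :: "real \<Rightarrow> ('a::euclidean_space \<Rightarrow> ereal) \<Rightarrow> 'a \<Rightarrow> 'a" where
  "prox \<beta> \<phi> x = arg_min (\<lambda>y. \<phi> y + ereal (1 / (2 * \<beta>) * (norm (y - x))\<^sup>2)) (\<lambda>y. True)"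

section \<open>Normal cones and subdifferentials\<close>

text \<open>At an isolated point of \<open>Q\<close> the upper limit is taken along the trivial filter and
  equals \<open>-\<infinity>\<close>, so that every vector is normal there.\<close>

definition regular_normal_cone :: "('a::euclidean_space) set \<Rightarrow> 'a \<Rightarrow> 'a set" where
  "regular_normal_cone Q x =
     {\<nu>. Limsup (at x within Q) (\<lambda>y. ereal (\<nu> \<bullet> (y - x) / norm (y - x))) \<le> 0}"

definition limiting_normal_cone :: "('a::euclidean_space) set \<Rightarrow> 'a \<Rightarrow> 'a set" where
  "limiting_normal_cone Q x =
     {\<nu>. \<exists>X V. (\<forall>i::nat. X i \<in> Q \<and> V i \<in> regular_normal_cone Q (X i)) \<and>
          X \<longlonglongrightarrow> x \<and> V \<longlonglongrightarrow> \<nu>}"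

definition clarke_normal_cone :: "('a::euclidean_space) set \<Rightarrow> 'a \<Rightarrow> 'a set" where
  "clarke_normal_cone Q x = closure (convex hull (limiting_normal_cone Q x))"

definition subdiff :: "('a::euclidean_space \<Rightarrow> ereal) \<Rightarrow> 'a \<Rightarrow> 'a set" where
  "subdiff \<phi> x = {\<nu>. \<bar>\<phi> x\<bar> \<noteq> \<infinity> \<and>
     (\<nu>, -1) \<in> regular_normal_cone (epi \<phi>) (x, real_of_ereal (\<phi> x))}"

definition clarke_subdiff :: "('a::euclidean_space \<Rightarrow> ereal) \<Rightarrow> 'a \<Rightarrow> 'a set" where
  "clarke_subdiff \<phi> x = {\<nu>. \<bar>\<phi> x\<bar> \<noteq> \<infinity> \<and>
     (\<nu>, -1) \<in> clarke_normal_cone (epi \<phi>) (x, real_of_ereal (\<phi> x))}"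

definition critical_point :: "('a::euclidean_space \<Rightarrow> ereal) \<Rightarrow> 'a \<Rightarrow> bool" where
  "critical_point \<phi> x \<longleftrightarrow> 0 \<in> subdiff \<phi> x"

definition locally_closed_around :: "('a::euclidean_space) set \<Rightarrow> 'a \<Rightarrow> bool" where
  "locally_closed_around Q x \<longleftrightarrow> (\<exists>\<epsilon>>0. closed (Q \<inter> cball x \<epsilon>))"

definition regular_at :: "('a::euclidean_space \<Rightarrow> ereal) \<Rightarrow> 'a \<Rightarrow> bool" where
  "regular_at \<phi> x \<longleftrightarrow> \<bar>\<phi> x\<bar> \<noteq> \<infinity> \<and>
     locally_closed_around (epi \<phi>) (x, real_of_ereal (\<phi> x)) \<and>
     regular_normal_cone (epi \<phi>) (x, real_of_ereal (\<phi> x)) =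
       clarke_normal_cone (epi \<phi>) (x, real_of_ereal (\<phi> x))"

definition subderivative :: "('a::euclidean_space \<Rightarrow> ereal) \<Rightarrow> 'a \<Rightarrow> 'a \<Rightarrow> ereal" where
  "subderivative \<phi> x v =
     Liminf (at_right (0::real) \<times>\<^sub>F nhds v) (\<lambda>(\<tau>, \<nu>). (\<phi> (x + \<tau> *\<^sub>R \<nu>) - \<phi> x) / ereal \<tau>)"

text \<open>Continuity of a set-valued map at \<open>x\<close> relative to \<open>M\<close> in the Painleve--Kuratowski
  sense: outer semicontinuity together with inner semicontinuity.\<close>

definition setvalued_continuous_at_rel ::
  "('a::euclidean_space \<Rightarrow> 'b::euclidean_space set) \<Rightarrow> 'a \<Rightarrow> 'a set \<Rightarrow> bool" where
  "setvalued_continuous_at_rel S x M \<longleftrightarrow>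
     (\<forall>X V v. (\<forall>i::nat. X i \<in> M \<and> V i \<in> S (X i)) \<and> X \<longlonglongrightarrow> x \<and> V \<longlonglongrightarrow> v \<longrightarrow> v \<in> S x) \<and>
     (\<forall>v\<in>S x. \<forall>X. (\<forall>i::nat. X i \<in> M) \<and> X \<longlonglongrightarrow> x \<longrightarrow>
        (\<exists>V. (\<forall>\<^sub>F i in sequentially. V i \<in> S (X i)) \<and> V \<longlonglongrightarrow> v))"

section \<open>Smooth and active manifolds\<close>

text \<open>\<open>G i\<close> for \<open>i < DIM('a) - r\<close> are the components of a map into the Euclidean space of
  dimension \<open>DIM('a) - r\<close>, so the rows of its Jacobian at \<open>x\<close> are the vectors
  \<open>grad (G i) x\<close>; full row rank says that they span a space of dimension \<open>DIM('a) - r\<close>.\<close>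

definition manifold_equation ::
  "nat \<Rightarrow> nat \<Rightarrow> ('a::euclidean_space) set \<Rightarrow> 'a \<Rightarrow> (nat \<Rightarrow> 'a \<Rightarrow> real) \<Rightarrow> bool" where
  "manifold_equation p r M x G \<longleftrightarrow> r \<le> DIM('a) \<and>
     (\<forall>i<DIM('a) - r. C_smooth_on p UNIV (G i)) \<and>
     dim ((\<lambda>i. grad (G i) x) ` {..<DIM('a) - r}) = DIM('a) - r \<and>
     (\<exists>\<epsilon>>0. M \<inter> ball x \<epsilon> = {y \<in> ball x \<epsilon>. \<forall>i<DIM('a) - r. G i y = 0})"

definition tangent_space ::
  "nat \<Rightarrow> (nat \<Rightarrow> ('a::euclidean_space) \<Rightarrow> real) \<Rightarrow> 'a \<Rightarrow> 'a set" where
  "tangent_space r G x = {v. \<forall>i<DIM('a) - r. grad (G i) x \<bullet> v = 0}"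

definition normal_space ::
  "nat \<Rightarrow> (nat \<Rightarrow> ('a::euclidean_space) \<Rightarrow> real) \<Rightarrow> 'a \<Rightarrow> 'a set" where
  "normal_space r G x = orthogonal_comp (tangent_space r G x)"

text \<open>\<open>G\<close> is chosen once and also supplies the normal space, which does not depend on that
  choice. Smoothness of the restriction of \<open>\<phi>\<close> to \<open>M\<close> means agreement on \<open>M\<close> near \<open>x\<close>
  with a smooth function defined on a neighbourhood of \<open>x\<close>.\<close>

definition active_manifold ::
  "nat \<Rightarrow> ('a::euclidean_space \<Rightarrow> ereal) \<Rightarrow> 'a set \<Rightarrow> 'a \<Rightarrow> bool" where
  "active_manifold p \<phi> M x \<longleftrightarrow> closed_fun \<phi> \<and> x \<in> M \<and>
     (\<exists>r G. manifold_equation p r M x G \<and>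
       (\<exists>h::'a \<Rightarrow> real. C_smooth_near p h x \<and>
          (\<forall>\<^sub>F y in nhds x. y \<in> M \<longrightarrow> \<phi> y = ereal (h y))) \<and>
       (\<forall>\<^sub>F y in nhds x. y \<in> M \<longrightarrow> regular_at \<phi> y \<and> subdiff \<phi> y \<noteq> {}) \<and>
       (\<forall>\<nu>\<in>normal_space r G x. \<nu> \<noteq> 0 \<longrightarrow>
          subderivative \<phi> x (- \<nu>) > - subderivative \<phi> x \<nu>) \<and>
       setvalued_continuous_at_rel (clarke_subdiff \<phi>) x M)"

section \<open>Douglas--Rachford mapping and Anderson acceleration\<close>

definition DR_R ::
  "real \<Rightarrow> ('a::euclidean_space \<Rightarrow> real) \<Rightarrow> ('a \<Rightarrow> ereal) \<Rightarrow> 'a \<Rightarrow> 'a" where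
  "DR_R \<beta> f g z = prox \<beta> g (2 *\<^sub>R prox \<beta> (\<lambda>y. ereal (f y)) z - z)"

definition DR_S ::
  "real \<Rightarrow> real \<Rightarrow> ('a::euclidean_space \<Rightarrow> real) \<Rightarrow> ('a \<Rightarrow> ereal) \<Rightarrow> 'a \<Rightarrow> 'a" where
  "DR_S \<beta> \<delta> f g z = z + \<delta> *\<^sub>R (DR_R \<beta> f g z - prox \<beta> (\<lambda>y. ereal (f y)) z)"

text \<open>Only the entries \<open>\<alpha> k i\<close> with \<open>i \<le> min m k\<close> matter. The minimizing coefficients need
  not be unique, hence a predicate on runs instead of a function.\<close>

definition anderson_run ::
  "nat \<Rightarrow> ('a::euclidean_space \<Rightarrow> 'a) \<Rightarrow> 'a \<Rightarrow> (nat \<Rightarrow> 'a) \<Rightarrow> (nat \<Rightarrow> nat \<Rightarrow> real) \<Rightarrow> bool" where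
  "anderson_run m H z0 z \<alpha> \<longleftrightarrow> z 0 = z0 \<and>
     (\<forall>k. is_arg_min
            (\<lambda>a. (norm (\<Sum>i\<le>min m k. a i *\<^sub>R (H (z (k - min m k + i)) - z (k - min m k + i))))\<^sup>2)
            (\<lambda>a. (\<Sum>i\<le>min m k. a i) = 1) (\<alpha> k) \<and>
          z (Suc k) = (\<Sum>i\<le>min m k. \<alpha> k i *\<^sub>R H (z (k - min m k + i))))"

end

theory Submission
  imports Defs
begin

text \<open>Part (i). The mapping \<open>prox \<beta> f\<close> inverts \<open>id + \<beta> grad f\<close>, so it is smooth by the inverse
  function theorem. For \<open>prox \<beta> g\<close>, consider the points \<open>y\<close> of the manifold near \<open>xstar\<close> together with
  vectors \<open>v\<close> of the affine space \<open>grad h y + N y\<close> near \<open>- grad f xstar\<close>, where \<open>h\<close> is the smooth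
  extension of \<open>g\<close>. All such \<open>v\<close> are subgradients of \<open>g\<close> at \<open>y\<close>: a unit normal separating \<open>v\<close> from
  the subdifferential would, in the limit, separate a point of the relative interior of the
  subdifferential at \<open>xstar\<close> from that subdifferential, so the subderivative would be linear in a
  normal direction. Hence \<open>prox \<beta> g (y + \<beta> v) = y\<close>, and weak monotonicity of the subdifferential
  makes the derivative of \<open>(y, v) \<mapsto> y + \<beta> v\<close> injective, so that this map has a smooth inverse.

  Part (ii). With \<open>H z = zstar + A (z - zstar) + R z\<close>, the new residual is \<open>A\<close> applied to the optimal
  combination of the old ones, plus remainders: its norm is at most \<open>\<gamma>\<close> times the last residual, plus
  a small multiple of the residuals in the memory window.\<close>

section \<open>Functions of class C^p\<close>

text \<open>The value of \<open>prox\<close> is a chosen minimiser without a formula, so smoothness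
  must come from a map that \<open>prox\<close> inverts on an open set. Two facts make this
  possible. Weak convexity turns the local notion of a regular subgradient into a global quadratic
  minorant, and \<open>\<beta> * \<sigma> < 1\<close> then makes \<open>y\<close> the strict global
  minimiser of the problem centred at \<open>y + \<beta> v\<close>, which leaves no choice.
  Moreover, points of the manifold and normal vectors there together have the dimension of the whole
  space: the tangential part of a vector \<open>n\<close> selects the point, the rest of
  \<open>n\<close> the normal vector. The inverse function theorem thus applies to a map of the
  ambient space into itself. Normal vectors at a moving point involve first derivatives of the
  chart, so data of class \<open>C^3\<close> yield a mapping of class \<open>C^2\<close>.

  In part (ii) the obstacle is that the remainders are measured by the oldest residual in the
  window, whose bound may exceed that of the newest by the factor \<open>1 / q ^ m\<close>, where
  the rate \<open>q\<close> is the midpoint of \<open>\<gamma>\<close> and 1. The tolerance for the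
  remainders therefore carries the factor \<open>(q - \<gamma>) * q ^ m\<close>.\<close>

lemma C_smooth_on_subset: "C_smooth_on p S h \<Longrightarrow> T \<subseteq> S \<Longrightarrow> C_smooth_on p T h"
  by (induction p arbitrary: h) (auto intro: continuous_on_subset)

lemma C_smooth_on_has_derivative:
  "C_smooth_on (Suc p) S h \<Longrightarrow> x \<in> S \<Longrightarrow> (h has_derivative frechet_derivative h (at x)) (at x)"
  using frechet_derivative_works by auto

lemma C_smooth_on_cong:
  assumes S: "open S" and "C_smooth_on p S h" "\<And>x. x \<in> S \<Longrightarrow> h x = k x"
  shows "C_smooth_on p S k"
  using assms(2,3)
proof (induction p arbitrary: h k)
  case 0
  then show ?case
    using continuous_on_cong[of S S h k] by simp
next
  case (Suc p)
  have d: "(k has_derivative frechet_derivative h (at x)) (at x)" if "x \<in> S" for x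
    using has_derivative_transform_within_open[OF C_smooth_on_has_derivative[OF Suc.prems(1) that] S that]
      Suc.prems(2) by auto
  have "C_smooth_on p S (\<lambda>x. frechet_derivative k (at x) v)" for v
    by (rule Suc.IH[of "\<lambda>x. frechet_derivative h (at x) v"])
       (use Suc.prems(1) frechet_derivative_at[OF d] in auto)
  then show ?case
    using d by (auto simp: differentiable_def)
qed

text \<open>Any explicit family of derivatives may be exhibited; uniqueness identifies it with
  \<open>frechet_derivative\<close>, which has no formula of its own.\<close>

lemma C_smooth_on_SucI:
  assumes S: "open S"
    and d: "\<And>x. x \<in> S \<Longrightarrow> (h has_derivative D x) (at x)"
    and D: "\<And>v. C_smooth_on p S (\<lambda>x. D x v)"
  shows "C_smooth_on (Suc p) S h"
proof -
  have "C_smooth_on p S (\<lambda>x. frechet_derivative h (at x) v)" for v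
    by (rule C_smooth_on_cong[OF S D[of v]]) (use frechet_derivative_at[OF d] in auto)
  then show ?thesis
    using d by (auto simp: differentiable_def)
qed

lemma C_smooth_on_lower: "C_smooth_on (Suc p) S h \<Longrightarrow> C_smooth_on p S h"
proof (induction p arbitrary: h)
  case 0
  then show ?case
    by (auto intro!: continuous_at_imp_continuous_on differentiable_imp_continuous_within)
next
  case (Suc p)
  then show ?case
    by (metis C_smooth_on.simps(2))
qed

lemma C_smooth_on_mono: "C_smooth_on q S h \<Longrightarrow> p \<le> q \<Longrightarrow> C_smooth_on p S h"
  by (induction q arbitrary: p) (use C_smooth_on_lower in \<open>auto simp: le_Suc_eq\<close>)

lemma C_smooth_on_continuous: "C_smooth_on p S h \<Longrightarrow> continuous_on S h"
  using C_smooth_on_mono[of p S h 0] by simp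

lemma C_smooth_on_const: "C_smooth_on p S (\<lambda>x. c)"
  by (induction p arbitrary: c) auto

lemma C_smooth_on_ident: "C_smooth_on p S (\<lambda>x. x)"
  by (cases p) (auto intro: C_smooth_on_const)

lemma C_smooth_on_add:
  assumes S: "open S"
  shows "C_smooth_on p S h \<Longrightarrow> C_smooth_on p S k \<Longrightarrow> C_smooth_on p S (\<lambda>x. h x + k x)"
proof (induction p arbitrary: h k)
  case 0
  then show ?case by (auto intro: continuous_intros)
next
  case (Suc p)
  show ?case
    by (rule C_smooth_on_SucI[OF S has_derivative_add[OF
          C_smooth_on_has_derivative[OF Suc.prems(1)] C_smooth_on_has_derivative[OF Suc.prems(2)]]])
       (use Suc in auto)
qed

lemma C_smooth_on_bounded_bilinear:
  assumes S: "open S" and B: "bounded_bilinear B"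
  shows "C_smooth_on p S h \<Longrightarrow> C_smooth_on p S k \<Longrightarrow> C_smooth_on p S (\<lambda>x. B (h x) (k x))"
proof (induction p arbitrary: h k)
  case 0
  then show ?case
    by (auto intro: bounded_bilinear.continuous_on[OF B])
next
  case (Suc p)
  note low = C_smooth_on_lower[OF Suc.prems(1)] C_smooth_on_lower[OF Suc.prems(2)]
  show ?case
  proof (rule C_smooth_on_SucI[OF S])
    fix x assume "x \<in> S"
    show "((\<lambda>x. B (h x) (k x)) has_derivative
        (\<lambda>v. B (h x) (frechet_derivative k (at x) v) + B (frechet_derivative h (at x) v) (k x))) (at x)"
      by (rule bounded_bilinear.FDERIV[OF B C_smooth_on_has_derivative C_smooth_on_has_derivative])
         (use Suc.prems \<open>x \<in> S\<close> in auto)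
  next
    fix v
    show "C_smooth_on p S (\<lambda>x. B (h x) (frechet_derivative k (at x) v) + B (frechet_derivative h (at x) v) (k x))"
      by (intro C_smooth_on_add[OF S] Suc.IH low) (use Suc.prems in auto)
  qed
qed

lemma C_smooth_on_bounded_linear:
  assumes S: "open S" and L: "bounded_linear L" and h: "C_smooth_on p S h"
  shows "C_smooth_on p S (\<lambda>x. L (h x))"
  using h
proof (induction p arbitrary: h)
  case 0
  then show ?case
    by (auto intro: bounded_linear.continuous_on[OF L])
next
  case (Suc p)
  show ?case
    by (rule C_smooth_on_SucI[OF S bounded_linear.has_derivative[OF L C_smooth_on_has_derivative]])
       (use Suc in auto)
qed

lemmas C_smooth_on_scaleR = C_smooth_on_bounded_bilinear[OF _ bounded_bilinear_scaleR]
lemmas C_smooth_on_inner = C_smooth_on_bounded_bilinear[OF _ bounded_bilinear_inner]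

lemma C_smooth_on_diff:
  assumes S: "open S" "C_smooth_on p S h" "C_smooth_on p S k"
  shows "C_smooth_on p S (\<lambda>x. h x - k x)"
  using C_smooth_on_add[OF S(1,2) C_smooth_on_bounded_linear[OF S(1) bounded_linear_minus[OF bounded_linear_ident] S(3)]]
  by simp

lemma C_smooth_on_sum:
  assumes S: "open S" and "\<And>i. i \<in> I \<Longrightarrow> C_smooth_on p S (h i)"
  shows "C_smooth_on p S (\<lambda>x. \<Sum>i\<in>I. h i x)"
  using assms(2)
  by (induction I rule: infinite_finite_induct) (auto intro: C_smooth_on_const C_smooth_on_add[OF S])

lemma linear_sum_Basis:
  fixes L :: "'a::euclidean_space \<Rightarrow> 'b::real_vector"
  assumes "linear L"
  shows "L v = (\<Sum>b\<in>Basis. (v \<bullet> b) *\<^sub>R L b)"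
proof -
  have "L v = L (\<Sum>b\<in>Basis. (v \<bullet> b) *\<^sub>R b)"
    by (simp add: euclidean_representation)
  also have "\<dots> = (\<Sum>b\<in>Basis. (v \<bullet> b) *\<^sub>R L b)"
    by (simp add: linear_sum[OF assms] linear_cmul[OF assms])
  finally show ?thesis .
qed

text \<open>\<open>C_smooth_on\<close> speaks of derivatives in fixed directions. When the direction
  moves with the point, linearity reduces the value to the basis directions, with smooth
  coefficients.\<close>

lemma C_smooth_on_linear_apply:
  fixes L :: "'a::euclidean_space \<Rightarrow> 'b::euclidean_space \<Rightarrow> 'c::real_normed_vector"
  assumes S: "open S" and lin: "\<And>x. x \<in> S \<Longrightarrow> linear (L x)"
    and L: "\<And>v. C_smooth_on p S (\<lambda>x. L x v)" and h: "C_smooth_on p S h"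
  shows "C_smooth_on p S (\<lambda>x. L x (h x))"
proof (rule C_smooth_on_cong[OF S])
  show "C_smooth_on p S (\<lambda>x. \<Sum>b\<in>Basis. (h x \<bullet> b) *\<^sub>R L x b)"
    by (intro C_smooth_on_sum[OF S] C_smooth_on_scaleR[OF S] C_smooth_on_inner[OF S] h L C_smooth_on_const)
qed (rule linear_sum_Basis[OF lin, symmetric])

text \<open>The chain rule applies the derivative of \<open>g\<close> to a moving vector, which is
  the case of \<open>C_smooth_on_linear_apply\<close>. The induction varies only \<open>g\<close>,
  replacing it by its derivative in a fixed direction, while \<open>f\<close> stays and gives up one
  order.\<close>

lemma C_smooth_on_compose:
  fixes f :: "'a::euclidean_space \<Rightarrow> 'b::euclidean_space" and g :: "'b \<Rightarrow> 'c::real_normed_vector"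
  assumes S: "open S" and "C_smooth_on p S f" "C_smooth_on p T g" "f ` S \<subseteq> T"
  shows "C_smooth_on p S (\<lambda>x. g (f x))"
  using assms(2-4)
proof (induction p arbitrary: g)
  case 0
  then show ?case
    using continuous_on_compose2[of T g S f] by auto
next
  case (Suc p)
  note d = C_smooth_on_has_derivative[OF Suc.prems(1)] C_smooth_on_has_derivative[OF Suc.prems(2)]
  show ?case
  proof (rule C_smooth_on_SucI[OF S])
    fix x assume x: "x \<in> S"
    show "((\<lambda>x. g (f x)) has_derivative
        (\<lambda>v. frechet_derivative g (at (f x)) (frechet_derivative f (at x) v))) (at x)"
      using diff_chain_at[OF d(1)[OF x] d(2)] Suc.prems(3) x by (auto simp: o_def)
  next
    fix v
    show "C_smooth_on p S (\<lambda>x. frechet_derivative g (at (f x)) (frechet_derivative f (at x) v))"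
    proof (rule C_smooth_on_linear_apply[OF S])
      show "linear (frechet_derivative g (at (f x)))" if "x \<in> S" for x
        using d(2)[of "f x"] that Suc.prems(3) by (auto intro: has_derivative_linear)
      show "C_smooth_on p S (\<lambda>x. frechet_derivative g (at (f x)) u)" for u
        by (rule Suc.IH[OF C_smooth_on_lower[OF Suc.prems(1)]]) (use Suc.prems in auto)
      show "C_smooth_on p S (\<lambda>x. frechet_derivative f (at x) v)"
        using Suc.prems(1) by simp
    qed
  qed
qed

text \<open>Riesz representation in coordinates: the vector with components \<open>D b\<close>
  represents \<open>D\<close>, and uniqueness of derivatives removes the definite description in
  \<open>grad\<close>.\<close>

lemma has_derivative_imp_GDERIV_grad:
  fixes h :: "'a::euclidean_space \<Rightarrow> real"
  assumes "(h has_derivative D) (at x)"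
  shows "GDERIV h x :> grad h x" "D v = v \<bullet> grad h x" "grad h x = (\<Sum>b\<in>Basis. D b *\<^sub>R b)"
proof -
  interpret bounded_linear D
    using assms has_derivative_bounded_linear by blast
  define g where "g = (\<Sum>b\<in>Basis. D b *\<^sub>R b)"
  have D: "D v = v \<bullet> g" for v
    using linear_sum_Basis[OF linear, of v] by (simp add: g_def inner_sum_right mult.commute)
  then have G: "GDERIV h x :> g"
    using assms by (simp add: gderiv_def flip: D)
  have "grad h x = g"
    unfolding grad_def
  proof (rule the_equality)
    show "GDERIV h x :> g" by (rule G)
  next
    fix g' assume "GDERIV h x :> g'"
    then have "(\<lambda>v. v \<bullet> g') = D"
      using has_derivative_unique[OF assms] by (auto simp: gderiv_def)
    then have "(g' - g) \<bullet> (g' - g) = 0"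
      using D by (metis inner_diff_right right_minus_eq)
    then show "g' = g" by simp
  qed
  with G show "GDERIV h x :> grad h x"
    by simp
  show "D v = v \<bullet> grad h x"
    using D \<open>grad h x = g\<close> by simp
  show "grad h x = (\<Sum>b\<in>Basis. D b *\<^sub>R b)"
    using \<open>grad h x = g\<close> by (simp only: g_def)
qed

lemma C_smooth_on_GDERIV:
  "C_smooth_on (Suc p) S h \<Longrightarrow> x \<in> S \<Longrightarrow> GDERIV h x :> grad h x"
  using has_derivative_imp_GDERIV_grad(1)[OF C_smooth_on_has_derivative] .

lemma C_smooth_on_grad:
  fixes h :: "'a::euclidean_space \<Rightarrow> real"
  assumes S: "open S" and h: "C_smooth_on (Suc p) S h"
  shows "C_smooth_on p S (grad h)"
proof (rule C_smooth_on_cong[OF S])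
  show "C_smooth_on p S (\<lambda>x. \<Sum>b\<in>Basis. frechet_derivative h (at x) b *\<^sub>R b)"
    by (intro C_smooth_on_sum[OF S] C_smooth_on_scaleR[OF S] C_smooth_on_const) (use h in auto)
qed (rule has_derivative_imp_GDERIV_grad(3)[OF C_smooth_on_has_derivative[OF h], symmetric])

section \<open>Smooth dependence of inverse linear maps, and smooth local inverses\<close>

text \<open>At a zero of \<open>k\<close> the product rule asks only for continuity of
  \<open>m\<close>, since the change of \<open>m\<close> is multiplied by a quantity of first order.
  This serves to differentiate an inverse of which only continuity is known so far.\<close>

lemma has_derivative_scaleR_vanishing:
  fixes k :: "'a::real_normed_vector \<Rightarrow> real" and m :: "'a \<Rightarrow> 'b::real_normed_vector"
  assumes k: "(k has_derivative k') (at x)" and k0: "k x = 0" and m: "isCont m x"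
  shows "((\<lambda>y. k y *\<^sub>R m y) has_derivative (\<lambda>d. k' d *\<^sub>R m x)) (at x)"
proof -
  interpret k': bounded_linear k'
    using k has_derivative_bounded_linear by blast
  obtain K where K: "\<And>d. norm (k' d) \<le> norm d * K"
    using k'.pos_bounded by blast
  have 1: "((\<lambda>y. norm (k y - k x - k' (y - x)) / norm (y - x)) \<longlongrightarrow> 0) (at x)"
    using k by (simp add: has_derivative_iff_norm)
  have m': "(m \<longlongrightarrow> m x) (at x)"
    using m by (simp add: isCont_def)
  have 2: "((\<lambda>y. norm (k y - k x - k' (y - x)) / norm (y - x) * norm (m y) + K * norm (m y - m x)) \<longlongrightarrow> 0) (at x)"
    by (rule tendsto_eq_intros 1 m' refl | simp)+
  have "((\<lambda>y. norm (k y *\<^sub>R m y - k x *\<^sub>R m x - k' (y - x) *\<^sub>R m x) / norm (y - x)) \<longlongrightarrow> 0) (at x)"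
  proof (rule Lim_null_comparison[OF _ 2], simp add: eventually_at_filter, intro always_eventually allI impI)
    fix y assume "y \<noteq> x"
    have "k y *\<^sub>R m y - k x *\<^sub>R m x - k' (y - x) *\<^sub>R m x = (k y - k x - k' (y - x)) *\<^sub>R m y + k' (y - x) *\<^sub>R (m y - m x)"
      by (simp add: k0 algebra_simps)
    then have "norm (k y *\<^sub>R m y - k x *\<^sub>R m x - k' (y - x) *\<^sub>R m x) \<le>
      norm (k y - k x - k' (y - x)) * norm (m y) + norm (k' (y - x)) * norm (m y - m x)"
      by (metis norm_scaleR norm_triangle_ineq real_norm_def)
    also have "\<dots> \<le> norm (k y - k x - k' (y - x)) * norm (m y) + (norm (y - x) * K) * norm (m y - m x)"
      by (intro add_left_mono mult_right_mono K) auto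
    finally show "norm (k y *\<^sub>R m y - k x *\<^sub>R m x - k' (y - x) *\<^sub>R m x) / norm (y - x)
        \<le> \<bar>k y - k x - k' (y - x)\<bar> * norm (m y) / norm (y - x) + K * norm (m y - m x)"
      using \<open>y \<noteq> x\<close> by (simp add: field_simps)
  qed
  then show ?thesis
    by (auto simp: has_derivative_iff_norm intro: k'.bounded_linear bounded_linear_scaleR_left bounded_linear_compose[OF bounded_linear_scaleR_left])
qed

lemma linear_inv_of_bij:
  assumes "linear L" "bij L"
  shows "linear (inv L)"
proof -
  interpret linear L by fact
  have L: "L (inv L y) = y" for y
    using assms(2) by (simp add: bij_is_surj surj_f_inv_f)
  show ?thesis
    by (rule linearI; rule injD[OF bij_is_inj[OF assms(2)]]) (simp_all add: L add scale)
qed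

text \<open>Near \<open>x0\<close> the maps \<open>B x\<close> share the lower bound
  \<open>c / 2\<close>, so the displacement \<open>w\<close> of the solution is controlled by
  \<open>B x w = v - B x u0\<close>, which tends to zero.\<close>

lemma continuous_on_linear_inverse:
  fixes B :: "'a::metric_space \<Rightarrow> 'b::euclidean_space \<Rightarrow> 'b"
  assumes S: "open S" and lin: "\<And>x. x \<in> S \<Longrightarrow> linear (B x)" and bij: "\<And>x. x \<in> S \<Longrightarrow> bij (B x)"
    and B: "\<And>u. continuous_on S (\<lambda>x. B x u)"
  shows "continuous_on S (\<lambda>x. inv (B x) v)"
proof (rule continuous_at_imp_continuous_on, rule ballI)
  fix x0 assume x0: "x0 \<in> S"
  define u0 where "u0 = inv (B x0) v"
  have Bu0: "B x0 u0 = v"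
    using bij[OF x0] by (simp add: u0_def bij_is_surj surj_f_inv_f)
  obtain c where c: "c > 0" "\<And>u. c * norm u \<le> norm (B x0 u)"
    using linear_inj_bounded_below_pos[OF lin[OF x0]] bij[OF x0] by (metis bij_is_inj mult.commute)
  have cont: "((\<lambda>x. B x u) \<longlongrightarrow> B x0 u) (at x0)" for u
    using B[of u] S x0 by (auto simp: continuous_on_eq_continuous_at isCont_def)
  have "((\<lambda>x. \<Sum>b\<in>Basis. norm (B x b - B x0 b)) \<longlongrightarrow> 0) (at x0)"
    by (rule tendsto_eq_intros cont refl | simp)+
  then have "\<forall>\<^sub>F x in at x0. (\<Sum>b\<in>Basis. norm (B x b - B x0 b)) < c / 2"
    by (rule order_tendstoD(2)) (use c in simp)
  moreover have "\<forall>\<^sub>F x in at x0. x \<in> S"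
    using S x0 by (rule eventually_at_in_open')
  ultimately have ev: "\<forall>\<^sub>F x in at x0. norm (inv (B x) v - u0) \<le> 2 / c * norm (v - B x u0)"
  proof eventually_elim
    case (elim x)
    interpret linear "B x" by (rule lin[OF elim(2)])
    interpret B0: linear "B x0" by (rule lin[OF x0])
    define w where "w = inv (B x) v - u0"
    have "linear (\<lambda>u. B x u - B x0 u)"
      by (intro linear_compose_sub lin x0 elim)
    then have "norm (B x w - B x0 w) = norm (\<Sum>b\<in>Basis. (w \<bullet> b) *\<^sub>R (B x b - B x0 b))"
      using linear_sum_Basis by metis
    also have "\<dots> \<le> (\<Sum>b\<in>Basis. norm w * norm (B x b - B x0 b))"
      by (rule sum_norm_le) (simp add: mult_right_mono Basis_le_norm)
    also have "\<dots> \<le> norm w * (c / 2)"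
      unfolding sum_distrib_left[symmetric] using elim(1) by (intro mult_left_mono) auto
    finally have "norm (B x w) \<ge> c * norm w - norm w * (c / 2)"
      using c(2)[of w] norm_triangle_ineq2[of "B x0 w" "B x0 w - B x w"] norm_minus_commute[of "B x w" "B x0 w"]
      by (simp add: mult.commute)
    moreover have "B x w = v - B x u0"
      using bij[OF elim(2)] by (simp add: w_def diff bij_is_surj surj_f_inv_f)
    ultimately have "c * norm w \<le> 2 * norm (v - B x u0)"
      by (simp add: mult.commute)
    then show ?case
      using c(1) by (simp add: pos_le_divide_eq mult.commute flip: w_def)
  qed
  have "((\<lambda>x. 2 / c * norm (v - B x u0)) \<longlongrightarrow> 0) (at x0)"
    by (rule tendsto_eq_intros cont refl | simp add: Bu0)+
  from Lim_null_comparison[OF ev this] show "isCont (\<lambda>x. inv (B x) v) x0"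
    by (simp add: isCont_def u0_def LIM_zero_iff)
qed

text \<open>Writing the inverse as \<open>u0\<close> plus \<open>inv (B x)\<close> applied to
  \<open>v - B x u0\<close> puts all first-order change into a factor that vanishes at
  \<open>x0\<close>; the moving inverse need only be continuous.\<close>

lemma has_derivative_linear_inverse:
  fixes B :: "'a::euclidean_space \<Rightarrow> 'b::euclidean_space \<Rightarrow> 'b"
  assumes S: "open S" and lin: "\<And>x. x \<in> S \<Longrightarrow> linear (B x)" and bij: "\<And>x. x \<in> S \<Longrightarrow> bij (B x)"
    and B: "\<And>u x. x \<in> S \<Longrightarrow> ((\<lambda>x. B x u) has_derivative B' u x) (at x)" and x0: "x0 \<in> S"
  shows "((\<lambda>x. inv (B x) v) has_derivative (\<lambda>d. - inv (B x0) (B' (inv (B x0) v) x0 d))) (at x0)"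
proof -
  define u0 where "u0 = inv (B x0) v"
  have Bu0: "B x0 u0 = v"
    using bij[OF x0] by (simp add: u0_def bij_is_surj surj_f_inv_f)
  have lini: "linear (inv (B x))" if "x \<in> S" for x
    using linear_inv_of_bij[OF lin bij] that by blast
  have cont: "continuous_on S (\<lambda>x. inv (B x) b)" for b
    by (rule continuous_on_linear_inverse[OF S lin bij])
       (auto intro!: continuous_at_imp_continuous_on has_derivative_continuous[OF B])
  have "((\<lambda>x. u0 + (\<Sum>b\<in>Basis. ((v - B x u0) \<bullet> b) *\<^sub>R inv (B x) b)) has_derivative
      (\<lambda>d. 0 + (\<Sum>b\<in>Basis. ((0 - B' u0 x0 d) \<bullet> b) *\<^sub>R inv (B x0) b))) (at x0)"
    by (intro has_derivative_add has_derivative_sum has_derivative_scaleR_vanishing has_derivative_const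
        has_derivative_inner_left has_derivative_diff B x0)
       (use cont x0 S in \<open>auto simp: Bu0 continuous_on_eq_continuous_at\<close>)
  moreover have "u0 + (\<Sum>b\<in>Basis. ((v - B x u0) \<bullet> b) *\<^sub>R inv (B x) b) = inv (B x) v" if "x \<in> S" for x
  proof -
    interpret linear "inv (B x)" by (rule lini[OF that])
    show ?thesis
      using linear_sum_Basis[OF linear_axioms, of "v - B x u0", symmetric] bij[OF that]
      by (simp add: diff bij_is_inj inv_f_f)
  qed
  moreover have "(\<lambda>d. 0 + (\<Sum>b\<in>Basis. ((0 - B' u0 x0 d) \<bullet> b) *\<^sub>R inv (B x0) b)) =
      (\<lambda>d. - inv (B x0) (B' (inv (B x0) v) x0 d))"
    using linear_sum_Basis[OF lini[OF x0], symmetric] linear_neg[OF lini[OF x0]]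
    by (auto simp: u0_def fun_eq_iff sum_negf)
  ultimately show ?thesis
    using has_derivative_transform_within_open[OF _ S x0, of "\<lambda>x. u0 + (\<Sum>b\<in>Basis. ((v - B x u0) \<bullet> b) *\<^sub>R inv (B x) b)" _ UNIV
        "\<lambda>x. inv (B x) v"] by simp
qed

text \<open>The derivative formula contains only \<open>inv (B x)\<close> and directional
  derivatives of \<open>B\<close>, so smoothness of order \<open>p\<close> of the inverse passes to
  its own derivative.\<close>

lemma C_smooth_on_linear_inverse:
  fixes B :: "'a::euclidean_space \<Rightarrow> 'b::euclidean_space \<Rightarrow> 'b"
  assumes S: "open S" and lin: "\<And>x. x \<in> S \<Longrightarrow> linear (B x)" and bij: "\<And>x. x \<in> S \<Longrightarrow> bij (B x)"
    and B: "\<And>u. C_smooth_on p S (\<lambda>x. B x u)"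
  shows "C_smooth_on p S (\<lambda>x. inv (B x) v)"
  using B
proof (induction p arbitrary: v)
  case 0
  then show ?case
    using continuous_on_linear_inverse[OF S lin bij] by auto
next
  case (Suc p)
  define B' where "B' u x = frechet_derivative (\<lambda>x. B x u) (at x)" for u x
  have B': "((\<lambda>x. B x u) has_derivative B' u x) (at x)" if "x \<in> S" for u x
    using C_smooth_on_has_derivative[OF Suc.prems that] by (simp add: B'_def)
  have IH: "C_smooth_on p S (\<lambda>x. inv (B x) u)" for u
    by (rule Suc.IH[OF C_smooth_on_lower[OF Suc.prems]])
  have lini: "linear (inv (B x))" if "x \<in> S" for x
    using linear_inv_of_bij[OF lin bij] that by blast
  \<comment> \<open>The definition of \<open>B'\<close> does not show linearity in \<open>u\<close>;
    it is inherited from \<open>B x\<close> because derivatives are unique.\<close>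
  have linB': "linear (\<lambda>u. B' u x d)" if "x \<in> S" for x d
  proof (rule linearI)
    fix u w and c :: real
    have "((\<lambda>x. B x (u + w)) has_derivative (\<lambda>d. B' u x d + B' w x d)) (at x)"
      by (rule has_derivative_transform_within_open[OF has_derivative_add[OF B'[OF that] B'[OF that]] S that])
         (simp add: linear_add[OF lin])
    from fun_cong[OF has_derivative_unique[OF B'[OF that] this]]
    show "B' (u + w) x d = B' u x d + B' w x d" .
    have "((\<lambda>x. B x (c *\<^sub>R u)) has_derivative (\<lambda>d. c *\<^sub>R B' u x d)) (at x)"
      by (rule has_derivative_transform_within_open[OF has_derivative_scaleR_right[OF B'[OF that]] S that])
         (simp add: linear_cmul[OF lin])
    from fun_cong[OF has_derivative_unique[OF B'[OF that] this]]
    show "B' (c *\<^sub>R u) x d = c *\<^sub>R B' u x d" .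
  qed
  show ?case
  proof (rule C_smooth_on_SucI[OF S has_derivative_linear_inverse[OF S lin bij B']])
    fix d
    have B'C: "C_smooth_on p S (\<lambda>x. B' u x d)" for u
      using Suc.prems by (simp add: B'_def)
    have B'I: "C_smooth_on p S (\<lambda>x. B' (inv (B x) v) x d)"
      by (rule C_smooth_on_linear_apply[where L = "\<lambda>x u. B' u x d", OF S linB' B'C IH])
    have "C_smooth_on p S (\<lambda>x. inv (B x) (B' (inv (B x) v) x d))"
      by (rule C_smooth_on_linear_apply[where L = "\<lambda>x. inv (B x)", OF S lini IH B'I])
    from C_smooth_on_bounded_linear[OF S bounded_linear_minus[OF bounded_linear_ident] this]
    show "C_smooth_on p S (\<lambda>x. - inv (B x) (B' (inv (B x) v) x d))" .
  qed auto
qed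

text \<open>The inverse function theorem supplies a differentiable inverse. Its derivative at
  \<open>y\<close> is \<open>inv (D (g y))\<close>, so each order of smoothness of \<open>g\<close>
  yields the next one.\<close>

lemma C_smooth_on_local_inverse:
  fixes f :: "'a::euclidean_space \<Rightarrow> 'a"
  assumes U: "open U" "x0 \<in> U" and f: "C_smooth_on (Suc p) U f"
    and inj: "\<And>d. frechet_derivative f (at x0) d = 0 \<Longrightarrow> d = 0"
  obtains U' V g where "open U'" "U' \<subseteq> U" "x0 \<in> U'" "open V" "f x0 \<in> V" "homeomorphism U' V f g"
    "C_smooth_on (Suc p) V g"
    "\<And>x. x \<in> U' \<Longrightarrow> bij (frechet_derivative f (at x))"
    "\<And>x. x \<in> U' \<Longrightarrow> (g has_derivative inv (frechet_derivative f (at x))) (at (f x))"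
proof -
  define D where "D x = frechet_derivative f (at x)" for x
  have D: "(f has_derivative D x) (at x)" if "x \<in> U" for x
    using C_smooth_on_has_derivative[OF f that] by (simp add: D_def)
  have bl: "bounded_linear (D x)" if "x \<in> U" for x
    using D[OF that] has_derivative_bounded_linear by blast
  have ap: "blinfun_apply (Blinfun (D x)) = D x" if "x \<in> U" for x
    using bl[OF that] by (simp add: bounded_linear_Blinfun_apply)
  have DC: "C_smooth_on p U (\<lambda>x. D x v)" for v
    using f by (simp add: D_def)
  have lin0: "linear (D x0)"
    using bl U(2) bounded_linear.linear by blast
  have inj0: "inj (D x0)"
    using inj unfolding linear_injective_0[OF lin0] by (simp add: D_def)
  have surj0: "surj (D x0)"
    using linear_injective_imp_surjective[OF lin0 inj0] by simp
  have bli: "bounded_linear (inv (D x0))"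
    using linear_inv_of_bij[OF lin0] inj0 surj0 by (simp add: bij_def linear_conv_bounded_linear)
  obtain U' V g g' where UV: "open U'" "U' \<subseteq> U" "x0 \<in> U'" "open V" "f x0 \<in> V" "homeomorphism U' V f g"
    and g1: "\<And>y. y \<in> V \<Longrightarrow> (g has_derivative (g' y)) (at y)"
    and g2: "\<And>y. y \<in> V \<Longrightarrow> g' y = inv (blinfun_apply (Blinfun (D (g y))))"
    and g3: "\<And>y. y \<in> V \<Longrightarrow> bij (blinfun_apply (Blinfun (D (g y))))"
  proof (rule inverse_function_theorem[OF U(1) _ _ U(2)])
    show "(f has_derivative blinfun_apply (Blinfun (D x))) (at x)" if "x \<in> U" for x
      using D ap that by simp
    have "continuous_on U (\<lambda>x. blinfun_apply (Blinfun (D x)) i)" for i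
      using C_smooth_on_continuous[OF DC[of i]] ap continuous_on_cong[of U U "\<lambda>x. blinfun_apply (Blinfun (D x)) i" "\<lambda>x. D x i"]
      by auto
    \<comment> \<open>In finite dimension, continuity in the operator norm follows from continuity
      of the values at fixed vectors.\<close>
    then show "continuous_on U (\<lambda>x. Blinfun (D x))"
      by (rule continuous_on_blinfun_componentwise)
    show "Blinfun (inv (D x0)) o\<^sub>L Blinfun (D x0) = id_blinfun"
      by (rule blinfun_eqI) (simp add: ap[OF U(2)] bounded_linear_Blinfun_apply[OF bli] inj0)
  qed auto
  have gV: "g ` V = U'" and gf: "\<And>x. x \<in> U' \<Longrightarrow> g (f x) = x" and fU: "f ` U' = V"
    using UV(6) by (auto simp: homeomorphism_def)
  have bijD: "bij (D x)" and gD: "(g has_derivative inv (D x)) (at (f x))" if x: "x \<in> U'" for x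
  proof -
    have "f x \<in> V" "g (f x) = x" "blinfun_apply (Blinfun (D x)) = D x"
      using x fU gf ap UV(2) by blast+
    then show "bij (D x)" "(g has_derivative inv (D x)) (at (f x))"
      using g3[of "f x"] g1[of "f x"] g2[of "f x"] by simp_all
  qed
  have gD': "(g has_derivative inv (D (g y))) (at y)" if y: "y \<in> V" for y
  proof -
    obtain x where "x \<in> U'" "y = f x"
      using y fU by blast
    then show ?thesis
      using gD gf by simp
  qed
  have "C_smooth_on q V g" if "q \<le> Suc p" for q
    using that
  proof (induction q)
    case 0
    then show ?case
      using UV(6) by (simp add: homeomorphism_def)
  next
    case (Suc q)
    have "C_smooth_on q U' (\<lambda>x. D x u)" for u
      by (rule C_smooth_on_subset[OF C_smooth_on_mono[OF DC] UV(2)]) (use Suc.prems in simp)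
    then have inv: "C_smooth_on q U' (\<lambda>x. inv (D x) v)" for v
      using UV(2) bl bijD by (intro C_smooth_on_linear_inverse[OF UV(1)]) (auto intro: bounded_linear.linear)
    have "C_smooth_on q V g"
      using Suc by simp
    then have gC: "C_smooth_on q V (\<lambda>y. inv (D (g y)) v)" for v
      using C_smooth_on_compose[OF UV(4) _ inv] gV by simp
    show ?case
      by (rule C_smooth_on_SucI[OF UV(4) gD' gC])
  qed
  then have "C_smooth_on (Suc p) V g"
    by blast
  then show ?thesis
    by (rule that[OF UV _ bijD[unfolded D_def] gD[unfolded D_def]])
qed

section \<open>Subgradients of weakly convex functions\<close>

lemma regular_normal_cone_iff:
  "n \<in> regular_normal_cone Q x \<longleftrightarrow>
    (\<forall>\<epsilon>>0. \<forall>\<^sub>F y in at x within Q. n \<bullet> (y - x) \<le> \<epsilon> * norm (y - x))" (is "?l \<longleftrightarrow> ?r")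
proof
  assume l: ?l
  show ?r
  proof (intro allI impI)
    fix \<epsilon> :: real assume "\<epsilon> > 0"
    then have "\<forall>\<^sub>F y in at x within Q. ereal (n \<bullet> (y - x) / norm (y - x)) < ereal \<epsilon>"
      using l unfolding regular_normal_cone_def mem_Collect_eq Limsup_le_iff by (metis ereal_less(2))
    then show "\<forall>\<^sub>F y in at x within Q. n \<bullet> (y - x) \<le> \<epsilon> * norm (y - x)"
      unfolding eventually_at_filter
      by eventually_elim (auto simp: field_simps)
  qed
next
  assume r: ?r
  have "\<forall>\<^sub>F y in at x within Q. ereal (n \<bullet> (y - x) / norm (y - x)) < c" if c: "c > 0" for c
  proof -
    obtain e where e: "ereal e < c" "e > 0"
      using ereal_dense2[OF c] by (auto simp: zero_ereal_def)
    have "\<forall>\<^sub>F y in at x within Q. n \<bullet> (y - x) \<le> e * norm (y - x)"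
      using r e by blast
    then show ?thesis
      unfolding eventually_at_filter
    proof eventually_elim
      case (elim y)
      show ?case
      proof (intro impI)
        assume "y \<noteq> x" "y \<in> Q"
        then have "n \<bullet> (y - x) / norm (y - x) \<le> e"
          using elim by (simp add: field_simps)
        then show "ereal (n \<bullet> (y - x) / norm (y - x)) < c"
          using e(1) by (meson ereal_less_eq(3) le_less_trans)
      qed
    qed
  qed
  then show ?l
    by (simp add: regular_normal_cone_def Limsup_le_iff)
qed

text \<open>This replaces the normal cone by an affine minorant with a first-order error. If the
  minorant failed at \<open>y\<close>, the point \<open>(y, t)\<close> with \<open>t\<close> on the
  minorant would lie in the epigraph and contradict normality.\<close>

lemma subdiff_iff:
  fixes \<phi> :: "'a::euclidean_space \<Rightarrow> ereal"
  assumes a: "\<phi> x = ereal a"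
  shows "\<nu> \<in> subdiff \<phi> x \<longleftrightarrow>
    (\<forall>\<epsilon>>0. \<forall>\<^sub>F y in nhds x. ereal (a + \<nu> \<bullet> (y - x) - \<epsilon> * norm (y - x)) \<le> \<phi> y)" (is "?l \<longleftrightarrow> ?r")
proof
  assume l: ?l
  show ?r
  proof (intro allI impI)
    fix \<epsilon> :: real assume \<epsilon>: "\<epsilon> > 0"
    \<comment> \<open>\<open>C\<close> bounds \<open>norm ((y, t) - (x, a))\<close> by a multiple of
      \<open>norm (y - x)\<close>. The tolerance \<open>\<epsilon> / (2 * C)\<close> then allows
      only half of \<open>\<epsilon>\<close>, whereas a violation produces all of it.\<close>
    define C where "C = 1 + norm \<nu> + \<epsilon>"
    have C: "C > 0" "C \<ge> 1"
      using \<epsilon> by (auto simp: C_def add_pos_nonneg add_nonneg_pos)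
    have "\<forall>\<^sub>F q in at (x, a) within epi \<phi>. (\<nu>, -1) \<bullet> (q - (x, a)) \<le> \<epsilon> / (2 * C) * norm (q - (x, a))"
    proof -
      have "(\<nu>, -1) \<in> regular_normal_cone (epi \<phi>) (x, a)" "\<epsilon> / (2 * C) > 0"
        using l a \<epsilon> C by (simp_all add: subdiff_def)
      then show ?thesis
        unfolding regular_normal_cone_iff by blast
    qed
    then obtain \<delta> where \<delta>: "\<delta> > 0"
      "\<And>q. q \<in> epi \<phi> \<Longrightarrow> q \<noteq> (x, a) \<Longrightarrow> dist q (x, a) < \<delta> \<Longrightarrow>
          (\<nu>, -1) \<bullet> (q - (x, a)) \<le> \<epsilon> / (2 * C) * norm (q - (x, a))"
      by (auto simp: eventually_at)
    have "ereal (a + \<nu> \<bullet> (y - x) - \<epsilon> * norm (y - x)) \<le> \<phi> y" if y: "dist y x < \<delta> / C" for y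
    proof (rule ccontr)
      define t where "t = a + \<nu> \<bullet> (y - x) - \<epsilon> * norm (y - x)"
      assume "\<not> ?thesis"
      then have "\<phi> y < ereal t" and neq: "y \<noteq> x"
        using a by (auto simp: t_def)
      then have epi: "(y, t) \<in> epi \<phi>"
        by (simp add: epi_def)
      have "\<bar>t - a\<bar> \<le> norm \<nu> * norm (y - x) + \<epsilon> * norm (y - x)"
        using Cauchy_Schwarz_ineq2[of \<nu> "y - x"] mult_nonneg_nonneg[OF less_imp_le[OF \<epsilon>] norm_ge_zero[of "y - x"]]
        unfolding t_def by linarith
      then have n: "norm ((y, t) - (x, a)) \<le> C * norm (y - x)"
        using norm_Pair_le[of "y - x" "t - a"] by (simp add: C_def algebra_simps)
      also have "\<dots> < \<delta>"
        using y C by (simp add: dist_norm field_simps)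
      finally have "(\<nu>, -1) \<bullet> ((y, t) - (x, a)) \<le> \<epsilon> / (2 * C) * norm ((y, t) - (x, a))"
        using \<delta>(2)[OF epi] neq by (simp add: dist_norm)
      also have "\<dots> \<le> \<epsilon> / (2 * C) * (C * norm (y - x))"
        using n \<epsilon> C by (intro mult_left_mono) auto
      finally have "\<epsilon> * norm (y - x) \<le> \<epsilon> / 2 * norm (y - x)"
        using C by (simp add: t_def)
      then show False
        using \<epsilon> neq by simp
    qed
    then show "\<forall>\<^sub>F y in nhds x. ereal (a + \<nu> \<bullet> (y - x) - \<epsilon> * norm (y - x)) \<le> \<phi> y"
      using \<delta>(1) C by (auto simp: eventually_nhds_metric intro!: exI[of _ "\<delta> / C"])
  qed
next
  assume r: ?r
  have "\<forall>\<^sub>F q in at (x, a) within epi \<phi>. (\<nu>, -1) \<bullet> (q - (x, a)) \<le> \<epsilon> * norm (q - (x, a))" if \<epsilon>: "\<epsilon> > 0" for \<epsilon>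
  proof -
    obtain \<delta> where \<delta>: "\<delta> > 0"
      "\<And>y. dist y x < \<delta> \<Longrightarrow> ereal (a + \<nu> \<bullet> (y - x) - \<epsilon> * norm (y - x)) \<le> \<phi> y"
      using r \<epsilon> by (auto simp: eventually_nhds_metric)
    have "(\<nu>, -1) \<bullet> ((y, t) - (x, a)) \<le> \<epsilon> * norm ((y, t) - (x, a))"
      if "(y, t) \<in> epi \<phi>" "dist (y, t) (x, a) < \<delta>" for y t
    proof -
      have "dist y x < \<delta>"
        using that(2) dist_fst_le[of "(y, t)" "(x, a)"] by simp
      then have "ereal (a + \<nu> \<bullet> (y - x) - \<epsilon> * norm (y - x)) \<le> ereal t"
        by (rule order_trans[OF \<delta>(2)]) (use that(1) in \<open>simp add: epi_def\<close>)
      then have "\<nu> \<bullet> (y - x) - (t - a) \<le> \<epsilon> * norm (y - x)"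
        by simp
      also have "\<dots> \<le> \<epsilon> * norm ((y, t) - (x, a))"
        using \<epsilon> norm_fst_le[of "y - x" "t - a"] by simp
      finally show ?thesis by simp
    qed
    then show ?thesis
      using \<delta>(1) by (auto simp: eventually_at intro!: exI[of _ \<delta>])
  qed
  then show ?l
    using a by (auto simp: subdiff_def regular_normal_cone_iff)
qed

lemma subdiff_add_differentiable:
  fixes k :: "'a::euclidean_space \<Rightarrow> real"
  assumes k: "GDERIV k x :> u" and a: "\<phi> x = ereal a" and v: "\<nu> \<in> subdiff \<phi> x"
  shows "u + \<nu> \<in> subdiff (\<lambda>y. ereal (k y) + \<phi> y) x"
proof -
  have bound: "ereal (k x + a + (u + \<nu>) \<bullet> (y - x) - \<epsilon> * norm (y - x)) \<le> ereal (k y) + \<phi> y"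
    if "norm (k y - k x - (y - x) \<bullet> u) \<le> \<epsilon> / 2 * norm (y - x)"
      "ereal (a + \<nu> \<bullet> (y - x) - \<epsilon> / 2 * norm (y - x)) \<le> \<phi> y" for y \<epsilon>
  proof -
    have "ereal (k x + a + (u + \<nu>) \<bullet> (y - x) - \<epsilon> * norm (y - x)) \<le>
        ereal (k y) + ereal (a + \<nu> \<bullet> (y - x) - \<epsilon> / 2 * norm (y - x))"
    proof -
      have "\<bar>k y - k x - u \<bullet> (y - x)\<bar> \<le> \<epsilon> / 2 * norm (y - x)"
        using that(1) by (simp add: inner_commute)
      then have "k x + a + (u + \<nu>) \<bullet> (y - x) - \<epsilon> * norm (y - x) \<le> k y + (a + \<nu> \<bullet> (y - x) - \<epsilon> / 2 * norm (y - x))"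
        unfolding inner_add_left by (simp only: abs_le_iff) linarith
      then show ?thesis by simp
    qed
    also have "\<dots> \<le> ereal (k y) + \<phi> y"
      by (intro add_left_mono that)
    finally show ?thesis .
  qed
  have ev1: "\<forall>\<^sub>F y in nhds x. norm (k y - k x - (y - x) \<bullet> u) \<le> \<epsilon> / 2 * norm (y - x)" if "\<epsilon> > 0" for \<epsilon>
    using k half_gt_zero[OF that] unfolding gderiv_def has_derivative_at_alt eventually_nhds_metric dist_norm
    by blast
  have ev2: "\<forall>\<^sub>F y in nhds x. ereal (a + \<nu> \<bullet> (y - x) - \<epsilon> / 2 * norm (y - x)) \<le> \<phi> y" if "\<epsilon> > 0" for \<epsilon>
    using v half_gt_zero[OF that] unfolding subdiff_iff[where \<phi>=\<phi>, OF a] by blast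
  have "\<forall>\<^sub>F y in nhds x. ereal (k x + a + (u + \<nu>) \<bullet> (y - x) - \<epsilon> * norm (y - x)) \<le> ereal (k y) + \<phi> y"
    if "\<epsilon> > 0" for \<epsilon>
    using ev1[OF that] ev2[OF that] by eventually_elim (rule bound)
  moreover have "ereal (k x) + \<phi> x = ereal (k x + a)"
    using a by simp
  ultimately show ?thesis
    using subdiff_iff[of "\<lambda>y. ereal (k y) + \<phi> y" x "k x + a" "u + \<nu>"] by blast
qed

text \<open>The reverse inclusion is the forward one for \<open>- k\<close>: adding
  \<open>- k\<close> after \<open>k\<close> restores \<open>\<phi>\<close> even at infinite values,
  because \<open>k\<close> is finite.\<close>

lemma subdiff_add_differentiable_eq:
  fixes k :: "'a::euclidean_space \<Rightarrow> real"
  assumes k: "GDERIV k x :> u" and a: "\<phi> x = ereal a"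
  shows "subdiff (\<lambda>y. ereal (k y) + \<phi> y) x = (+) u ` subdiff \<phi> x"
proof (rule set_eqI, rule iffI)
  fix w assume w: "w \<in> subdiff (\<lambda>y. ereal (k y) + \<phi> y) x"
  have "ereal (- k y) + (ereal (k y) + \<phi> y) = \<phi> y" for y
    by (cases "\<phi> y") auto
  then have "- u + w \<in> subdiff \<phi> x"
    using subdiff_add_differentiable[OF GDERIV_minus[OF k] _ w, of "k x + a"] a by simp
  then show "w \<in> (+) u ` subdiff \<phi> x"
    by (metis add.commute add_uminus_conv_diff diff_add_cancel rev_image_eqI)
next
  fix w assume "w \<in> (+) u ` subdiff \<phi> x"
  then show "w \<in> subdiff (\<lambda>y. ereal (k y) + \<phi> y) x"
    using subdiff_add_differentiable[of k x u \<phi> a] k a by blast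
qed

lemma norm_convex_combination:
  fixes x y :: "'a::real_inner"
  shows "(norm ((1 - s) *\<^sub>R x + s *\<^sub>R y))\<^sup>2 = (1 - s) * (norm x)\<^sup>2 + s * (norm y)\<^sup>2 - s * (1 - s) * (norm (y - x))\<^sup>2"
  by (simp add: power2_norm_eq_inner inner_simps inner_commute[of y x] algebra_simps)

lemma weakly_convexD:
  assumes wc: "weakly_convex \<sigma> g" and x: "g x \<le> ereal a" and y: "g y \<le> ereal b" and s: "0 \<le> s" "s \<le> 1"
  shows "g ((1 - s) *\<^sub>R x + s *\<^sub>R y) \<le> ereal ((1 - s) * a + s * b + \<sigma> / 2 * (s * (1 - s) * (norm (y - x))\<^sup>2))"
proof -
  define z where "z = (1 - s) *\<^sub>R x + s *\<^sub>R y"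
  let ?E = "epi (\<lambda>x. g x + ereal (\<sigma> / 2 * (norm x)\<^sup>2))"
  have "(x, a + \<sigma> / 2 * (norm x)\<^sup>2) \<in> ?E" "(y, b + \<sigma> / 2 * (norm y)\<^sup>2) \<in> ?E"
    using add_right_mono[OF x] add_right_mono[OF y] by (auto simp: epi_def simp flip: plus_ereal.simps(1))
  then have "(1 - s) *\<^sub>R (x, a + \<sigma> / 2 * (norm x)\<^sup>2) + s *\<^sub>R (y, b + \<sigma> / 2 * (norm y)\<^sup>2) \<in> ?E"
    using wc s by (intro convexD) (auto simp: weakly_convex_def convex_fun_def)
  then have "g z + ereal (\<sigma> / 2 * (norm z)\<^sup>2) \<le>
      ereal ((1 - s) * (a + \<sigma> / 2 * (norm x)\<^sup>2) + s * (b + \<sigma> / 2 * (norm y)\<^sup>2))"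
    by (simp add: epi_def z_def)
  then have "g z \<le> ereal ((1 - s) * (a + \<sigma> / 2 * (norm x)\<^sup>2) + s * (b + \<sigma> / 2 * (norm y)\<^sup>2) - \<sigma> / 2 * (norm z)\<^sup>2)"
    by (cases "g z") auto
  also have "(1 - s) * (a + \<sigma> / 2 * (norm x)\<^sup>2) + s * (b + \<sigma> / 2 * (norm y)\<^sup>2) - \<sigma> / 2 * (norm z)\<^sup>2 =
      (1 - s) * a + s * b + \<sigma> / 2 * (s * (1 - s) * (norm (y - x))\<^sup>2)"
    unfolding z_def norm_convex_combination by (simp add: field_simps)
  finally show ?thesis
    by (simp add: z_def)
qed

text \<open>The local inequality is tested at a point \<open>x + s d\<close> of the segment to
  \<open>y\<close>. Weak convexity bounds \<open>g\<close> there by its values at the ends, and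
  division by \<open>s\<close> carries the inequality to \<open>y\<close>.\<close>

lemma subdiff_weakly_convex_iff:
  fixes g :: "'a::euclidean_space \<Rightarrow> ereal"
  assumes wc: "weakly_convex \<sigma> g" and \<sigma>: "0 \<le> \<sigma>" and proper: "\<And>x. g x \<noteq> -\<infinity>" and a: "g x = ereal a"
  shows "\<nu> \<in> subdiff g x \<longleftrightarrow> (\<forall>y. ereal (a + \<nu> \<bullet> (y - x) - \<sigma> / 2 * (norm (y - x))\<^sup>2) \<le> g y)" (is "?l \<longleftrightarrow> ?r")
proof
  assume l: ?l
  show ?r
  proof
    fix y
    show "ereal (a + \<nu> \<bullet> (y - x) - \<sigma> / 2 * (norm (y - x))\<^sup>2) \<le> g y"
    proof (cases "g y")
      case (real b)
      define d where "d = y - x"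
      have "a + \<nu> \<bullet> d - \<sigma> / 2 * (norm d)\<^sup>2 \<le> b + e" if e: "e > 0" for e
      proof -
        \<comment> \<open>Scaled so that the local error costs at most \<open>e\<close> over the
          whole length of \<open>d\<close>.\<close>
        define \<epsilon> where "\<epsilon> = e / (norm d + 1)"
        have \<epsilon>: "\<epsilon> > 0" "\<epsilon> * norm d \<le> e"
          using e by (auto simp: \<epsilon>_def pos_divide_le_eq add_nonneg_pos distrib_left)
        have ev: "\<forall>\<^sub>F y in nhds x. ereal (a + \<nu> \<bullet> (y - x) - \<epsilon> * norm (y - x)) \<le> g y"
          using l \<epsilon> unfolding subdiff_iff[where \<phi>=g, OF a] by blast
        have "((\<lambda>s. x + s *\<^sub>R d) \<longlongrightarrow> x + 0 *\<^sub>R d) (at_right 0)"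
          by (intro tendsto_intros)
        then have "((\<lambda>s. x + s *\<^sub>R d) \<longlongrightarrow> x) (at_right 0)"
          by simp
        from filterlim_iff[THEN iffD1, OF this, rule_format, OF ev]
        have "\<forall>\<^sub>F s in at_right 0. ereal (a + \<nu> \<bullet> (x + s *\<^sub>R d - x) - \<epsilon> * norm (x + s *\<^sub>R d - x)) \<le> g (x + s *\<^sub>R d)" .
        moreover have "\<forall>\<^sub>F s in at_right 0. 0 < s \<and> s < (1::real)"
          by (auto simp: eventually_at_right_field intro!: exI[of _ 1])
        ultimately have "\<forall>\<^sub>F s in at_right 0. 0 < s \<and> s < 1 \<and>
            ereal (a + \<nu> \<bullet> (x + s *\<^sub>R d - x) - \<epsilon> * norm (x + s *\<^sub>R d - x)) \<le> g (x + s *\<^sub>R d)"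
          by eventually_elim simp
        then obtain s where s: "0 < s" "s < 1"
          "ereal (a + \<nu> \<bullet> (x + s *\<^sub>R d - x) - \<epsilon> * norm (x + s *\<^sub>R d - x)) \<le> g (x + s *\<^sub>R d)"
          using eventually_happens by force
        have "(1 - s) *\<^sub>R x + s *\<^sub>R y = x + s *\<^sub>R d"
          by (simp add: d_def algebra_simps)
        then have "g (x + s *\<^sub>R d) \<le> ereal ((1 - s) * a + s * b + \<sigma> / 2 * (s * (1 - s) * (norm (y - x))\<^sup>2))"
          using weakly_convexD[OF wc, of x a y b s] s a real by simp
        from order_trans[OF s(3) this] have "s * (a + \<nu> \<bullet> d - \<epsilon> * norm d) \<le> s * (b + \<sigma> / 2 * ((1 - s) * (norm d)\<^sup>2))"
          using s by (simp add: d_def[symmetric] field_simps)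
        then have "a + \<nu> \<bullet> d - \<epsilon> * norm d \<le> b + \<sigma> / 2 * ((1 - s) * (norm d)\<^sup>2)"
          using s by simp
        also have "\<dots> \<le> b + \<sigma> / 2 * (1 * (norm d)\<^sup>2)"
          using s \<sigma> by (intro add_left_mono mult_left_mono mult_right_mono) auto
        finally show ?thesis
          using \<epsilon> by simp
      qed
      then have "a + \<nu> \<bullet> d - \<sigma> / 2 * (norm d)\<^sup>2 \<le> b"
        by (rule field_le_epsilon)
      then show ?thesis
        by (simp add: real d_def)
    qed (use proper in auto)
  qed
next
  assume r: ?r
  have "\<forall>\<^sub>F y in nhds x. ereal (a + \<nu> \<bullet> (y - x) - \<epsilon> * norm (y - x)) \<le> g y" if \<epsilon>: "\<epsilon> > 0" for \<epsilon>
  proof -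
    have "ereal (a + \<nu> \<bullet> (y - x) - \<epsilon> * norm (y - x)) \<le> g y" if y: "dist y x < \<epsilon> / (\<sigma> + 1)" for y
    proof -
      have "\<sigma> * norm (y - x) \<le> \<epsilon>"
        using y \<sigma> \<epsilon> norm_ge_zero[of "y - x"] by (simp add: dist_norm field_simps del: norm_ge_zero)
      then have "\<sigma> / 2 * norm (y - x) \<le> \<epsilon>"
        using \<epsilon> by simp
      then have "\<sigma> / 2 * (norm (y - x))\<^sup>2 \<le> \<epsilon> * norm (y - x)"
        by (simp add: power2_eq_square mult_right_mono flip: mult.assoc times_divide_eq_left)
      then have "ereal (a + \<nu> \<bullet> (y - x) - \<epsilon> * norm (y - x)) \<le> ereal (a + \<nu> \<bullet> (y - x) - \<sigma> / 2 * (norm (y - x))\<^sup>2)"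
        by simp
      also have "\<dots> \<le> g y"
        using r by blast
      finally show ?thesis .
    qed
    moreover have "\<epsilon> / (\<sigma> + 1) > 0"
      using \<epsilon> \<sigma> by simp
    ultimately show ?thesis
      by (auto simp: eventually_nhds_metric)
  qed
  then show ?l
    unfolding subdiff_iff[where \<phi>=g, OF a] by blast
qed

lemma
  fixes g :: "'a::euclidean_space \<Rightarrow> ereal"
  assumes wc: "weakly_convex \<sigma> g" and \<sigma>: "0 \<le> \<sigma>" and proper: "\<And>x. g x \<noteq> -\<infinity>" and a: "g x = ereal a"
  shows closed_subdiff_weakly_convex: "closed (subdiff g x)"
    and convex_subdiff_weakly_convex: "convex (subdiff g x)"
proof -
  let ?S = "\<lambda>y. {\<nu>. ereal (a + \<nu> \<bullet> (y - x) - \<sigma> / 2 * (norm (y - x))\<^sup>2) \<le> g y}"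
  have eq: "subdiff g x = (\<Inter>y. ?S y)"
    by (auto simp: subdiff_weakly_convex_iff[OF assms])
  have S: "?S y = UNIV \<or> (\<exists>b. ?S y = {\<nu>. (y - x) \<bullet> \<nu> \<le> b})" for y
  proof (cases "g y")
    case (real b)
    then have "?S y = {\<nu>. (y - x) \<bullet> \<nu> \<le> b - a + \<sigma> / 2 * (norm (y - x))\<^sup>2}"
      by (auto simp: inner_commute algebra_simps)
    then show ?thesis by blast
  qed (use proper in auto)
  have "closed (?S y)" "convex (?S y)" for y
    using S[of y] closed_halfspace_le convex_halfspace_le by (metis closed_UNIV convex_UNIV)+
  then show "closed (subdiff g x)" "convex (subdiff g x)"
    unfolding eq by (auto intro: closed_INT convex_INT)
qed

section \<open>Proximal mappings at points given by subgradients\<close>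

text \<open>Strictness is essential: \<open>prox\<close> chooses among minimisers, so its value is
  determined only where there is exactly one.\<close>

lemma prox_eqI:
  assumes "\<And>u. u \<noteq> y \<Longrightarrow>
    \<phi> y + ereal (1 / (2 * \<beta>) * (norm (y - x))\<^sup>2) < \<phi> u + ereal (1 / (2 * \<beta>) * (norm (u - x))\<^sup>2)"
  shows "prox \<beta> \<phi> x = y"
  unfolding prox_def arg_min_def
proof (rule some_equality)
  show "is_arg_min (\<lambda>y. \<phi> y + ereal (1 / (2 * \<beta>) * (norm (y - x))\<^sup>2)) (\<lambda>y. True) y"
    unfolding is_arg_min_def using assms by (metis not_less_iff_gr_or_eq)
next
  fix u assume "is_arg_min (\<lambda>y. \<phi> y + ereal (1 / (2 * \<beta>) * (norm (y - x))\<^sup>2)) (\<lambda>y. True) u"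
  then show "u = y"
    unfolding is_arg_min_def using assms by blast
qed

text \<open>The proximal term of curvature \<open>1 / \<beta>\<close> beats the defect
  \<open>\<sigma>\<close> of convexity, and the shift of the centre by \<open>\<beta> v\<close>
  makes the linear terms cancel.\<close>

lemma prox_add_scaleR_subgradient:
  assumes \<beta>: "0 < \<beta>" "\<beta> * \<sigma> < 1" and a: "\<phi> y = ereal a"
    and v: "\<And>u. ereal (a + v \<bullet> (u - y) - \<sigma> / 2 * (norm (u - y))\<^sup>2) \<le> \<phi> u"
  shows "prox \<beta> \<phi> (y + \<beta> *\<^sub>R v) = y"
proof (rule prox_eqI)
  fix u assume u: "u \<noteq> y"
  define d where "d = u - y"
  have n: "(norm (u - (y + \<beta> *\<^sub>R v)))\<^sup>2 = (norm d)\<^sup>2 - 2 * \<beta> * (v \<bullet> d) + \<beta>\<^sup>2 * (norm v)\<^sup>2"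
  proof -
    have "u - (y + \<beta> *\<^sub>R v) = d - \<beta> *\<^sub>R v"
      by (simp add: d_def)
    moreover have "(norm (d - \<beta> *\<^sub>R v))\<^sup>2 = (norm d)\<^sup>2 - 2 * \<beta> * (v \<bullet> d) + \<beta>\<^sup>2 * (norm v)\<^sup>2"
      by (simp add: power2_norm_eq_inner inner_diff_left inner_diff_right inner_commute[of d v] power2_eq_square[of \<beta>] algebra_simps)
    ultimately show ?thesis
      by metis
  qed
  have "\<beta> * \<sigma> * (norm d)\<^sup>2 < 1 * (norm d)\<^sup>2"
    using u \<beta> by (intro mult_strict_right_mono) (auto simp: d_def)
  then have pos: "\<sigma> / 2 * (norm d)\<^sup>2 < 1 / (2 * \<beta>) * (norm d)\<^sup>2"
    using \<beta> by (simp add: field_simps)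
  have "1 / (2 * \<beta>) * (\<beta>\<^sup>2 * (norm v)\<^sup>2) <
      v \<bullet> d - \<sigma> / 2 * (norm d)\<^sup>2 + 1 / (2 * \<beta>) * ((norm d)\<^sup>2 - 2 * \<beta> * (v \<bullet> d) + \<beta>\<^sup>2 * (norm v)\<^sup>2)"
    using pos \<beta> by (simp add: distrib_left right_diff_distrib)
  then have "\<phi> y + ereal (1 / (2 * \<beta>) * (norm (y - (y + \<beta> *\<^sub>R v)))\<^sup>2) <
      ereal (a + v \<bullet> d - \<sigma> / 2 * (norm d)\<^sup>2) + ereal (1 / (2 * \<beta>) * (norm (u - (y + \<beta> *\<^sub>R v)))\<^sup>2)"
    unfolding n a by (simp add: power_mult_distrib)
  also have "\<dots> \<le> \<phi> u + ereal (1 / (2 * \<beta>) * (norm (u - (y + \<beta> *\<^sub>R v)))\<^sup>2)"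
    using v by (intro add_right_mono) (auto simp: d_def)
  finally show "\<phi> y + ereal (1 / (2 * \<beta>) * (norm (y - (y + \<beta> *\<^sub>R v)))\<^sup>2) <
      \<phi> u + ereal (1 / (2 * \<beta>) * (norm (u - (y + \<beta> *\<^sub>R v)))\<^sup>2)" .
qed

text \<open>The lower half of the descent lemma. It lets \<open>prox_add_scaleR_subgradient\<close>
  apply to \<open>f\<close>, with \<open>L\<close> in place of \<open>\<sigma>\<close>.\<close>

lemma lipschitz_grad_lower_bound:
  fixes f :: "'a::euclidean_space \<Rightarrow> real"
  assumes f: "\<And>x. GDERIV f x :> grad f x" and L: "L-lipschitz_on UNIV (grad f)"
  shows "f y + grad f y \<bullet> (u - y) - L / 2 * (norm (u - y))\<^sup>2 \<le> f u"
proof -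
  define d where "d = u - y"
  \<comment> \<open>The quadratic term absorbs the variation of the gradient and makes
    \<open>\<phi>\<close> nondecreasing for nonnegative \<open>s\<close>; the claim compares
    \<open>\<phi> 0\<close> with \<open>\<phi> 1\<close>.\<close>
  define \<phi> where "\<phi> s = f (y + s *\<^sub>R d) - s * (grad f y \<bullet> d) + L / 2 * s\<^sup>2 * (norm d)\<^sup>2" for s :: real
  have "(\<phi> has_real_derivative (d \<bullet> grad f (y + s *\<^sub>R d) - grad f y \<bullet> d + L * s * (norm d)\<^sup>2)) (at s)" for s
  proof -
    have "((\<lambda>s. f (y + s *\<^sub>R d)) has_derivative (\<lambda>h. (h *\<^sub>R d) \<bullet> grad f (y + s *\<^sub>R d))) (at s)"
      by (rule has_derivative_compose[OF _ f[unfolded gderiv_def]]) (auto intro!: derivative_eq_intros)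
    then have "((\<lambda>s. f (y + s *\<^sub>R d)) has_real_derivative d \<bullet> grad f (y + s *\<^sub>R d)) (at s)"
      by (simp add: has_field_derivative_def mult_commute_abs)
    then show ?thesis
      unfolding \<phi>_def by (auto intro!: derivative_eq_intros)
  qed
  moreover have "d \<bullet> grad f (y + s *\<^sub>R d) - grad f y \<bullet> d + L * s * (norm d)\<^sup>2 \<ge> 0" if "0 \<le> s" for s
  proof -
    have "- (d \<bullet> (grad f (y + s *\<^sub>R d) - grad f y)) \<le> norm d * norm (grad f (y + s *\<^sub>R d) - grad f y)"
      using Cauchy_Schwarz_ineq2[of d "grad f (y + s *\<^sub>R d) - grad f y"] by simp
    also have "\<dots> \<le> norm d * (L * norm (s *\<^sub>R d))"
      using lipschitz_onD[OF L, of "y + s *\<^sub>R d" y] by (intro mult_left_mono) (auto simp: dist_norm)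
    finally show ?thesis
      using that by (simp add: inner_diff_right inner_commute[of "grad f y"] power2_eq_square ac_simps)
  qed
  ultimately have "\<phi> 0 \<le> \<phi> 1"
    by (intro DERIV_nonneg_imp_nondecreasing[of 0 1 \<phi>]) auto
  then show ?thesis
    by (simp add: \<phi>_def d_def)
qed

lemma
  fixes f :: "'a::euclidean_space \<Rightarrow> real"
  assumes f: "\<And>x. GDERIV f x :> grad f x" and L: "L-lipschitz_on UNIV (grad f)"
    and \<beta>: "0 < \<beta>" "\<beta> * L < 1"
  shows prox_add_scaleR_grad: "prox \<beta> (\<lambda>y. ereal (f y)) (y + \<beta> *\<^sub>R grad f y) = y"
    and prox_add_scaleR_grad_prox:
      "prox \<beta> (\<lambda>y. ereal (f y)) z + \<beta> *\<^sub>R grad f (prox \<beta> (\<lambda>y. ereal (f y)) z) = z"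
proof -
  show p: "prox \<beta> (\<lambda>y. ereal (f y)) (y + \<beta> *\<^sub>R grad f y) = y" for y
    by (rule prox_add_scaleR_subgradient[OF \<beta> refl]) (use lipschitz_grad_lower_bound[OF f L] in simp)
  \<comment> \<open>Solving \<open>y + \<beta> grad f y = z\<close> is a fixed-point problem for a
    contraction of ratio \<open>\<beta> * L\<close>.\<close>
  have "\<exists>!y. z - \<beta> *\<^sub>R grad f y = y"
  proof (rule banach_fix_type[OF _ \<beta>(2)])
    show "0 \<le> \<beta> * L"
      using \<beta> lipschitz_on_nonneg[OF L] by simp
    show "\<forall>x y. dist (z - \<beta> *\<^sub>R grad f x) (z - \<beta> *\<^sub>R grad f y) \<le> \<beta> * L * dist x y"
    proof (intro allI)
      fix x y
      have "dist (z - \<beta> *\<^sub>R grad f x) (z - \<beta> *\<^sub>R grad f y) = norm (\<beta> *\<^sub>R (grad f y - grad f x))"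
        by (simp add: dist_norm scaleR_diff_right)
      also have "\<dots> = \<beta> * dist (grad f x) (grad f y)"
        using \<beta> by (simp add: dist_norm norm_minus_commute)
      also have "\<dots> \<le> \<beta> * (L * dist x y)"
        using lipschitz_onD[OF L] \<beta> by (intro mult_left_mono) auto
      finally show "dist (z - \<beta> *\<^sub>R grad f x) (z - \<beta> *\<^sub>R grad f y) \<le> \<beta> * L * dist x y"
        by simp
    qed
  qed
  then obtain y where "y + \<beta> *\<^sub>R grad f y = z"
    by (metis diff_add_cancel)
  then show "prox \<beta> (\<lambda>y. ereal (f y)) z + \<beta> *\<^sub>R grad f (prox \<beta> (\<lambda>y. ereal (f y)) z) = z"
    using p by metis
qed

section \<open>Subderivatives and charts of a manifold\<close>

text \<open>If \<open>(u, c)\<close> lay outside the closure of the cone over the convexified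
  epigraph, a separating functional would yield a subgradient \<open>s\<close> with
  \<open>s \<bullet> u > c\<close>. Points of the cone near \<open>(u, c)\<close>, in turn, give
  directions near \<open>u\<close> with difference quotients below any
  \<open>c' > c\<close>.\<close>

lemma subderivative_le_support:
  fixes g :: "'a::euclidean_space \<Rightarrow> ereal"
  assumes wc: "weakly_convex \<sigma> g" and \<sigma>: "0 \<le> \<sigma>" and proper: "\<And>x. g x \<noteq> -\<infinity>" and a: "g x = ereal a"
    and s0: "s0 \<in> subdiff g x" and supp: "\<And>s. s \<in> subdiff g x \<Longrightarrow> s \<bullet> u \<le> c"
  shows "subderivative g x u \<le> ereal c"
proof -
  \<comment> \<open>The epigraph of \<open>g\<close> moved to the origin, after adding the term
    \<open>\<sigma> / 2 * (norm d)^2\<close> centred at \<open>x\<close> that makes it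
    convex.\<close>
  define C where "C = {(d, t). g (x + d) \<le> ereal (a + t - \<sigma> / 2 * (norm d)\<^sup>2)}"
  define K where "K = cone hull C"
  note sub = subdiff_weakly_convex_iff[OF wc \<sigma> proper a]
  have "convex C"
    unfolding convex_alt
  proof (clarify)
    fix d1 t1 d2 t2 and s :: real
    assume d: "(d1, t1) \<in> C" "(d2, t2) \<in> C" and s: "0 \<le> s" "s \<le> 1"
    define b where "b = (1 - s) * (a + t1 - \<sigma> / 2 * (norm d1)\<^sup>2) + s * (a + t2 - \<sigma> / 2 * (norm d2)\<^sup>2)"
    have "g ((1 - s) *\<^sub>R (x + d1) + s *\<^sub>R (x + d2)) \<le>
        ereal (b + \<sigma> / 2 * (s * (1 - s) * (norm (x + d2 - (x + d1)))\<^sup>2))"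
      unfolding b_def using d s by (intro weakly_convexD[OF wc]) (auto simp: C_def)
    also have "(1 - s) *\<^sub>R (x + d1) + s *\<^sub>R (x + d2) = x + ((1 - s) *\<^sub>R d1 + s *\<^sub>R d2)"
      by (simp add: algebra_simps)
    also have "b + \<sigma> / 2 * (s * (1 - s) * (norm (x + d2 - (x + d1)))\<^sup>2) =
        a + ((1 - s) * t1 + s * t2) - \<sigma> / 2 * (norm ((1 - s) *\<^sub>R d1 + s *\<^sub>R d2))\<^sup>2"
      unfolding b_def norm_convex_combination by (simp add: field_simps)
    finally show "(1 - s) *\<^sub>R (d1, t1) + s *\<^sub>R (d2, t2) \<in> C"
      by (simp add: C_def)
  qed
  then have "convex K"
    unfolding K_def by (rule convex_cone_hull)
  have CK: "r *\<^sub>R z \<in> K" if "z \<in> C" "0 \<le> r" for r z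
    unfolding K_def cone_hull_expl using that by blast
  have "(0, 0) \<in> C" "(0, 1) \<in> C"
    using a by (auto simp: C_def)
  have closure: "(u, c) \<in> closure K"
  proof (rule ccontr)
    assume "(u, c) \<notin> closure K"
    then obtain p b where p: "p \<bullet> (u, c) < b" "\<And>z. z \<in> closure K \<Longrightarrow> b < p \<bullet> z"
      using separating_hyperplane_closed_point[of "closure K" "(u, c)"] convex_closure[OF \<open>convex K\<close>] by blast
    have pK: "b < p \<bullet> z" if "z \<in> K" for z
      using p(2) closure_subset that by blast
    have "b < 0"
      using pK[OF CK[OF \<open>(0, 0) \<in> C\<close>, of 0]] by (simp flip: zero_prod_def)
    have pC: "0 \<le> p \<bullet> z" if z: "z \<in> C" for z
    proof (rule ccontr)
      assume neg: "\<not> 0 \<le> p \<bullet> z"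
      then have "b < p \<bullet> ((b / (p \<bullet> z)) *\<^sub>R z)"
        using \<open>b < 0\<close> by (intro pK CK[OF z]) (simp add: divide_nonpos_neg)
      then show False
        using neg by simp
    qed
    obtain p1 q where pq: "p = (p1, q)"
      by (cases p)
    have q: "0 \<le> q"
      using pC[OF \<open>(0, 1) \<in> C\<close>] by (simp add: pq)
    have uc: "p1 \<bullet> u + q * c < 0"
      using p(1) \<open>b < 0\<close> by (simp add: pq)
    have pd: "0 \<le> p1 \<bullet> (y - x) + q * (b' + \<sigma> / 2 * (norm (y - x))\<^sup>2 - a)" if "g y = ereal b'" for y b'
      using pC[of "(y - x, b' + \<sigma> / 2 * (norm (y - x))\<^sup>2 - a)"] that by (simp add: C_def pq)
    show False
    proof (cases "q = 0")
      case False
      then have q: "q > 0" using q by simp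
      have "- (p1 /\<^sub>R q) \<in> subdiff g x"
        unfolding sub
      proof
        fix y
        show "ereal (a + - (p1 /\<^sub>R q) \<bullet> (y - x) - \<sigma> / 2 * (norm (y - x))\<^sup>2) \<le> g y"
        proof (cases "g y")
          case (real b')
          then show ?thesis
            using pd[OF real] q by (simp add: field_simps)
        qed (use proper in auto)
      qed
      from supp[OF this] show False
        using uc q by (simp add: field_simps)
    next
      \<comment> \<open>A vertical separating hyperplane: \<open>- p1\<close> is a recession
        direction of the subdifferential, so \<open>s0\<close> may be moved along it arbitrarily
        far.\<close>
      case True
      then have u: "p1 \<bullet> u < 0"
        using uc by simp
      \<comment> \<open>Chosen so that \<open>s0 - \<tau> p1\<close> has inner product exactly
        \<open>c + 1\<close> with \<open>u\<close>.\<close>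
      define \<tau> where "\<tau> = (c - s0 \<bullet> u + 1) / - (p1 \<bullet> u)"
      have "\<tau> \<ge> 0"
        unfolding \<tau>_def using u supp[OF s0] by (intro divide_nonneg_pos) auto
      have "s0 - \<tau> *\<^sub>R p1 \<in> subdiff g x"
        unfolding sub
      proof
        fix y
        show "ereal (a + (s0 - \<tau> *\<^sub>R p1) \<bullet> (y - x) - \<sigma> / 2 * (norm (y - x))\<^sup>2) \<le> g y"
        proof (cases "g y")
          case (real b')
          have "a + (s0 - \<tau> *\<^sub>R p1) \<bullet> (y - x) \<le> a + s0 \<bullet> (y - x)"
            using pd[OF real] True mult_nonneg_nonneg[OF \<open>\<tau> \<ge> 0\<close>, of "p1 \<bullet> (y - x)"] by (simp add: inner_diff_left)
          then have "ereal (a + (s0 - \<tau> *\<^sub>R p1) \<bullet> (y - x) - \<sigma> / 2 * (norm (y - x))\<^sup>2) \<le>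
              ereal (a + s0 \<bullet> (y - x) - \<sigma> / 2 * (norm (y - x))\<^sup>2)"
            by simp
          also have "\<dots> \<le> g y"
            using s0 unfolding sub by blast
          finally show ?thesis .
        qed (use proper in auto)
      qed
      moreover have "\<tau> * (p1 \<bullet> u) = - (c - s0 \<bullet> u + 1)"
        using u by (simp add: \<tau>_def)
      ultimately show False
        using supp[of "s0 - \<tau> *\<^sub>R p1"] by (simp add: inner_diff_left)
    qed
  qed
  show ?thesis
  proof (rule ccontr)
    assume "\<not> ?thesis"
    then have "ereal c < subderivative g x u"
      by (simp add: not_le)
    from ereal_dense2[OF this] obtain c' where c': "ereal c < ereal c'" "ereal c' < subderivative g x u"
      by blast
    from less_LiminfD[OF c'(2)[unfolded subderivative_def]]
    obtain Pf Pg where ev: "eventually Pf (at_right 0)" "eventually Pg (nhds u)"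
      and P: "\<And>\<tau> \<nu>. Pf \<tau> \<Longrightarrow> Pg \<nu> \<Longrightarrow> ereal c' < (g (x + \<tau> *\<^sub>R \<nu>) - g x) / ereal \<tau>"
      unfolding eventually_prod_filter by auto
    obtain e where e: "e > 0" "\<And>\<nu>. dist \<nu> u < e \<Longrightarrow> Pg \<nu>"
      using ev(2) by (auto simp: eventually_nhds_metric)
    obtain z where z: "z \<in> K" "dist z (u, c) < min e (c' - c)"
      using closure[unfolded closure_approachable] e(1) c'(1) by (auto dest!: spec[of _ "min e (c' - c)"])
    then obtain r d t where r: "0 \<le> r" "(d, t) \<in> C" "z = r *\<^sub>R (d, t)"
      unfolding K_def cone_hull_expl by auto
    have Pd: "Pg (r *\<^sub>R d)"
      using z(2) dist_fst_le[of z "(u, c)"] r by (intro e) simp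
    have "dist (r * t) c < c' - c"
      using z(2) dist_snd_le[of z "(u, c)"] r by simp
    then have rt: "r * t < c'"
      by (simp add: dist_real_def)
    \<comment> \<open>For \<open>s\<close> below \<open>1 / (r + 1)\<close> the point
      \<open>x + s r d\<close> lies on the segment from \<open>x\<close> to \<open>x + d\<close>,
      where weak convexity bounds the quotient by \<open>r * t\<close>.\<close>
    have "\<forall>\<^sub>F s in at_right (0::real). s < 1 / (r + 1)"
      using r by (intro order_tendstoD(2)[OF tendsto_ident_at]) simp
    moreover have "\<forall>\<^sub>F s in at_right (0::real). 0 < s"
      by (simp add: eventually_at_right_less)
    ultimately have "\<forall>\<^sub>F s in at_right 0. Pf s \<and> 0 < s \<and> s < 1 / (r + 1)"
      using ev(1) by eventually_elim simp
    then obtain s where s: "Pf s" "0 < s" "s < 1 / (r + 1)"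
      using eventually_happens by force
    have "s * r + s < 1"
      using s r by (simp add: field_simps)
    then have sr: "0 \<le> s * r" "s * r \<le> 1"
      using s r by auto
    have "g ((1 - s * r) *\<^sub>R x + (s * r) *\<^sub>R (x + d)) \<le>
        ereal ((1 - s * r) * a + (s * r) * (a + t - \<sigma> / 2 * (norm d)\<^sup>2) +
          \<sigma> / 2 * ((s * r) * (1 - s * r) * (norm (x + d - x))\<^sup>2))"
      by (rule weakly_convexD[OF wc _ _ sr]) (use a r in \<open>auto simp: C_def\<close>)
    also have "(1 - s * r) *\<^sub>R x + (s * r) *\<^sub>R (x + d) = x + s *\<^sub>R (r *\<^sub>R d)"
      by (simp add: algebra_simps)
    also have "(1 - s * r) * a + (s * r) * (a + t - \<sigma> / 2 * (norm d)\<^sup>2) +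
          \<sigma> / 2 * ((s * r) * (1 - s * r) * (norm (x + d - x))\<^sup>2) =
        a + s * (r * t) - \<sigma> / 2 * ((s * r)\<^sup>2 * (norm d)\<^sup>2)"
      by (simp add: field_simps power2_eq_square)
    finally have "g (x + s *\<^sub>R (r *\<^sub>R d)) \<le> ereal (a + s * (r * t) - \<sigma> / 2 * ((s * r)\<^sup>2 * (norm d)\<^sup>2))" .
    also have "\<dots> \<le> ereal (a + s * (r * t))"
      using \<sigma> by simp
    finally have le: "g (x + s *\<^sub>R (r *\<^sub>R d)) \<le> ereal (a + s * (r * t))" .
    have "(g (x + s *\<^sub>R (r *\<^sub>R d)) - g x) / ereal s \<le> ereal (r * t)"
      using le s(2) a proper[of "x + s *\<^sub>R (r *\<^sub>R d)"]
      by (cases "g (x + s *\<^sub>R (r *\<^sub>R d))") (auto simp: field_simps)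
    with P[OF s(1) Pd] rt show False
      by (meson ereal_less_eq(3) less_imp_le less_le_trans not_less order_trans)
  qed
qed

section \<open>Charts of a manifold and tangential components of subgradients\<close>

lemma orthogonal_projection_exists:
  fixes T :: "'a::euclidean_space set"
  assumes T: "subspace T"
  obtains P :: "'a \<Rightarrow> 'a" where "linear P" "\<And>d. P d \<in> T" "\<And>t. t \<in> T \<Longrightarrow> P t = t"
    "\<And>d t. t \<in> T \<Longrightarrow> (d - P d) \<bullet> t = 0"
proof -
  obtain B where B: "B \<subseteq> T" "pairwise orthogonal B" "\<And>b. b \<in> B \<Longrightarrow> norm b = 1" "independent B" "span B = T"
    using orthonormal_basis_subspace[OF T] by metis
  have "finite B"
    using B(4) independent_imp_finite by blast
  define P where "P d = (\<Sum>b\<in>B. (d \<bullet> b) *\<^sub>R b)" for d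
  have PT: "P t = t" if "t \<in> T" for t
    using orthonormal_basis_expand[OF B(2,3) _ \<open>finite B\<close>, of t] that B(5) by (simp add: P_def)
  show ?thesis
  proof
    show "linear P"
      unfolding P_def
      by (intro linearI) (simp_all add: inner_add_left scaleR_add_left sum.distrib scaleR_sum_right)
    show "P d \<in> T" for d
      unfolding P_def using B(1) T by (intro subspace_sum subspace_mul) auto
    show "P t = t" if "t \<in> T" for t
      using that by (rule PT)
    show "(d - P d) \<bullet> t = 0" if "t \<in> T" for d t
    proof -
      have "P d \<bullet> t = d \<bullet> P t"
        by (simp add: P_def inner_sum_left inner_sum_right inner_commute[of t] mult.commute)
      then show ?thesis
        using PT[OF that] by (simp add: inner_diff_left)
    qed
  qed
qed

lemma subspace_tangent_space: "subspace (tangent_space r G x)"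
  by (auto simp: subspace_def tangent_space_def inner_add_right)

text \<open>Completing the equations \<open>G i = 0\<close> to a local diffeomorphism straightens the manifold to
  its tangent space; the linear normalisation makes the derivative at the base point the identity.\<close>

lemma manifold_equation_chart:
  fixes M :: "'a::euclidean_space set"
  assumes M: "manifold_equation (Suc p) r M x G" and x: "x \<in> M"
  obtains \<Psi> :: "'a \<Rightarrow> 'a" and \<epsilon> :: real where "C_smooth_on (Suc p) UNIV \<Psi>" "\<Psi> x = 0"
    "(\<Psi> has_derivative (\<lambda>d. d)) (at x)" "\<epsilon> > 0"
    "\<And>y. y \<in> ball x \<epsilon> \<Longrightarrow> y \<in> M \<longleftrightarrow> \<Psi> y \<in> tangent_space r G x"
proof -
  define I where "I = {..<DIM('a) - r}"
  define a where "a i = grad (G i) x" for i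
  define T where "T = tangent_space r G x"
  have T: "t \<in> T \<longleftrightarrow> (\<forall>i\<in>I. a i \<bullet> t = 0)" for t
    by (auto simp: T_def tangent_space_def I_def a_def)
  have subT: "subspace T"
    unfolding T_def by (rule subspace_tangent_space)
  have GC: "C_smooth_on (Suc p) UNIV (G i)" if "i \<in> I" for i
    using M that by (simp add: manifold_equation_def I_def del: C_smooth_on.simps)
  have dim: "dim (a ` I) = card I"
    using M by (simp add: manifold_equation_def I_def a_def del: C_smooth_on.simps)
  obtain \<epsilon> where \<epsilon>0: "\<epsilon> > 0" "M \<inter> ball x \<epsilon> = {y \<in> ball x \<epsilon>. \<forall>i<DIM('a) - r. G i y = 0}"
    using M unfolding manifold_equation_def by blast
  have \<epsilon>: "\<epsilon> > 0" "M \<inter> ball x \<epsilon> = {y \<in> ball x \<epsilon>. \<forall>i\<in>I. G i y = 0}"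
    using \<epsilon>0 by (simp_all add: I_def Ball_def)
  have [simp]: "finite I"
    by (simp add: I_def)
  \<comment> \<open>Full row rank also excludes repeated gradients, which the image of
    \<open>I\<close> under \<open>a\<close> would hide; so \<open>a\<close> is injective and its
    values are independent.\<close>
  have card: "card (a ` I) = card I"
    using dim_le_card[of "a ` I" "a ` I"] dim card_image_le[of I a] by (simp add: span_superset)
  then have inj: "inj_on a I"
    by (simp add: eq_card_imp_inj_on)
  have indep: "independent (a ` I)"
    using card_eq_dim[of "a ` I" "a ` I"] card dim by (simp add: span_superset)
  have comb0: "c i = 0" if s: "(\<Sum>i\<in>I. c i *\<^sub>R a i) = 0" and i: "i \<in> I" for c i
  proof -
    have "(\<Sum>v\<in>a ` I. c (inv_into I a v) *\<^sub>R v) = (\<Sum>i\<in>I. c i *\<^sub>R a i)"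
      using inj by (simp add: sum.reindex)
    then have "c (inv_into I a (a i)) = 0"
      by (intro independentD[OF indep _ subset_refl]) (simp_all add: s i)
    then show ?thesis
      using inj i by simp
  qed
  obtain P where P: "linear P" "\<And>d. P d \<in> T" "\<And>t. t \<in> T \<Longrightarrow> P t = t"
    "\<And>d t. t \<in> T \<Longrightarrow> (d - P d) \<bullet> t = 0"
    using orthogonal_projection_exists[OF subT] by blast
  \<comment> \<open>The derivative at \<open>x\<close> of the completed equations: the gradients
    account for the normal directions, \<open>P\<close> for the tangential ones. It fixes
    \<open>T\<close> pointwise.\<close>
  define J where "J d = (\<Sum>i\<in>I. (a i \<bullet> d) *\<^sub>R a i) + P d" for d
  have linJ: "linear J"
  proof -
    have "linear (\<lambda>d. \<Sum>i\<in>I. (a i \<bullet> d) *\<^sub>R a i)"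
      by (intro linearI) (simp_all add: inner_add_right scaleR_add_left sum.distrib scaleR_sum_right)
    then show ?thesis
      unfolding J_def using P(1) by (rule linear_compose_add)
  qed
  have JT: "J t = t" if "t \<in> T" for t
    using that T P(3) by (simp add: J_def)
  have orth: "(\<Sum>i\<in>I. c i *\<^sub>R a i) \<bullet> t = 0" if "t \<in> T" for c t
    using that T by (simp add: inner_sum_left)
  have "d = 0" if "J d = 0" for d
  proof -
    have "P d \<bullet> P d = 0"
      using arg_cong[OF that, of "\<lambda>w. w \<bullet> P d"] orth[OF P(2), of "\<lambda>i. a i \<bullet> d" d]
      by (simp add: J_def inner_add_left)
    then have "(\<Sum>i\<in>I. (a i \<bullet> d) *\<^sub>R a i) = 0"
      using that by (simp add: J_def)
    then have "d \<in> T"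
      using comb0[of "\<lambda>i. a i \<bullet> d"] by (simp add: T)
    then show ?thesis
      using JT that by simp
  qed
  then have injJ: "inj J"
    using linear_injective_0[OF linJ] by blast
  then have bijJ: "bij J"
    using linear_injective_imp_surjective[OF linJ injJ] by (simp add: bij_def)
  define K where "K = inv J"
  have linK: "linear K"
    unfolding K_def using linJ bijJ by (rule linear_inv_of_bij)
  have KJ: "K (J d) = d" and JK: "J (K d) = d" for d
    using bijJ by (simp_all add: K_def bij_is_inj bij_is_surj surj_f_inv_f)
  \<comment> \<open>Composition with \<open>K\<close> makes the derivative the identity. Since
    \<open>J\<close> fixes \<open>T\<close> pointwise, so does \<open>K\<close>, and membership in
    \<open>T\<close> is not affected.\<close>
  define \<Psi> where "\<Psi> y = K ((\<Sum>i\<in>I. G i y *\<^sub>R a i) + P (y - x))" for y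
  have bK: "bounded_linear K" and bP: "bounded_linear P"
    using linK P(1) by (simp_all add: linear_conv_bounded_linear)
  have G0: "G i x = 0" if "i \<in> I" for i
  proof -
    have "x \<in> M \<inter> ball x \<epsilon>"
      using \<epsilon>(1) x by simp
    then show ?thesis
      using that unfolding \<epsilon>(2) by blast
  qed
  show ?thesis
  proof (rule that[of \<Psi> \<epsilon>])
    show "C_smooth_on (Suc p) UNIV \<Psi>"
      unfolding \<Psi>_def
      by (intro C_smooth_on_bounded_linear[OF open_UNIV bK] C_smooth_on_add C_smooth_on_sum C_smooth_on_scaleR GC
          C_smooth_on_const C_smooth_on_bounded_linear[OF open_UNIV bP] C_smooth_on_diff C_smooth_on_ident open_UNIV)
    show "\<Psi> x = 0"
      using G0 linear_0[OF linK] linear_0[OF P(1)] by (simp add: \<Psi>_def)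
    have "(G i has_derivative (\<lambda>d. d \<bullet> a i)) (at x)" if "i \<in> I" for i
      using C_smooth_on_GDERIV[OF GC[OF that], of x] by (simp add: gderiv_def a_def)
    then have "((\<lambda>y. (\<Sum>i\<in>I. G i y *\<^sub>R a i) + P (y - x)) has_derivative
        (\<lambda>d. (\<Sum>i\<in>I. (d \<bullet> a i) *\<^sub>R a i) + P (d - 0))) (at x)"
      by (intro has_derivative_add has_derivative_sum has_derivative_scaleR_left bounded_linear.has_derivative[OF bP]
          has_derivative_diff has_derivative_ident has_derivative_const)
    then have "(\<Psi> has_derivative (\<lambda>d. K ((\<Sum>i\<in>I. (d \<bullet> a i) *\<^sub>R a i) + P (d - 0)))) (at x)"
      unfolding \<Psi>_def by (rule bounded_linear.has_derivative[OF bK])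
    also have "(\<lambda>d. K ((\<Sum>i\<in>I. (d \<bullet> a i) *\<^sub>R a i) + P (d - 0))) = (\<lambda>d. K (J d))"
      by (simp add: J_def inner_commute)
    finally show "(\<Psi> has_derivative (\<lambda>d. d)) (at x)"
      by (simp add: KJ)
    show "\<epsilon> > 0" by (fact \<epsilon>)
    fix y assume y: "y \<in> ball x \<epsilon>"
    have "\<Psi> y \<in> T \<longleftrightarrow> (\<forall>i\<in>I. G i y = 0)"
    proof
      assume "\<Psi> y \<in> T"
      define w where "w = (\<Sum>i\<in>I. G i y *\<^sub>R a i)"
      have "w + P (y - x) = \<Psi> y"
        using JK JT[OF \<open>\<Psi> y \<in> T\<close>] by (simp add: \<Psi>_def w_def)
      then have "w \<in> T"
        using \<open>\<Psi> y \<in> T\<close> P(2) subT by (metis add_diff_cancel_right' subspace_diff)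
      then have "w \<bullet> w = 0"
        using orth by (simp add: w_def)
      then show "\<forall>i\<in>I. G i y = 0"
        using comb0 by (auto simp: w_def)
    next
      assume "\<forall>i\<in>I. G i y = 0"
      then have "\<Psi> y = K (J (P (y - x)))"
        using JT[OF P(2)] by (simp add: \<Psi>_def)
      then show "\<Psi> y \<in> T"
        using KJ P(2) by simp
    qed
    then show "y \<in> M \<longleftrightarrow> \<Psi> y \<in> tangent_space r G x"
      using \<epsilon>(2) y by (auto simp: T_def)
  qed
qed

text \<open>Along the curve \<open>r \<mapsto> \<theta> (\<xi> + r t)\<close> the function
  \<open>g\<close> agrees with the smooth \<open>h\<close>, so the global subgradient inequality
  gives a differentiable function with a minimum at \<open>r = 0\<close>. Both signs of
  \<open>r\<close> are admissible, hence its derivative vanishes.\<close>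

lemma subdiff_tangential:
  fixes g :: "'a::euclidean_space \<Rightarrow> ereal" and \<theta> :: "'a \<Rightarrow> 'a"
  assumes wc: "weakly_convex \<sigma> g" and \<sigma>: "0 \<le> \<sigma>" and proper: "\<And>x. g x \<noteq> -\<infinity>"
    and V: "open V" "\<xi> \<in> V" and T: "subspace T" "\<xi> \<in> T" "t \<in> T"
    and gh: "\<And>\<xi>. \<xi> \<in> V \<Longrightarrow> \<xi> \<in> T \<Longrightarrow> g (\<theta> \<xi>) = ereal (h (\<theta> \<xi>))"
    and \<theta>: "(\<theta> has_derivative D) (at \<xi>)" and h: "GDERIV h (\<theta> \<xi>) :> u" and s: "s \<in> subdiff g (\<theta> \<xi>)"
  shows "(s - u) \<bullet> D t = 0"
proof -
  interpret D: bounded_linear D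
    using \<theta> has_derivative_bounded_linear by blast
  define y where "y r = \<theta> (\<xi> + r *\<^sub>R t)" for r :: real
  define \<phi> where "\<phi> r = h (y r) - s \<bullet> (y r - \<theta> \<xi>) + \<sigma> / 2 * ((y r - \<theta> \<xi>) \<bullet> (y r - \<theta> \<xi>))" for r :: real
  have y: "(y has_derivative (\<lambda>r. D (r *\<^sub>R t))) (at 0)"
    unfolding y_def by (rule has_derivative_compose[where g = \<theta>]) (use \<theta> in \<open>auto intro!: derivative_eq_intros\<close>)
  have y0: "y 0 = \<theta> \<xi>"
    by (simp add: y_def)
  have hy: "((\<lambda>r. h (y r)) has_derivative (\<lambda>r. D (r *\<^sub>R t) \<bullet> u)) (at 0)"
    by (rule has_derivative_compose[OF y]) (use h in \<open>simp add: gderiv_def y0\<close>)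
  have "(\<phi> has_derivative (\<lambda>r. D (r *\<^sub>R t) \<bullet> u - s \<bullet> (D (r *\<^sub>R t) - 0) + \<sigma> / 2 *
      ((y 0 - \<theta> \<xi>) \<bullet> (D (r *\<^sub>R t) - 0) + (D (r *\<^sub>R t) - 0) \<bullet> (y 0 - \<theta> \<xi>)))) (at 0)"
    unfolding \<phi>_def
    by (intro has_derivative_add has_derivative_diff hy y has_derivative_inner_right has_derivative_const
        has_derivative_mult_right has_derivative_inner)
  then have "(\<phi> has_derivative (\<lambda>r. r * - ((s - u) \<bullet> D t))) (at 0)"
    by (rule has_derivative_eq_rhs) (simp add: fun_eq_iff y0 D.scaleR inner_diff_left inner_commute algebra_simps)
  then have der: "DERIV \<phi> 0 :> - ((s - u) \<bullet> D t)"
    by (simp only: has_field_derivative_def mult_commute_abs)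
  have lim: "((\<lambda>r. \<xi> + r *\<^sub>R t) \<longlongrightarrow> \<xi> + 0 *\<^sub>R t) (nhds (0::real))"
    by (intro tendsto_intros filterlim_ident)
  then have "\<forall>\<^sub>F r in nhds (0::real). \<xi> + r *\<^sub>R t \<in> V"
    using V by (intro topological_tendstoD[OF lim]) auto
  then obtain d where d: "d > 0" "\<And>r. \<bar>r\<bar> < d \<Longrightarrow> \<xi> + r *\<^sub>R t \<in> V"
    by (auto simp: eventually_nhds_metric dist_real_def)
  have "\<phi> 0 \<le> \<phi> r" if "\<bar>0 - r\<bar> < d" for r
  proof -
    have "g (y r) = ereal (h (y r))"
      unfolding y_def using T d(2)[of r] that by (intro gh) (auto intro: subspace_add subspace_mul)
    moreover have "ereal (h (\<theta> \<xi>) + s \<bullet> (y r - \<theta> \<xi>) - \<sigma> / 2 * (norm (y r - \<theta> \<xi>))\<^sup>2) \<le> g (y r)"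
      using s V(2) T(2) subdiff_weakly_convex_iff[OF wc \<sigma> proper gh] by blast
    ultimately show ?thesis
      by (simp add: \<phi>_def y0 power2_norm_eq_inner)
  qed
  then have "- ((s - u) \<bullet> D t) = 0"
    using DERIV_local_min[OF der d(1)] by blast
  then show ?thesis by simp
qed

section \<open>The proximal mapping near an active manifold\<close>

text \<open>The small step past \<open>v\<close> is what forces a linear functional that is maximal
  over \<open>S\<close> at \<open>v\<close> to be constant on \<open>S\<close>.\<close>

lemma rel_interior_extend_beyond:
  fixes S :: "'a::euclidean_space set"
  assumes v: "v \<in> rel_interior S" and s: "s \<in> S"
  obtains e where "e > 0" "v + e *\<^sub>R (v - s) \<in> S"
proof -
  obtain e where e: "e > 0" "cball v e \<inter> affine hull S \<subseteq> S" and vS: "v \<in> S"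
    using v unfolding mem_rel_interior_cball by blast
  define r where "r = e / (norm (v - s) + 1)"
  have r: "r > 0" "r * norm (v - s) \<le> e"
    using e by (auto simp: r_def pos_divide_le_eq add_nonneg_pos distrib_left)
  have "v + r *\<^sub>R (v - s) = (1 + r) *\<^sub>R v + (- r) *\<^sub>R s"
    by (simp add: algebra_simps)
  also have "\<dots> \<in> affine hull S"
    by (intro mem_affine) (auto intro: hull_inc vS s)
  finally have "v + r *\<^sub>R (v - s) \<in> S"
    using r e by (intro subsetD[OF e(2)]) (auto simp: dist_norm)
  with r(1) that show ?thesis by blast
qed

lemma difference_quotient_tendsto:
  fixes k :: "'a::real_normed_vector \<Rightarrow> 'b::real_normed_vector"
  assumes "(k has_derivative D) (at n)"
  shows "((\<lambda>r. (k (n + r *\<^sub>R d) - k n) /\<^sub>R r) \<longlongrightarrow> D d) (at_right (0::real))"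
proof -
  interpret D: bounded_linear D
    using assms has_derivative_bounded_linear by blast
  have 1: "((\<lambda>r. n + r *\<^sub>R d) has_derivative (\<lambda>r. r *\<^sub>R d)) (at (0::real))"
    by (auto intro!: derivative_eq_intros)
  have "((\<lambda>r. k (n + r *\<^sub>R d)) has_derivative (\<lambda>r. D (r *\<^sub>R d))) (at 0)"
    by (rule has_derivative_compose[OF 1]) (use assms in simp)
  then have "((\<lambda>r. norm (k (n + r *\<^sub>R d) - k n - r *\<^sub>R D d) / norm r) \<longlongrightarrow> 0) (at 0)"
    by (simp add: has_derivative_iff_norm D.scaleR)
  then have "((\<lambda>r. norm ((k (n + r *\<^sub>R d) - k n) /\<^sub>R r - D d)) \<longlongrightarrow> 0) (at 0)"
  proof (rule Lim_transform_eventually)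
    show "\<forall>\<^sub>F r in at 0. norm (k (n + r *\<^sub>R d) - k n - r *\<^sub>R D d) / norm r = norm ((k (n + r *\<^sub>R d) - k n) /\<^sub>R r - D d)"
      unfolding eventually_at_filter
    proof (intro always_eventually allI impI)
      fix r :: real assume "r \<noteq> 0"
      then have "(k (n + r *\<^sub>R d) - k n) /\<^sub>R r - D d = (k (n + r *\<^sub>R d) - k n - r *\<^sub>R D d) /\<^sub>R r"
        by (simp add: scaleR_diff_right)
      then show "norm (k (n + r *\<^sub>R d) - k n - r *\<^sub>R D d) / norm r = norm ((k (n + r *\<^sub>R d) - k n) /\<^sub>R r - D d)"
        by (simp add: divide_inverse_commute)
    qed
  qed
  then have "((\<lambda>r. (k (n + r *\<^sub>R d) - k n) /\<^sub>R r) \<longlongrightarrow> D d) (at 0)"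
    by (rule LIM_zero_cancel[OF tendsto_norm_zero_cancel])
  then show ?thesis
    by (rule filterlim_mono) (auto simp: at_le)
qed

text \<open>The manifold is represented by the image of \<open>V \<inter> T\<close> under
  \<open>\<theta>\<close>. \<open>inner_semicontinuous\<close> and \<open>sharp\<close> are
  conditions of an active manifold carried to this chart; regularity allows \<open>subdiff\<close>
  in place of the Clarke subdifferential.\<close>

locale active_chart =
  fixes g :: "'a::euclidean_space \<Rightarrow> ereal" and \<sigma> :: real and x :: 'a and h :: "'a \<Rightarrow> real"
    and T U V :: "'a set" and \<Psi> \<theta> P :: "'a \<Rightarrow> 'a"
  assumes weakly_convex: "weakly_convex \<sigma> g" and \<sigma>_nonneg: "0 \<le> \<sigma>" and proper: "\<And>x. g x \<noteq> -\<infinity>"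
    and T: "subspace T" and linear_P: "linear P" and P_mem: "\<And>d. P d \<in> T" and P_ident: "\<And>t. t \<in> T \<Longrightarrow> P t = t"
    and P_orth: "\<And>d t. t \<in> T \<Longrightarrow> (d - P d) \<bullet> t = 0"
    and open_U: "open U" and open_V: "open V" and zero_V: "0 \<in> V" and \<theta>_0: "\<theta> 0 = x"
    and \<Psi>_smooth: "C_smooth_on 3 U \<Psi>" and \<theta>_smooth: "C_smooth_on 3 V \<theta>"
    and \<theta>_mem: "\<And>\<xi>. \<xi> \<in> V \<Longrightarrow> \<theta> \<xi> \<in> U" and \<Psi>_\<theta>: "\<And>\<xi>. \<xi> \<in> V \<Longrightarrow> \<Psi> (\<theta> \<xi>) = \<xi>"
    and \<Psi>_deriv: "frechet_derivative \<Psi> (at x) = (\<lambda>d. d)"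
    and h_smooth: "C_smooth_on 3 U h"
    and gh: "\<And>\<xi>. \<xi> \<in> V \<Longrightarrow> \<xi> \<in> T \<Longrightarrow> g (\<theta> \<xi>) = ereal (h (\<theta> \<xi>))"
    and subdiff_nonempty: "\<And>\<xi>. \<xi> \<in> V \<Longrightarrow> \<xi> \<in> T \<Longrightarrow> subdiff g (\<theta> \<xi>) \<noteq> {}"
    and inner_semicontinuous: "\<And>X s. (\<And>i. X i \<in> V \<inter> T) \<Longrightarrow> X \<longlonglongrightarrow> 0 \<Longrightarrow> s \<in> subdiff g x \<Longrightarrow>
      \<exists>S. (\<forall>\<^sub>F i in sequentially. S i \<in> subdiff g (\<theta> (X i))) \<and> S \<longlonglongrightarrow> s"
    and sharp: "\<And>u. (\<And>t. t \<in> T \<Longrightarrow> u \<bullet> t = 0) \<Longrightarrow> u \<noteq> 0 \<Longrightarrow> - subderivative g x u < subderivative g x (- u)"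
begin

text \<open>\<open>n\<close> encodes a point \<open>base n\<close> of the manifold, through its tangential part \<open>P n\<close>, together
  with a normal vector there, through \<open>n - P n\<close>; \<open>sub n\<close> runs through \<open>grad h + N\<close>, the affine
  space that carries the subdifferential of \<open>g\<close> at \<open>base n\<close>.\<close>

definition "base n = \<theta> (P n)"
definition "nrm n = (\<Sum>b\<in>Basis. (frechet_derivative \<Psi> (at (base n)) b \<bullet> (n - P n)) *\<^sub>R b)"
definition "sub n = grad h (base n) + nrm n"
definition "W = {n. P n \<in> V}"

lemma bounded_linear_P: "bounded_linear P"
  using linear_P by (simp add: linear_conv_bounded_linear)

lemma open_W: "open W"
  using open_vimage[OF open_V linear_continuous_on[OF bounded_linear_P]] by (simp add: W_def vimage_def)

lemma W_D: "n \<in> W \<Longrightarrow> P n \<in> V \<inter> T"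
  using P_mem by (simp add: W_def)

lemma base_mem: "n \<in> W \<Longrightarrow> base n \<in> U"
  by (simp add: W_def base_def \<theta>_mem)

lemma base_smooth: "C_smooth_on 3 W base"
  unfolding base_def
  by (rule C_smooth_on_compose[OF open_W C_smooth_on_bounded_linear[OF open_W bounded_linear_P C_smooth_on_ident] \<theta>_smooth])
     (auto simp: W_def)

lemma base_smooth2: "C_smooth_on 2 W base"
  by (rule C_smooth_on_mono[OF base_smooth]) simp

lemma grad_h_smooth: "C_smooth_on 2 U (grad h)"
  by (rule C_smooth_on_grad[OF open_U]) (use h_smooth in \<open>simp only: eval_nat_numeral\<close>)

lemma D\<Psi>_smooth: "C_smooth_on 2 U (\<lambda>y. frechet_derivative \<Psi> (at y) d)"
  using \<Psi>_smooth by (simp add: eval_nat_numeral)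

lemma D\<theta>_smooth: "C_smooth_on 2 V (\<lambda>y. frechet_derivative \<theta> (at y) d)"
  using \<theta>_smooth by (simp add: eval_nat_numeral)

lemma base_image: "base ` W \<subseteq> U"
  using base_mem by blast

lemma sub_smooth: "C_smooth_on 2 W sub"
  unfolding sub_def nrm_def
  by (intro C_smooth_on_add C_smooth_on_sum C_smooth_on_scaleR C_smooth_on_inner open_W C_smooth_on_const
      C_smooth_on_diff C_smooth_on_ident C_smooth_on_bounded_linear[OF open_W bounded_linear_P]
      C_smooth_on_compose[OF open_W base_smooth2 grad_h_smooth base_image]
      C_smooth_on_compose[OF open_W base_smooth2 D\<Psi>_smooth base_image])

lemma h_GDERIV: "y \<in> U \<Longrightarrow> GDERIV h y :> grad h y"
  by (rule C_smooth_on_GDERIV[of 2]) (use h_smooth in \<open>simp only: eval_nat_numeral\<close>)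

lemma \<Psi>_has_derivative: "y \<in> U \<Longrightarrow> (\<Psi> has_derivative frechet_derivative \<Psi> (at y)) (at y)"
  by (rule C_smooth_on_has_derivative[of 2]) (use \<Psi>_smooth in \<open>simp only: eval_nat_numeral\<close>)

lemma \<theta>_has_derivative: "\<xi> \<in> V \<Longrightarrow> (\<theta> has_derivative frechet_derivative \<theta> (at \<xi>)) (at \<xi>)"
  by (rule C_smooth_on_has_derivative[of 2]) (use \<theta>_smooth in \<open>simp only: eval_nat_numeral\<close>)

lemma D\<Psi>_D\<theta>:
  assumes "\<xi> \<in> V"
  shows "frechet_derivative \<Psi> (at (\<theta> \<xi>)) (frechet_derivative \<theta> (at \<xi>) d) = d"
proof -
  have "((\<lambda>\<xi>. \<Psi> (\<theta> \<xi>)) has_derivative (\<lambda>d. frechet_derivative \<Psi> (at (\<theta> \<xi>)) (frechet_derivative \<theta> (at \<xi>) d))) (at \<xi>)"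
    by (rule has_derivative_compose[OF \<theta>_has_derivative[OF assms] \<Psi>_has_derivative[OF \<theta>_mem[OF assms]]])
  then have "((\<lambda>\<xi>. \<xi>) has_derivative (\<lambda>d. frechet_derivative \<Psi> (at (\<theta> \<xi>)) (frechet_derivative \<theta> (at \<xi>) d))) (at \<xi>)"
    by (rule has_derivative_transform_within_open[OF _ open_V assms]) (simp add: \<Psi>_\<theta>)
  from fun_cong[OF has_derivative_unique[OF this has_derivative_ident]] show ?thesis .
qed

lemma D\<theta>_0: "frechet_derivative \<theta> (at 0) = (\<lambda>d. d)"
  using D\<Psi>_D\<theta>[OF zero_V] by (simp add: \<theta>_0 \<Psi>_deriv fun_eq_iff)

text \<open>So \<open>nrm n\<close> is the adjoint of the derivative of \<open>\<Psi>\<close> at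
  \<open>base n\<close>, applied to \<open>n - P n\<close>; the sum over \<open>Basis\<close> writes
  this adjoint in coordinates.\<close>

lemma nrm_inner:
  assumes "n \<in> W"
  shows "nrm n \<bullet> w = frechet_derivative \<Psi> (at (base n)) w \<bullet> (n - P n)"
proof -
  have "linear (frechet_derivative \<Psi> (at (base n)))"
    using \<Psi>_has_derivative[OF base_mem[OF assms]] has_derivative_linear by blast
  from linear_sum_Basis[OF this, of w] show ?thesis
    by (simp add: nrm_def inner_sum_left mult.commute inner_commute[of w])
qed

text \<open>Tangent vectors at \<open>base n\<close> are images of \<open>T\<close> under the
  derivative of \<open>\<theta>\<close>. The derivative of \<open>\<Psi>\<close> takes them back to
  \<open>T\<close>, which is orthogonal to \<open>n - P n\<close>.\<close>

lemma nrm_tangential: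
  assumes "n \<in> W" "t \<in> T"
  shows "nrm n \<bullet> frechet_derivative \<theta> (at (P n)) t = 0"
proof -
  have "P n \<in> V"
    using W_D[OF assms(1)] by blast
  then have "nrm n \<bullet> frechet_derivative \<theta> (at (P n)) t = t \<bullet> (n - P n)"
    unfolding nrm_inner[OF assms(1)] by (simp add: base_def D\<Psi>_D\<theta>)
  then show ?thesis
    using P_orth[OF assms(2), of n] by (simp add: inner_commute)
qed

text \<open>Both \<open>s\<close> and \<open>sub n\<close> have the tangential component of
  \<open>grad h\<close>, so they can differ only by a normal vector.\<close>

lemma subdiff_tangential':
  assumes "n \<in> W" "t \<in> T" "s \<in> subdiff g (base n)"
  shows "(s - sub n) \<bullet> frechet_derivative \<theta> (at (P n)) t = 0"
proof -
  have "(s - grad h (base n)) \<bullet> frechet_derivative \<theta> (at (P n)) t = 0"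
    by (rule subdiff_tangential[where g = g and \<theta> = \<theta> and h = h, OF weakly_convex \<sigma>_nonneg proper open_V _ T _ assms(2) gh])
       (use W_D[OF assms(1)] \<theta>_has_derivative h_GDERIV[OF base_mem[OF assms(1)]] assms(3) in \<open>auto simp: base_def\<close>)
  then show ?thesis
    using nrm_tangential[OF assms(1,2)] by (simp add: sub_def inner_diff_left inner_add_left)
qed

lemma P_0: "P 0 = 0"
  using linear_0[OF linear_P] .

lemma zero_T: "0 \<in> T"
  using T by (rule subspace_0)

lemma g_x: "g x = ereal (h x)"
  using gh[OF zero_V zero_T] by (simp add: \<theta>_0)

text \<open>On the normal space at \<open>x\<close> the parametrisation is affine, because the
  derivative of \<open>\<Psi>\<close> at \<open>x\<close> is the identity. This identifies
  \<open>v - grad h x\<close> as the parameter of a subgradient \<open>v\<close> and determines how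
  \<open>sub\<close> moves in normal directions.\<close>

lemma
  assumes "P n = 0"
  shows base_normal: "base n = x" and sub_normal: "sub n = grad h x + n" and W_normal: "n \<in> W"
  using assms zero_V by (auto simp: base_def sub_def nrm_def \<theta>_0 \<Psi>_deriv W_def euclidean_representation inner_commute[of _ n])

lemma P_grad_diff:
  assumes "v \<in> subdiff g x"
  shows "P (v - grad h x) = 0"
proof -
  have "(v - grad h x) \<bullet> t = 0" if "t \<in> T" for t
    using subdiff_tangential'[OF W_normal[OF P_0] that] assms base_normal[OF P_0] sub_normal[OF P_0] D\<theta>_0 P_0 by simp
  then have "P (v - grad h x) \<bullet> P (v - grad h x) = 0"
    using P_orth[OF P_mem, of "v - grad h x" "v - grad h x"] P_mem by (simp add: inner_diff_left)
  then show ?thesis by simp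
qed

text \<open>A functional maximal at \<open>v\<close> is constant on the subdifferential. Then the
  subderivatives at \<open>u\<close> and \<open>- u\<close> are at most \<open>v \<bullet> u\<close>
  and its negative, against \<open>sharp\<close>.\<close>

lemma no_separation_at_base:
  assumes v: "v \<in> rel_interior (subdiff g x)" and u: "\<And>t. t \<in> T \<Longrightarrow> u \<bullet> t = 0" "u \<noteq> 0"
    and sep: "\<And>s. s \<in> subdiff g x \<Longrightarrow> u \<bullet> (s - v) \<le> 0"
  shows False
proof -
  have vS: "v \<in> subdiff g x"
    using v rel_interior_subset by blast
  have eq: "s \<bullet> u = v \<bullet> u" if s: "s \<in> subdiff g x" for s
  proof -
    obtain e where "e > 0" "v + e *\<^sub>R (v - s) \<in> subdiff g x"
      using rel_interior_extend_beyond[OF v s] by blast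
    then have "u \<bullet> (v - s) \<le> 0"
      using sep[of "v + e *\<^sub>R (v - s)"] by (simp add: mult_le_0_iff)
    then show ?thesis
      using sep[OF s] by (simp add: inner_diff_right inner_commute)
  qed
  note supp = subderivative_le_support[OF weakly_convex \<sigma>_nonneg proper g_x vS]
  have "subderivative g x u \<le> ereal (v \<bullet> u)" "subderivative g x (- u) \<le> ereal (- (v \<bullet> u))"
    using eq by (auto intro!: supp)
  moreover have "- ereal (v \<bullet> u) \<le> - subderivative g x u"
    using calculation(1) by (simp only: ereal_minus_le_minus)
  ultimately show False
    using sharp[OF u] by (simp add: not_less[symmetric])
qed

text \<open>Nearest points \<open>c i\<close> supply the separating unit vectors, and compactness of
  the sphere supplies a limit \<open>w\<close>. Inner semicontinuity transfers the separation: every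
  subgradient at \<open>x\<close> is a limit of subgradients at the points
  \<open>base (X i)\<close>.\<close>

lemma sub_mem_subdiff_sequentially:
  assumes v: "v \<in> rel_interior (subdiff g x)" and X: "X \<longlonglongrightarrow> v - grad h x" and XW: "\<And>i. X i \<in> W"
  shows "\<not> (\<forall>i. sub (X i) \<notin> subdiff g (base (X i)))"
proof
  assume notin: "\<forall>i. sub (X i) \<notin> subdiff g (base (X i))"
  have vS: "v \<in> subdiff g x"
    using v rel_interior_subset by blast
  define n0 where "n0 = v - grad h x"
  have Pn0: "P n0 = 0"
    unfolding n0_def using vS by (rule P_grad_diff)
  have n0W: "n0 \<in> W" and sub_n0: "sub n0 = v"
    using W_normal[OF Pn0] sub_normal[OF Pn0] by (simp_all add: n0_def)
  have Xn0: "X \<longlonglongrightarrow> n0"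
    using X by (simp add: n0_def)
  have PX: "(\<lambda>i. P (X i)) \<longlonglongrightarrow> 0"
    using bounded_linear.tendsto[OF bounded_linear_P Xn0] by (simp add: Pn0)
  have subX: "(\<lambda>i. sub (X i)) \<longlonglongrightarrow> v"
    using continuous_on_tendsto_compose[OF C_smooth_on_continuous[OF sub_smooth] Xn0 n0W] XW by (simp add: sub_n0)
  have D\<theta>X: "(\<lambda>i. frechet_derivative \<theta> (at (P (X i))) t) \<longlonglongrightarrow> t" for t
    using continuous_on_tendsto_compose[OF C_smooth_on_continuous[OF D\<theta>_smooth[of t]] PX zero_V] W_D[OF XW]
    by (simp add: D\<theta>_0)
  define S where "S i = subdiff g (base (X i))" for i
  define c where "c i = closest_point (S i) (sub (X i))" for i
  define u where "u i = (sub (X i) - c i) /\<^sub>R norm (sub (X i) - c i)" for i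
  have gX: "g (base (X i)) = ereal (h (base (X i)))" for i
    using gh[of "P (X i)"] W_D[OF XW[of i]] by (simp add: base_def)
  have S: "closed (S i)" "convex (S i)" "S i \<noteq> {}" for i
    using closed_subdiff_weakly_convex[OF weakly_convex \<sigma>_nonneg proper gX]
      convex_subdiff_weakly_convex[OF weakly_convex \<sigma>_nonneg proper gX] subdiff_nonempty W_D[OF XW[of i]]
    by (auto simp: S_def base_def)
  have cS: "c i \<in> S i" for i
    unfolding c_def using closest_point_in_set[OF S(1,3)] .
  have ne: "sub (X i) - c i \<noteq> 0" for i
    using cS[of i] notin by (metis S_def eq_iff_diff_eq_0)
  have u1: "norm (u i) = 1" for i
    using ne[of i] by (simp add: u_def)
  have usep: "u i \<bullet> (s - sub (X i)) \<le> 0" if "s \<in> S i" for s i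
  proof -
    have "(sub (X i) - c i) \<bullet> (s - c i) \<le> 0"
      unfolding c_def by (rule closest_point_dot[OF S(2,1) that])
    moreover have "s - sub (X i) = (s - c i) - (sub (X i) - c i)"
      by simp
    ultimately have "(sub (X i) - c i) \<bullet> (s - sub (X i)) \<le> 0"
      using inner_ge_zero[of "sub (X i) - c i"] by (simp only: inner_diff_right[of _ "s - c i"])
    then show ?thesis
      by (simp add: u_def mult_nonneg_nonpos)
  qed
  \<comment> \<open>\<open>sub (X i)\<close> and its nearest subgradient have equal tangential
    components, so the separating direction is normal to the manifold.\<close>
  have utan: "u i \<bullet> frechet_derivative \<theta> (at (P (X i))) t = 0" if "t \<in> T" for t i
    using subdiff_tangential'[OF XW that, of "c i" i] cS[of i] by (simp add: u_def S_def inner_diff_left)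
  have "\<forall>i. u i \<in> sphere 0 1"
    using u1 by simp
  then obtain w r where w: "w \<in> sphere 0 1" and r: "strict_mono (r :: nat \<Rightarrow> nat)" "(u \<circ> r) \<longlonglongrightarrow> w"
    using compact_sphere[of "0::'a" 1] unfolding compact_def by metis
  have sub_lim: "(\<lambda>i. k (r i)) \<longlonglongrightarrow> l" if "k \<longlonglongrightarrow> l" for k and l :: 'a
    using LIMSEQ_subseq_LIMSEQ[OF that r(1)] by (simp add: o_def)
  have ur: "(\<lambda>i. u (r i)) \<longlonglongrightarrow> w"
    using r(2) by (simp add: o_def)
  show False
  proof (rule no_separation_at_base[OF v])
    show "w \<noteq> 0"
      using w by auto
    \<comment> \<open>The tangent spaces turn with the point, but they converge to \<open>T\<close>,
      as the derivative of \<open>\<theta>\<close> at 0 is the identity.\<close>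
    show "w \<bullet> t = 0" if "t \<in> T" for t
      using tendsto_inner[OF ur sub_lim[OF D\<theta>X[of t]]] utan[OF that] by (simp add: LIMSEQ_const_iff)
    fix s assume s: "s \<in> subdiff g x"
    obtain s' where s': "\<forall>\<^sub>F i in sequentially. s' i \<in> subdiff g (\<theta> (P (X (r i))))" "s' \<longlonglongrightarrow> s"
      using inner_semicontinuous[of "\<lambda>i. P (X (r i))", OF W_D[OF XW] sub_lim[OF PX] s] by blast
    have "(\<lambda>i. u (r i) \<bullet> (s' i - sub (X (r i)))) \<longlonglongrightarrow> w \<bullet> (s - v)"
      by (intro tendsto_intros ur s' sub_lim subX)
    moreover have "\<forall>\<^sub>F i in sequentially. u (r i) \<bullet> (s' i - sub (X (r i))) \<le> 0"
      using s'(1) by eventually_elim (auto intro!: usep simp: S_def base_def)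
    ultimately show "w \<bullet> (s - v) \<le> 0"
      by (rule tendsto_upperbound) simp
  qed
qed

lemma eventually_sub_mem_subdiff:
  assumes v: "v \<in> rel_interior (subdiff g x)"
  shows "\<forall>\<^sub>F n in nhds (v - grad h x). n \<in> W \<and> sub n \<in> subdiff g (base n)"
  unfolding eventually_nhds_iff_sequentially
proof (intro allI impI)
  fix X assume X: "X \<longlonglongrightarrow> v - grad h x"
  have "v \<in> subdiff g x"
    using v rel_interior_subset by blast
  then have "v - grad h x \<in> W"
    using P_grad_diff W_normal by blast
  then have XW: "\<forall>\<^sub>F i in sequentially. X i \<in> W"
    using X open_W by (simp add: topological_tendstoD)
  have "\<forall>\<^sub>F i in sequentially. X i \<in> W \<longrightarrow> sub (X i) \<in> subdiff g (base (X i))"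
  proof (rule ccontr)
    assume "\<not> ?thesis"
    then obtain r where r: "strict_mono (r :: nat \<Rightarrow> nat)"
      "\<And>i. X (r i) \<in> W" "\<And>i. sub (X (r i)) \<notin> subdiff g (base (X (r i)))"
      using not_eventually_sequentiallyD[of "\<lambda>i. X i \<in> W \<longrightarrow> sub (X i) \<in> subdiff g (base (X i))"] by auto
    show False
      using sub_mem_subdiff_sequentially[OF v, of "\<lambda>i. X (r i)"] LIMSEQ_subseq_LIMSEQ[OF X r(1)] r(2,3)
      by (auto simp: o_def)
  qed
  with XW show "\<forall>\<^sub>F i in sequentially. X i \<in> W \<and> sub (X i) \<in> subdiff g (base (X i))"
    by eventually_elim simp
qed

text \<open>\<open>\<Phi>\<close> sends a parameter \<open>n\<close> to a point whose proximal image
  is \<open>base n\<close>, so near \<open>x + \<beta> v\<close> the proximal mapping is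
  \<open>base\<close> after the local inverse of \<open>\<Phi>\<close>.\<close>

lemma prox_smooth:
  assumes v: "v \<in> rel_interior (subdiff g x)" and \<beta>: "0 < \<beta>" "\<beta> * \<sigma> < 1"
  shows "C_smooth_near 2 (prox \<beta> g) (x + \<beta> *\<^sub>R v)"
proof -
  define n0 where "n0 = v - grad h x"
  have Pn0: "P n0 = 0"
    unfolding n0_def by (rule P_grad_diff) (use v rel_interior_subset in blast)
  have n0W: "n0 \<in> W" and sub_n0: "sub n0 = v" and base_n0: "base n0 = x"
    using W_normal[OF Pn0] sub_normal[OF Pn0] base_normal[OF Pn0] by (simp_all add: n0_def)
  have ev: "\<forall>\<^sub>F n in nhds n0. n \<in> W \<and> sub n \<in> subdiff g (base n)"
    unfolding n0_def by (rule eventually_sub_mem_subdiff[OF v])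
  then obtain W' where W': "open W'" "n0 \<in> W'" "\<And>n. n \<in> W' \<Longrightarrow> n \<in> W \<and> sub n \<in> subdiff g (base n)"
    unfolding eventually_nhds by blast
  have "W' \<subseteq> W"
    using W'(3) by blast
  define \<Phi> where "\<Phi> n = base n + \<beta> *\<^sub>R sub n" for n
  have \<Phi>_smooth: "C_smooth_on 2 W' \<Phi>"
    unfolding \<Phi>_def
    by (intro C_smooth_on_add C_smooth_on_scaleR C_smooth_on_const W'(1)
        C_smooth_on_subset[OF base_smooth2 \<open>W' \<subseteq> W\<close>] C_smooth_on_subset[OF sub_smooth \<open>W' \<subseteq> W\<close>])
  have gbase: "g (base n) = ereal (h (base n))" if "n \<in> W" for n
    using gh[of "P n"] W_D[OF that] by (simp add: base_def)
  have global: "ereal (h (base n) + sub n \<bullet> (y - base n) - \<sigma> / 2 * (norm (y - base n))\<^sup>2) \<le> g y" if "n \<in> W'" for n y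
    using W'(3)[OF that] subdiff_weakly_convex_iff[OF weakly_convex \<sigma>_nonneg proper gbase] by blast
  have prox: "prox \<beta> g (\<Phi> n) = base n" if "n \<in> W'" for n
    unfolding \<Phi>_def
    by (rule prox_add_scaleR_subgradient[OF \<beta>, of g "base n" "h (base n)"])
       (use W'(3)[OF that] global[OF that] gbase in auto)
  have mono: "(sub n - v) \<bullet> (base n - x) \<ge> - \<sigma> * (norm (base n - x))\<^sup>2" if n: "n \<in> W'" for n
  proof -
    have "h (base n) + sub n \<bullet> (x - base n) - \<sigma> / 2 * (norm (x - base n))\<^sup>2 \<le> h x"
      using global[OF n, of x] g_x by simp
    moreover have "h x + v \<bullet> (base n - x) - \<sigma> / 2 * (norm (base n - x))\<^sup>2 \<le> h (base n)"
      using global[OF W'(2), of "base n"] gbase[of n] W'(3)[OF n] by (simp add: sub_n0 base_n0)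
    moreover have "sub n \<bullet> (x - base n) = - (sub n \<bullet> (base n - x))"
      by (simp add: inner_diff_right)
    ultimately show ?thesis
      by (simp add: inner_diff_left norm_minus_commute[of x])
  qed
  define Dsub where "Dsub = frechet_derivative sub (at n0)"
  have Dsub: "(sub has_derivative Dsub) (at n0)"
    unfolding Dsub_def by (rule C_smooth_on_has_derivative[OF sub_smooth[unfolded numeral_2_eq_2] n0W])
  have "(base has_derivative (\<lambda>d. frechet_derivative \<theta> (at (P n0)) (P d))) (at n0)"
    unfolding base_def
    by (rule has_derivative_compose[OF bounded_linear_imp_has_derivative[OF bounded_linear_P] \<theta>_has_derivative])
       (simp add: Pn0 zero_V)
  then have Dbase: "(base has_derivative P) (at n0)"
    by (simp add: Pn0 D\<theta>_0)
  have "(\<Phi> has_derivative (\<lambda>d. P d + \<beta> *\<^sub>R Dsub d)) (at n0)"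
    unfolding \<Phi>_def by (intro has_derivative_add Dbase has_derivative_scaleR_right Dsub)
  then have D\<Phi>: "frechet_derivative \<Phi> (at n0) = (\<lambda>d. P d + \<beta> *\<^sub>R Dsub d)"
    using frechet_derivative_at by fastforce
  have inj: "d = 0" if "frechet_derivative \<Phi> (at n0) d = 0" for d
  proof -
    have eq: "P d + \<beta> *\<^sub>R Dsub d = 0"
      using that by (simp add: D\<Phi>)
    have lim_sub: "((\<lambda>r. (sub (n0 + r *\<^sub>R d) - v) /\<^sub>R r) \<longlongrightarrow> Dsub d) (at_right 0)"
      using difference_quotient_tendsto[OF Dsub] by (simp add: sub_n0)
    have lim_base: "((\<lambda>r. (base (n0 + r *\<^sub>R d) - x) /\<^sub>R r) \<longlongrightarrow> P d) (at_right 0)"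
      using difference_quotient_tendsto[OF Dbase] by (simp add: base_n0)
    have "((\<lambda>r. n0 + r *\<^sub>R d) \<longlongrightarrow> n0 + 0 *\<^sub>R d) (at_right (0::real))"
      by (intro tendsto_intros)
    then have "\<forall>\<^sub>F r in at_right (0::real). n0 + r *\<^sub>R d \<in> W'"
      using W'(1,2) by (simp add: topological_tendstoD)
    moreover have "\<forall>\<^sub>F r in at_right (0::real). 0 < r"
      by (simp add: eventually_at_right_less)
    ultimately have "\<forall>\<^sub>F r in at_right (0::real). - \<sigma> * (norm ((base (n0 + r *\<^sub>R d) - x) /\<^sub>R r))\<^sup>2 \<le>
        ((sub (n0 + r *\<^sub>R d) - v) /\<^sub>R r) \<bullet> ((base (n0 + r *\<^sub>R d) - x) /\<^sub>R r)"
    proof eventually_elim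
      case (elim r)
      have "- \<sigma> * (norm ((base (n0 + r *\<^sub>R d) - x) /\<^sub>R r))\<^sup>2 = inverse r * inverse r * (- \<sigma> * (norm (base (n0 + r *\<^sub>R d) - x))\<^sup>2)"
        using elim by (simp add: power_mult_distrib power2_eq_square)
      also have "\<dots> \<le> inverse r * inverse r * ((sub (n0 + r *\<^sub>R d) - v) \<bullet> (base (n0 + r *\<^sub>R d) - x))"
        using elim by (intro mult_left_mono mono) auto
      finally show ?case
        by simp
    qed
    then have "- \<sigma> * (norm (P d))\<^sup>2 \<le> Dsub d \<bullet> P d"
      by (rule tendsto_le[rotated -1]) (intro tendsto_intros lim_sub lim_base | simp)+
    moreover have "P d \<bullet> P d + \<beta> * (Dsub d \<bullet> P d) = 0"
      using arg_cong[OF eq, of "\<lambda>w. w \<bullet> P d"] by (simp add: inner_add_left)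
    \<comment> \<open>In the limit, weak monotonicity loses at most the fraction
      \<open>\<beta> * \<sigma> < 1\<close> of the square, so a kernel vector has no tangential
      part.\<close>
    ultimately have "(norm (P d))\<^sup>2 + \<beta> * (- \<sigma> * (norm (P d))\<^sup>2) \<le> 0"
      using \<beta>(1) mult_left_mono[of "- \<sigma> * (norm (P d))\<^sup>2" "Dsub d \<bullet> P d" \<beta>] by (simp add: power2_norm_eq_inner)
    then have "(1 - \<beta> * \<sigma>) * (norm (P d))\<^sup>2 \<le> 0"
      by (simp add: algebra_simps)
    then have Pd: "P d = 0"
      using \<beta>(2) by (simp add: mult_le_0_iff)
    then have "Dsub d = 0"
      using eq \<beta>(1) by simp
    \<comment> \<open>With \<open>P d = 0\<close> the parameter moves inside the normal space, where
      \<open>sub\<close> is a translation; hence \<open>Dsub d = d\<close>.\<close>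
    moreover have "sub (n0 + r *\<^sub>R d) - v = r *\<^sub>R d" for r
    proof -
      have "P (n0 + r *\<^sub>R d) = 0"
        using Pn0 Pd by (simp add: linear_add[OF linear_P] linear_cmul[OF linear_P])
      from sub_normal[OF this] show ?thesis
        by (simp add: n0_def)
    qed
    then have "\<forall>\<^sub>F r in at_right (0::real). (sub (n0 + r *\<^sub>R d) - v) /\<^sub>R r = d"
      using eventually_at_right_less[of "0::real"] by (auto elim: eventually_mono)
    then have "((\<lambda>r. (sub (n0 + r *\<^sub>R d) - v) /\<^sub>R r) \<longlongrightarrow> d) (at_right 0)"
      by (rule tendsto_eventually)
    ultimately show "d = 0"
      using tendsto_unique[OF _ lim_sub] by force
  qed
  have \<Phi>_smooth': "C_smooth_on (Suc 1) W' \<Phi>"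
    using \<Phi>_smooth by (simp only: numeral_2_eq_2 One_nat_def)
  obtain U' V' \<Theta> where \<Theta>: "open U'" "U' \<subseteq> W'" "open V'" "\<Phi> n0 \<in> V'" "homeomorphism U' V' \<Phi> \<Theta>" "C_smooth_on (Suc 1) V' \<Theta>"
    using C_smooth_on_local_inverse[OF W'(1,2) \<Phi>_smooth' inj] by metis
  have \<Theta>_mem: "\<Theta> w \<in> W'" and \<Phi>_\<Theta>: "\<Phi> (\<Theta> w) = w" if "w \<in> V'" for w
    using \<Theta>(2,5) that by (auto simp: homeomorphism_def)
  have "C_smooth_on 2 V' (\<lambda>w. base (\<Theta> w))"
    by (rule C_smooth_on_compose[OF \<Theta>(3) _ base_smooth2])
       (use \<Theta>(6) \<Theta>_mem W'(3) in \<open>auto simp only: numeral_2_eq_2 One_nat_def\<close>)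
  moreover have "base (\<Theta> w) = prox \<beta> g w" if "w \<in> V'" for w
    using prox[OF \<Theta>_mem[OF that]] \<Phi>_\<Theta>[OF that] by simp
  ultimately have C: "C_smooth_on 2 V' (prox \<beta> g)"
    by (rule C_smooth_on_cong[OF \<Theta>(3)])
  have "\<Phi> n0 = x + \<beta> *\<^sub>R v"
    by (simp add: \<Phi>_def sub_n0 base_n0)
  then obtain e where "e > 0" "ball (x + \<beta> *\<^sub>R v) e \<subseteq> V'"
    using \<Theta>(3,4) open_contains_ball by metis
  then show ?thesis
    unfolding C_smooth_near_def using C_smooth_on_subset[OF C] by blast
qed

end

lemma regular_at_clarke_subdiff: "regular_at \<phi> x \<Longrightarrow> clarke_subdiff \<phi> x = subdiff \<phi> x"
  by (auto simp: regular_at_def clarke_subdiff_def subdiff_def)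

lemma active_manifold_prox_smooth:
  fixes g :: "'a::euclidean_space \<Rightarrow> ereal"
  assumes wc: "weakly_convex \<sigma> g" and \<sigma>: "0 \<le> \<sigma>" and proper: "\<And>x. g x \<noteq> -\<infinity>"
    and active: "active_manifold 3 g M x" and v: "v \<in> rel_interior (subdiff g x)" and \<beta>: "0 < \<beta>" "\<beta> * \<sigma> < 1"
  shows "C_smooth_near 2 (prox \<beta> g) (x + \<beta> *\<^sub>R v)"
proof -
  have 3: "3 = Suc 2" by simp
  obtain r G h where xM: "x \<in> M" and G: "manifold_equation 3 r M x G" and h: "C_smooth_near 3 h x"
    and gh: "\<forall>\<^sub>F y in nhds x. y \<in> M \<longrightarrow> g y = ereal (h y)"
    and reg: "\<forall>\<^sub>F y in nhds x. y \<in> M \<longrightarrow> regular_at g y \<and> subdiff g y \<noteq> {}"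
    and sharp: "\<And>\<nu>. \<nu> \<in> normal_space r G x \<Longrightarrow> \<nu> \<noteq> 0 \<Longrightarrow> subderivative g x (- \<nu>) > - subderivative g x \<nu>"
    and cont: "setvalued_continuous_at_rel (clarke_subdiff g) x M"
    using active unfolding active_manifold_def by blast
  define T where "T = tangent_space r G x"
  have T: "subspace T"
    unfolding T_def by (rule subspace_tangent_space)
  obtain \<Psi> \<epsilon>0 where \<Psi>: "C_smooth_on (Suc 2) UNIV \<Psi>" "\<Psi> x = 0" "(\<Psi> has_derivative (\<lambda>d. d)) (at x)"
    and \<epsilon>0: "\<epsilon>0 > 0" "\<And>y. y \<in> ball x \<epsilon>0 \<Longrightarrow> y \<in> M \<longleftrightarrow> \<Psi> y \<in> T"
    using manifold_equation_chart[OF G[unfolded 3] xM] unfolding T_def by blast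
  obtain \<epsilon>1 where \<epsilon>1: "\<epsilon>1 > 0" "C_smooth_on 3 (ball x \<epsilon>1) h"
    using h unfolding C_smooth_near_def by blast
  obtain \<epsilon>2 where \<epsilon>2: "\<epsilon>2 > 0" "\<And>y. dist y x < \<epsilon>2 \<Longrightarrow> y \<in> M \<Longrightarrow> g y = ereal (h y) \<and> regular_at g y \<and> subdiff g y \<noteq> {}"
    using eventually_conj[OF gh reg] by (auto simp: eventually_nhds_metric)
  \<comment> \<open>On this ball the chart describes \<open>M\<close>, \<open>h\<close> is smooth,
    and on \<open>M\<close> the function \<open>g\<close> equals \<open>h\<close> and is regular
    with a subgradient.\<close>
  define \<epsilon> where "\<epsilon> = min \<epsilon>0 (min \<epsilon>1 \<epsilon>2)"
  have \<epsilon>: "\<epsilon> > 0"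
    using \<epsilon>0 \<epsilon>1 \<epsilon>2 by (simp add: \<epsilon>_def)
  have D\<Psi>: "frechet_derivative \<Psi> (at x) = (\<lambda>d. d)"
    using frechet_derivative_at[OF \<Psi>(3)] by simp
  have x\<epsilon>: "x \<in> ball x \<epsilon>"
    using \<epsilon> by simp
  have \<Psi>C: "C_smooth_on (Suc 2) (ball x \<epsilon>) \<Psi>"
    by (rule C_smooth_on_subset[OF \<Psi>(1)]) simp
  have inj: "frechet_derivative \<Psi> (at x) d = 0 \<Longrightarrow> d = 0" for d
    by (simp add: D\<Psi>)
  obtain U V \<theta> where U: "open U" "U \<subseteq> ball x \<epsilon>" "x \<in> U" "open V" "\<Psi> x \<in> V" "homeomorphism U V \<Psi> \<theta>"
    and \<theta>: "C_smooth_on (Suc 2) V \<theta>"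
    by (rule C_smooth_on_local_inverse[OF open_ball x\<epsilon> \<Psi>C inj])
  have \<theta>U: "\<theta> \<xi> \<in> U" and \<Psi>\<theta>: "\<Psi> (\<theta> \<xi>) = \<xi>" if "\<xi> \<in> V" for \<xi>
    using U(6) that by (auto simp: homeomorphism_def)
  have \<theta>M: "\<theta> \<xi> \<in> M" and \<theta>2: "dist (\<theta> \<xi>) x < \<epsilon>2" if "\<xi> \<in> V" "\<xi> \<in> T" for \<xi>
    using \<epsilon>0(2)[of "\<theta> \<xi>"] \<theta>U[OF that(1)] U(2) \<Psi>\<theta>[OF that(1)] that(2)
    by (auto simp: \<epsilon>_def subset_iff dist_commute)
  have \<theta>0: "\<theta> 0 = x"
    using U(3,6) \<Psi>(2) by (metis homeomorphism_apply1)
  have zero: "0 \<in> V"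
    using U(5) \<Psi>(2) by simp
  obtain P where P: "linear P" "\<And>d. P d \<in> T" "\<And>t. t \<in> T \<Longrightarrow> P t = t" "\<And>d t. t \<in> T \<Longrightarrow> (d - P d) \<bullet> t = 0"
    using orthogonal_projection_exists[OF T] by blast
  have clarke: "clarke_subdiff g y = subdiff g y" if "y \<in> M" "dist y x < \<epsilon>2" for y
    using \<epsilon>2(2)[OF that(2,1)] regular_at_clarke_subdiff by blast
  have near: "y \<in> M \<Longrightarrow> dist y x < \<epsilon>2 \<Longrightarrow> g y = ereal (h y) \<and> subdiff g y \<noteq> {}" for y
    using \<epsilon>2(2) by blast
  interpret active_chart g \<sigma> x h T U V \<Psi> \<theta> P
  proof
    show "C_smooth_on 3 U \<Psi>"
      unfolding 3 by (rule C_smooth_on_subset[OF \<Psi>(1)]) simp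
    show "C_smooth_on 3 V \<theta>"
      unfolding 3 by (rule \<theta>)
    have "ball x \<epsilon> \<subseteq> ball x \<epsilon>1"
      by (auto simp: \<epsilon>_def)
    then show "C_smooth_on 3 U h"
      using U(2) by (intro C_smooth_on_subset[OF \<epsilon>1(2)]) blast
    show "g (\<theta> \<xi>) = ereal (h (\<theta> \<xi>))" "subdiff g (\<theta> \<xi>) \<noteq> {}" if "\<xi> \<in> V" "\<xi> \<in> T" for \<xi>
      using near[OF \<theta>M[OF that] \<theta>2[OF that]] by auto
    \<comment> \<open>The inner half of the continuity condition yields a sequence of Clarke
      subgradients; regularity identifies them with regular ones, at \<open>x\<close> and along the
      sequence.\<close>
    show "\<exists>S. (\<forall>\<^sub>F i in sequentially. S i \<in> subdiff g (\<theta> (X i))) \<and> S \<longlonglongrightarrow> s"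
      if X: "\<And>i. X i \<in> V \<inter> T" "X \<longlonglongrightarrow> 0" and s: "s \<in> subdiff g x" for X s
    proof -
      have XV: "X i \<in> V" "X i \<in> T" for i
        using X(1) by auto
      have "continuous_on V \<theta>"
        using U(6) by (simp add: homeomorphism_def)
      from continuous_on_tendsto_compose[OF this X(2) zero] have "(\<lambda>i. \<theta> (X i)) \<longlonglongrightarrow> x"
        using XV \<theta>0 by simp
      moreover have "s \<in> clarke_subdiff g x"
        using s clarke[OF xM] \<epsilon>2(1) by simp
      ultimately obtain S where "\<forall>\<^sub>F i in sequentially. S i \<in> clarke_subdiff g (\<theta> (X i))" "S \<longlonglongrightarrow> s"
        using cont \<theta>M[OF XV] unfolding setvalued_continuous_at_rel_def by meson
      then show ?thesis
        using clarke[OF \<theta>M[OF XV] \<theta>2[OF XV]] by auto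
    qed
    show "- subderivative g x u < subderivative g x (- u)" if "\<And>t. t \<in> T \<Longrightarrow> u \<bullet> t = 0" "u \<noteq> 0" for u
      using that by (intro sharp) (auto simp: normal_space_def orthogonal_comp_def orthogonal_def T_def inner_commute)
  qed (rule wc \<sigma> proper T P linear_add[OF P(1)] linear_cmul[OF P(1)] U(1,4) zero \<theta>0 \<theta>U \<Psi>\<theta> D\<Psi> | assumption)+
  show ?thesis
    by (rule prox_smooth[OF v \<beta>])
qed

section \<open>Smoothness near a point and the proximal mapping of the smooth term\<close>

text \<open>Open sets are stable under the preimages and intersections that occur in compositions
  and sums; balls are not.\<close>

lemma C_smooth_near_iff_open: "C_smooth_near p h x \<longleftrightarrow> (\<exists>U. open U \<and> x \<in> U \<and> C_smooth_on p U h)"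
proof
  assume "\<exists>U. open U \<and> x \<in> U \<and> C_smooth_on p U h"
  then obtain U where U: "open U" "x \<in> U" "C_smooth_on p U h" by blast
  then obtain e where "e > 0" "ball x e \<subseteq> U"
    using open_contains_ball by blast
  then show "C_smooth_near p h x"
    unfolding C_smooth_near_def using C_smooth_on_subset[OF U(3)] by blast
next
  assume "C_smooth_near p h x"
  then show "\<exists>U. open U \<and> x \<in> U \<and> C_smooth_on p U h"
    unfolding C_smooth_near_def by (metis open_ball centre_in_ball)
qed

lemma C_smooth_near_mono: "C_smooth_near q h x \<Longrightarrow> p \<le> q \<Longrightarrow> C_smooth_near p h x"
  unfolding C_smooth_near_def using C_smooth_on_mono by blast

lemma C_smooth_near_compose:
  fixes k :: "'a::euclidean_space \<Rightarrow> 'b::euclidean_space" and l :: "'b \<Rightarrow> 'c::real_normed_vector"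
  assumes "C_smooth_near p k x" "C_smooth_near p l (k x)"
  shows "C_smooth_near p (\<lambda>x. l (k x)) x"
proof -
  obtain U V where U: "open U" "x \<in> U" "C_smooth_on p U k" and V: "open V" "k x \<in> V" "C_smooth_on p V l"
    using assms unfolding C_smooth_near_iff_open by blast
  have op: "open (U \<inter> k -` V)"
    using C_smooth_on_continuous[OF U(3)] U(1) V(1) by (rule continuous_open_preimage)
  have "C_smooth_on p (U \<inter> k -` V) (\<lambda>x. l (k x))"
    by (rule C_smooth_on_compose[OF op C_smooth_on_subset[OF U(3)] V(3)]) auto
  then show ?thesis
    unfolding C_smooth_near_iff_open using op U(2) V(2) by blast
qed

lemma C_smooth_near_binary:
  assumes op: "\<And>U. open U \<Longrightarrow> C_smooth_on p U k \<Longrightarrow> C_smooth_on p U l \<Longrightarrow> C_smooth_on p U m"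
    and "C_smooth_near p k x" "C_smooth_near p l x"
  shows "C_smooth_near p m x"
proof -
  obtain U V where U: "open U" "x \<in> U" "C_smooth_on p U k" and V: "open V" "x \<in> V" "C_smooth_on p V l"
    using assms(2,3) unfolding C_smooth_near_iff_open by blast
  have "C_smooth_on p (U \<inter> V) m"
    by (rule op[OF open_Int[OF U(1) V(1)] C_smooth_on_subset[OF U(3)] C_smooth_on_subset[OF V(3)]]) auto
  then show ?thesis
    unfolding C_smooth_near_iff_open using U V by blast
qed

lemma C_smooth_near_add: "C_smooth_near p k x \<Longrightarrow> C_smooth_near p l x \<Longrightarrow> C_smooth_near p (\<lambda>x. k x + l x) x"
  by (rule C_smooth_near_binary[of p k l]) (auto intro: C_smooth_on_add)

lemma C_smooth_near_diff: "C_smooth_near p k x \<Longrightarrow> C_smooth_near p l x \<Longrightarrow> C_smooth_near p (\<lambda>x. k x - l x) x"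
  by (rule C_smooth_near_binary[of p k l]) (auto intro: C_smooth_on_diff)

lemma C_smooth_near_ident: "C_smooth_near p (\<lambda>x. x) x"
  unfolding C_smooth_near_def by (intro exI[of _ 1]) (simp add: C_smooth_on_ident)

lemma C_smooth_near_scaleR: "C_smooth_near p k x \<Longrightarrow> C_smooth_near p (\<lambda>x. c *\<^sub>R k x) x"
  unfolding C_smooth_near_def by (blast intro: C_smooth_on_scaleR[OF open_ball C_smooth_on_const])

text \<open>Used for \<open>grad f\<close>, where it makes
  \<open>d \<mapsto> d + \<beta> A d\<close> injective, and for \<open>H\<close>, where the
  contraction factor bounds the derivative at the fixed point.\<close>

lemma has_derivative_norm_bound:
  fixes k :: "'a::real_normed_vector \<Rightarrow> 'b::real_normed_vector"
  assumes k: "(k has_derivative A) (at x)" and L: "\<forall>\<^sub>F y in nhds x. norm (k y - k x) \<le> L * norm (y - x)"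
  shows "norm (A d) \<le> L * norm d"
proof -
  have "((\<lambda>r. x + r *\<^sub>R d) \<longlongrightarrow> x + 0 *\<^sub>R d) (at_right (0::real))"
    by (intro tendsto_intros)
  then have "((\<lambda>r. x + r *\<^sub>R d) \<longlongrightarrow> x) (at_right (0::real))"
    by simp
  from filterlim_iff[THEN iffD1, OF this, rule_format, OF L]
  have "\<forall>\<^sub>F r in at_right (0::real). norm (k (x + r *\<^sub>R d) - k x) \<le> L * norm (x + r *\<^sub>R d - x)" .
  moreover have "\<forall>\<^sub>F r in at_right (0::real). 0 < r"
    by (simp add: eventually_at_right_less)
  ultimately have "\<forall>\<^sub>F r in at_right (0::real). norm ((k (x + r *\<^sub>R d) - k x) /\<^sub>R r) \<le> L * norm d"
  proof eventually_elim
    case (elim r)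
    have "norm (k (x + r *\<^sub>R d) - k x) \<le> (L * norm d) * r"
      using elim by (simp add: mult.commute mult.left_commute)
    then show ?case
      using elim(2) by (simp add: divide_inverse_commute[symmetric] pos_divide_le_eq)
  qed
  then show ?thesis
    using tendsto_upperbound[OF tendsto_norm[OF difference_quotient_tendsto[OF k]]] by fastforce
qed

text \<open>The derivative of \<open>\<Gamma>\<close> is injective because
  \<open>norm (A d) \<le> L * norm d\<close> and \<open>\<beta> * L < 1\<close>. Passing to the
  gradient costs one order.\<close>

lemma prox_smooth_of_lipschitz_grad:
  fixes f :: "'a::euclidean_space \<Rightarrow> real"
  assumes f: "\<And>x. GDERIV f x :> grad f x" and L: "L-lipschitz_on UNIV (grad f)"
    and \<beta>: "0 < \<beta>" "\<beta> * L < 1" and C: "C_smooth_near (Suc (Suc p)) f (prox \<beta> (\<lambda>y. ereal (f y)) z)"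
  shows "C_smooth_near (Suc p) (prox \<beta> (\<lambda>y. ereal (f y))) z"
proof -
  define x where "x = prox \<beta> (\<lambda>y. ereal (f y)) z"
  define \<Gamma> where "\<Gamma> y = y + \<beta> *\<^sub>R grad f y" for y
  have \<Gamma>x: "\<Gamma> x = z"
    unfolding \<Gamma>_def x_def by (rule prox_add_scaleR_grad_prox[OF f L \<beta>])
  have prox: "prox \<beta> (\<lambda>y. ereal (f y)) (\<Gamma> y) = y" for y
    unfolding \<Gamma>_def by (rule prox_add_scaleR_grad[OF f L \<beta>])
  obtain U where U: "open U" "x \<in> U" "C_smooth_on (Suc (Suc p)) U f"
    using C unfolding x_def C_smooth_near_iff_open by blast
  have gC: "C_smooth_on (Suc p) U (grad f)"
    by (rule C_smooth_on_grad[OF U(1,3)])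
  have \<Gamma>C: "C_smooth_on (Suc p) U \<Gamma>"
    unfolding \<Gamma>_def by (intro C_smooth_on_add C_smooth_on_scaleR C_smooth_on_const C_smooth_on_ident gC U(1))
  define A where "A = frechet_derivative (grad f) (at x)"
  have A: "(grad f has_derivative A) (at x)"
    unfolding A_def by (rule C_smooth_on_has_derivative[OF gC U(2)])
  have "(\<Gamma> has_derivative (\<lambda>d. d + \<beta> *\<^sub>R A d)) (at x)"
    unfolding \<Gamma>_def by (intro has_derivative_add has_derivative_ident has_derivative_scaleR_right A)
  then have D\<Gamma>: "frechet_derivative \<Gamma> (at x) = (\<lambda>d. d + \<beta> *\<^sub>R A d)"
    using frechet_derivative_at by fastforce
  have An: "norm (A d) \<le> L * norm d" for d
    by (rule has_derivative_norm_bound[OF A]) (use lipschitz_onD[OF L] in \<open>simp add: dist_norm\<close>)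
  have inj: "d = 0" if "frechet_derivative \<Gamma> (at x) d = 0" for d
  proof -
    have "d = - (\<beta> *\<^sub>R A d)"
      using that by (simp add: D\<Gamma> eq_neg_iff_add_eq_0)
    then have "norm d = \<beta> * norm (A d)"
      using \<beta>(1) by (metis abs_of_pos norm_minus_cancel norm_scaleR)
    also have "\<dots> \<le> \<beta> * (L * norm d)"
      using An \<beta>(1) by (intro mult_left_mono) auto
    finally have "(1 - \<beta> * L) * norm d \<le> 0"
      by (simp add: algebra_simps)
    then show ?thesis
      using \<beta>(2) by (simp add: mult_le_0_iff)
  qed
  obtain U' V \<Theta> where \<Theta>: "open V" "\<Gamma> x \<in> V" "homeomorphism U' V \<Gamma> \<Theta>" "C_smooth_on (Suc p) V \<Theta>"
    using C_smooth_on_local_inverse[OF U(1,2) \<Gamma>C inj] by metis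
  have "\<Theta> w = prox \<beta> (\<lambda>y. ereal (f y)) w" if "w \<in> V" for w
    using prox[of "\<Theta> w"] homeomorphism_apply2[OF \<Theta>(3) that] by simp
  then have "C_smooth_on (Suc p) V (prox \<beta> (\<lambda>y. ereal (f y)))"
    by (rule C_smooth_on_cong[OF \<Theta>(1,4)])
  then show ?thesis
    using \<Theta>(1,2) unfolding \<Gamma>x C_smooth_near_iff_open by blast
qed

section \<open>Lipschitz continuity of smooth mappings and of their derivatives\<close>

lemma norm_linear_le_sum_Basis:
  fixes L :: "'a::euclidean_space \<Rightarrow> 'b::real_normed_vector"
  assumes "linear L"
  shows "norm (L d) \<le> (\<Sum>b\<in>Basis. norm (L b)) * norm d"
proof -
  have "norm (L d) \<le> (\<Sum>b\<in>Basis. norm ((d \<bullet> b) *\<^sub>R L b))"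
    unfolding linear_sum_Basis[OF assms, of d] by (rule norm_sum)
  also have "\<dots> \<le> (\<Sum>b\<in>Basis. norm (L b) * norm d)"
  proof (rule sum_mono)
    fix b :: 'a assume "b \<in> Basis"
    then show "norm ((d \<bullet> b) *\<^sub>R L b) \<le> norm (L b) * norm d"
      using mult_right_mono[OF Basis_le_norm[of b d], of "norm (L b)"] by (simp add: mult.commute)
  qed
  finally show ?thesis
    by (simp add: sum_distrib_right)
qed

text \<open>Halving the radius puts the derivative on a compact ball, where it is bounded; convexity
  of the ball then gives the mean value estimate.\<close>

lemma C_smooth_near_lipschitz:
  fixes h :: "'a::euclidean_space \<Rightarrow> 'b::real_normed_vector"
  assumes "C_smooth_near (Suc 0) h x"
  shows "\<exists>\<epsilon>>0. \<exists>L. L-lipschitz_on (ball x \<epsilon>) h"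
proof -
  obtain e where e: "e > 0" "C_smooth_on (Suc 0) (ball x e) h"
    using assms unfolding C_smooth_near_def by blast
  define D where "D y = frechet_derivative h (at y)" for y
  have D: "(h has_derivative D y) (at y)" if "y \<in> ball x e" for y
    unfolding D_def by (rule C_smooth_on_has_derivative[OF e(2) that])
  have cont: "continuous_on (ball x e) (\<lambda>y. D y b)" for b
    using e(2) by (simp add: D_def)
  have sub: "cball x (e / 2) \<subseteq> ball x e"
    using e(1) by auto
  have "continuous_on (cball x (e / 2)) (\<lambda>y. \<Sum>b\<in>Basis. norm (D y b))"
    by (intro continuous_intros continuous_on_subset[OF cont sub])
  then have "bounded ((\<lambda>y. \<Sum>b\<in>Basis. norm (D y b)) ` cball x (e / 2))"
    by (intro compact_imp_bounded compact_continuous_image) auto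
  then obtain B where B: "B > 0" "\<And>y. y \<in> cball x (e / 2) \<Longrightarrow> (\<Sum>b\<in>Basis. norm (D y b)) \<le> B"
    by (force simp: bounded_pos)
  have "B-lipschitz_on (ball x (e / 2)) h"
  proof (rule lipschitz_onI)
    fix y z assume yz: "y \<in> ball x (e / 2)" "z \<in> ball x (e / 2)"
    have "norm (h y - h z) \<le> B * norm (y - z)"
    proof (rule differentiable_bound[OF convex_ball _ _ yz])
      fix w assume w: "w \<in> ball x (e / 2)"
      have w': "w \<in> ball x e" "w \<in> cball x (e / 2)"
        using w e(1) by auto
      show "(h has_derivative D w) (at w within ball x (e / 2))"
        by (rule has_derivative_at_withinI[OF D[OF w'(1)]])
      show "onorm (D w) \<le> B"
      proof (rule onorm_bound)
        fix d
        have "norm (D w d) \<le> (\<Sum>b\<in>Basis. norm (D w b)) * norm d"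
          by (rule norm_linear_le_sum_Basis[OF has_derivative_linear[OF D[OF w'(1)]]])
        also have "\<dots> \<le> B * norm d"
          using B(2)[OF w'(2)] by (intro mult_right_mono) auto
        finally show "norm (D w d) \<le> B * norm d" .
      qed (use B(1) in simp)
    qed
    then show "dist (h y) (h z) \<le> B * dist y z"
      by (simp add: dist_norm)
  qed (use B(1) in simp)
  then show ?thesis
    using e(1) by (intro exI[of _ "e / 2"]) auto
qed

text \<open>The operator norm is at most the sum of the norms of the values at basis vectors, so the
  Lipschitz constants of the finitely many maps \<open>y \<mapsto> D y b\<close> add up on the
  smallest of their balls.\<close>

lemma C_smooth_near_lipschitz_derivative:
  fixes H :: "'a::euclidean_space \<Rightarrow> 'b::real_normed_vector"
  assumes H: "C_smooth_near 2 H x"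
  shows "\<exists>\<epsilon>>0. \<exists>L. \<exists>DH :: 'a \<Rightarrow> 'a \<Rightarrow>\<^sub>L 'b. (\<forall>z\<in>ball x \<epsilon>. (H has_derivative blinfun_apply (DH z)) (at z)) \<and>
    L-lipschitz_on (ball x \<epsilon>) DH"
proof -
  obtain e where e: "e > 0" "C_smooth_on (Suc (Suc 0)) (ball x e) H"
    using H unfolding C_smooth_near_def numeral_2_eq_2 by blast
  define D where "D y = frechet_derivative H (at y)" for y
  have D: "(H has_derivative D y) (at y)" if "y \<in> ball x e" for y
    unfolding D_def by (rule C_smooth_on_has_derivative[OF e(2) that])
  have "C_smooth_on (Suc 0) (ball x e) (\<lambda>y. D y b)" for b
    using e(2) unfolding D_def by (subst (asm) C_smooth_on.simps(2)) blast
  then have "C_smooth_near (Suc 0) (\<lambda>y. D y b) x" for b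
    using e(1) unfolding C_smooth_near_def by blast
  from C_smooth_near_lipschitz[OF this]
  obtain E L where EL: "\<And>b. E b > 0" "\<And>b. (L b)-lipschitz_on (ball x (E b)) (\<lambda>y. D y b)"
    by metis
  define \<epsilon> where "\<epsilon> = min e (Min (E ` Basis))"
  have \<epsilon>: "\<epsilon> > 0" "\<epsilon> \<le> e" "\<And>b. b \<in> Basis \<Longrightarrow> \<epsilon> \<le> E b"
    using e(1) EL(1) by (auto simp: \<epsilon>_def min_le_iff_disj)
  define DH where "DH y = Blinfun (D y)" for y
  have DH: "blinfun_apply (DH y) = D y" if "y \<in> ball x \<epsilon>" for y
    unfolding DH_def using D[of y] that \<epsilon>(2)
    by (intro bounded_linear_Blinfun_apply has_derivative_bounded_linear) auto
  have "(\<Sum>b\<in>Basis. L b)-lipschitz_on (ball x \<epsilon>) DH"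
  proof (rule lipschitz_onI)
    fix y z assume yz: "y \<in> ball x \<epsilon>" "z \<in> ball x \<epsilon>"
    have "norm (DH y - DH z) \<le> (\<Sum>b\<in>Basis. norm (blinfun_apply (DH y - DH z) b))"
      by (rule norm_blinfun_bound)
         (auto intro!: sum_nonneg norm_linear_le_sum_Basis bounded_linear.linear blinfun.bounded_linear_right)
    also have "\<dots> \<le> (\<Sum>b\<in>Basis. L b * dist y z)"
    proof (rule sum_mono)
      fix b :: 'a assume b: "b \<in> Basis"
      then have "y \<in> ball x (E b)" "z \<in> ball x (E b)"
        using yz \<epsilon>(3)[OF b] by auto
      then show "norm (blinfun_apply (DH y - DH z) b) \<le> L b * dist y z"
        using lipschitz_onD[OF EL(2)[of b]] yz by (simp add: blinfun.diff_left DH dist_norm)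
    qed
    finally show "dist (DH y) (DH z) \<le> (\<Sum>b\<in>Basis. L b) * dist y z"
      by (simp add: dist_norm sum_distrib_right)
  qed (use EL(2) lipschitz_on_nonneg in \<open>auto intro!: sum_nonneg\<close>)
  moreover have "\<forall>z\<in>ball x \<epsilon>. (H has_derivative blinfun_apply (DH z)) (at z)"
    using D DH \<epsilon>(2) by auto
  ultimately show ?thesis
    using \<epsilon>(1) by blast
qed

section \<open>Anderson acceleration\<close>

text \<open>By contraction, residual and error are comparable near \<open>zs\<close>. One induction
  therefore bounds the residuals and keeps the iterates in the ball where the remainder estimate
  holds. The rate depends on \<open>\<gamma>\<close> alone, the radius \<open>\<eta>\<close> also on
  \<open>m\<close>, \<open>M\<^sub>\<alpha>\<close> and \<open>H\<close>.\<close>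

lemma anderson_local_convergence:
  fixes H :: "'a::euclidean_space \<Rightarrow> 'a"
  assumes A: "(H has_derivative A) (at zs)" and fix_zs: "H zs = zs" and \<rho>: "\<rho> > 0" and \<gamma>: "0 < \<gamma>" "\<gamma> < 1"
    and contr: "\<And>z z'. z \<in> cball zs \<rho> \<Longrightarrow> z' \<in> cball zs \<rho> \<Longrightarrow> norm (H z - H z') \<le> \<gamma> * norm (z - z')"
  shows "\<exists>\<gamma>'. \<gamma> < \<gamma>' \<and> \<gamma>' < 1 \<and>
    (\<exists>\<eta>>0. \<forall>z0 z \<alpha>. norm (z0 - zs) < \<eta> \<and> anderson_run m H z0 z \<alpha> \<and>
        (\<forall>k. (\<Sum>i\<le>min m k. \<bar>\<alpha> k i\<bar>) \<le> M\<^sub>\<alpha>) \<longrightarrow>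
      z \<longlonglongrightarrow> zs \<and>
      (\<forall>k. norm (H (z k) - z k) \<le> \<gamma>' ^ k * norm (H z0 - z0) \<and>
           norm (z k - zs) \<le> (1 + \<gamma>) / (1 - \<gamma>) * \<gamma>' ^ k * norm (z0 - zs)))"
proof -
  interpret A: bounded_linear A
    using A has_derivative_bounded_linear by blast
  define q where "q = (1 + \<gamma>) / 2"
  have q: "\<gamma> < q" "q < 1" "0 < q" "q - \<gamma> = (1 - \<gamma>) / 2"
    using \<gamma> by (auto simp: q_def field_simps)
  \<comment> \<open>The maximum with 1 keeps \<open>C\<close> positive for every real
    \<open>M\<^sub>\<alpha>\<close> and gives \<open>\<eta> \<le> \<delta>\<close>.\<close>
  define C where "C = max 1 M\<^sub>\<alpha>"
  have C: "C \<ge> 1" "M\<^sub>\<alpha> \<le> C"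
    by (auto simp: C_def)
  \<comment> \<open>Two remainders of size \<open>C * \<epsilon> * E\<close> will occur, and
    \<open>E\<close> contains \<open>1 / (1 - \<gamma>)\<close> and a power of \<open>q\<close> that
    lags by up to \<open>m\<close> steps. Together they must fit into the gap
    \<open>q - \<gamma>\<close>.\<close>
  define \<epsilon> where "\<epsilon> = (q - \<gamma>) * q ^ m * (1 - \<gamma>) / (2 * C)"
  have \<epsilon>: "\<epsilon> > 0" "2 * C * \<epsilon> / (1 - \<gamma>) = (q - \<gamma>) * q ^ m"
    using q \<gamma> C by (auto simp: \<epsilon>_def)
  define R where "R w = H w - zs - A (w - zs)" for w
  obtain \<delta>0 where \<delta>0: "\<delta>0 > 0" "\<And>w. norm (w - zs) < \<delta>0 \<Longrightarrow> norm (R w) \<le> \<epsilon> * norm (w - zs)"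
    using A \<epsilon>(1) unfolding has_derivative_at_alt R_def fix_zs by meson
  define \<delta> where "\<delta> = min \<delta>0 \<rho>"
  have \<delta>: "\<delta> > 0" and ball: "\<And>w. norm (w - zs) < \<delta> \<Longrightarrow> w \<in> cball zs \<rho>"
    and R: "\<And>w. norm (w - zs) < \<delta> \<Longrightarrow> norm (R w) \<le> \<epsilon> * norm (w - zs)"
    using \<delta>0 \<rho> by (auto simp: \<delta>_def dist_norm norm_minus_commute)
  have H_bound: "norm (H w - zs) \<le> \<gamma> * norm (w - zs)" if "norm (w - zs) < \<delta>" for w
    using contr[OF ball[OF that], of zs] \<rho> by (simp add: fix_zs)
  have A_bound: "norm (A d) \<le> \<gamma> * norm d" for d
  proof (rule has_derivative_norm_bound[OF A])
    have "\<forall>\<^sub>F y in nhds zs. dist y zs < \<delta>"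
      using \<delta> by (auto simp: eventually_nhds_metric)
    then show "\<forall>\<^sub>F y in nhds zs. norm (H y - H zs) \<le> \<gamma> * norm (y - zs)"
      by eventually_elim (use H_bound in \<open>simp add: fix_zs dist_norm\<close>)
  qed
  have res_lower: "norm (w - zs) \<le> norm (H w - w) / (1 - \<gamma>)" if "norm (w - zs) < \<delta>" for w
  proof -
    have "norm (w - zs) \<le> norm (H w - w) + norm (H w - zs)"
      using norm_triangle_ineq4[of "H w - zs" "H w - w"] by simp
    then show ?thesis
      using H_bound[OF that] \<gamma> by (simp add: pos_le_divide_eq algebra_simps)
  qed
  have res_upper: "norm (H w - w) \<le> (1 + \<gamma>) * norm (w - zs)" if "norm (w - zs) < \<delta>" for w
    using norm_triangle_ineq4[of "H w - zs" "w - zs"] H_bound[OF that] by (simp add: algebra_simps)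
  \<comment> \<open>The residual at \<open>z0\<close> is then below \<open>2 * \<eta>\<close>, so
    \<open>C\<close> times the error bound \<open>norm (r z0) / (1 - \<gamma>)\<close> stays below
    \<open>\<delta>\<close>.\<close>
  define \<eta> where "\<eta> = \<delta> * (1 - \<gamma>) / (2 * C)"
  have \<eta>: "\<eta> > 0" "\<eta> \<le> \<delta>"
  proof -
    show "\<eta> > 0"
      using \<delta> \<gamma> C by (simp add: \<eta>_def)
    have "\<delta> * (1 - \<gamma>) \<le> \<delta> * (2 * C)"
      using \<delta> \<gamma> C by (intro mult_left_mono) auto
    then show "\<eta> \<le> \<delta>"
      using C by (simp add: \<eta>_def pos_divide_le_eq)
  qed
  have main: "z \<longlonglongrightarrow> zs \<and>
      (\<forall>k. norm (H (z k) - z k) \<le> q ^ k * norm (H z0 - z0) \<and>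
           norm (z k - zs) \<le> (1 + \<gamma>) / (1 - \<gamma>) * q ^ k * norm (z0 - zs))"
    if z0: "norm (z0 - zs) < \<eta>" and run: "anderson_run m H z0 z \<alpha>"
      and bound: "\<And>k. (\<Sum>i\<le>min m k. \<bar>\<alpha> k i\<bar>) \<le> M\<^sub>\<alpha>" for z0 z \<alpha>
  proof -
    define r where "r w = H w - w" for w
    have z_0: "z 0 = z0"
      using run by (simp add: anderson_run_def)
    have z0\<delta>: "norm (z0 - zs) < \<delta>"
      using z0 \<eta> by simp
    have r0: "norm (r z0) \<le> (1 + \<gamma>) * norm (z0 - zs)"
      unfolding r_def by (rule res_upper[OF z0\<delta>])
    have r0': "C * (norm (r z0) / (1 - \<gamma>)) < \<delta>"
    proof -
      have "norm (r z0) < 2 * \<eta>"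
      proof -
        have "(1 + \<gamma>) * norm (z0 - zs) \<le> 2 * norm (z0 - zs)"
          using \<gamma> by (intro mult_right_mono) auto
        then show ?thesis
          using r0 z0 by simp
      qed
      also have "2 * \<eta> = \<delta> * (1 - \<gamma>) / C"
        using C by (simp add: \<eta>_def field_simps)
      finally show ?thesis
        using \<gamma> C by (simp add: field_simps)
    qed
    have inv: "norm (z k - zs) < \<delta> \<and> norm (r (z k)) \<le> q ^ k * norm (r z0)" for k
    proof (induction k rule: less_induct)
      case (less n)
      show ?case
      proof (cases n)
        case 0
        then show ?thesis
          using z0\<delta> by (simp add: z_0)
      next
        case (Suc k)
        define mk where "mk = min m k"
        define w where "w i = z (k - mk + i)" for i
        define a where "a = \<alpha> k"
        have mk: "mk \<le> m" "mk \<le> k"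
          by (auto simp: mk_def)
        have sum1: "(\<Sum>i\<le>mk. a i) = 1"
          and opt: "\<And>a'. (\<Sum>i\<le>mk. a' i) = 1 \<Longrightarrow>
            (norm (\<Sum>i\<le>mk. a i *\<^sub>R r (w i)))\<^sup>2 \<le> (norm (\<Sum>i\<le>mk. a' i *\<^sub>R r (w i)))\<^sup>2"
          and step: "z n = (\<Sum>i\<le>mk. a i *\<^sub>R H (w i))"
        proof -
          have "is_arg_min (\<lambda>a. (norm (\<Sum>i\<le>mk. a i *\<^sub>R r (w i)))\<^sup>2) (\<lambda>a. (\<Sum>i\<le>mk. a i) = 1) a"
            and "z n = (\<Sum>i\<le>mk. a i *\<^sub>R H (w i))"
            using run unfolding anderson_run_def mk_def w_def a_def r_def Suc by blast+
          then show "(\<Sum>i\<le>mk. a i) = 1" "z n = (\<Sum>i\<le>mk. a i *\<^sub>R H (w i))"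
            "\<And>a'. (\<Sum>i\<le>mk. a' i) = 1 \<Longrightarrow>
              (norm (\<Sum>i\<le>mk. a i *\<^sub>R r (w i)))\<^sup>2 \<le> (norm (\<Sum>i\<le>mk. a' i *\<^sub>R r (w i)))\<^sup>2"
            unfolding is_arg_min_def not_ex not_less de_Morgan_conj by blast+
        qed
        have absum: "(\<Sum>i\<le>mk. \<bar>a i\<bar>) \<le> C"
          using bound[of k] C by (simp add: mk_def a_def)
        \<comment> \<open>A common error bound for the window: its oldest index is
          \<open>k - mk\<close>, and \<open>res_lower\<close> turns residuals into errors at the
          cost of \<open>1 / (1 - \<gamma>)\<close>.\<close>
        define E where "E = q ^ (k - mk) * norm (r z0) / (1 - \<gamma>)"
        have E0: "0 \<le> E"
          using q \<gamma> by (simp add: E_def)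
        have w\<delta>: "norm (w i - zs) < \<delta>" and wE: "norm (w i - zs) \<le> E" if "i \<le> mk" for i
        proof -
          have IH: "norm (w i - zs) < \<delta>" "norm (r (w i)) \<le> q ^ (k - mk + i) * norm (r z0)"
            unfolding w_def using less.IH[of "k - mk + i"] that mk Suc by auto
          show "norm (w i - zs) < \<delta>" by (rule IH)
          have "norm (r (w i)) \<le> q ^ (k - mk) * norm (r z0)"
            using q by (intro order_trans[OF IH(2)] mult_right_mono power_decreasing) auto
          then have "norm (r (w i)) / (1 - \<gamma>) \<le> E"
            unfolding E_def using \<gamma> by (intro divide_right_mono) auto
          with res_lower[OF IH(1)] show "norm (w i - zs) \<le> E"
            unfolding r_def by linarith
        qed
        have weighted: "norm (\<Sum>i\<le>mk. a i *\<^sub>R u i) \<le> C * B"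
          if "\<And>i. i \<le> mk \<Longrightarrow> norm (u i) \<le> B" "0 \<le> B" for u :: "nat \<Rightarrow> 'a" and B
        proof -
          have "norm (\<Sum>i\<le>mk. a i *\<^sub>R u i) \<le> (\<Sum>i\<le>mk. \<bar>a i\<bar> * B)"
            using that by (intro sum_norm_le) (auto intro: mult_left_mono)
          also have "\<dots> \<le> C * B"
            unfolding sum_distrib_right[symmetric] using absum that(2) by (rule mult_right_mono)
          finally show ?thesis .
        qed
        have CE: "C * E < \<delta>"
        proof -
          have "q ^ (k - mk) \<le> 1"
            using q by (intro power_le_one) auto
          then have "q ^ (k - mk) * (norm (r z0) / (1 - \<gamma>)) \<le> 1 * (norm (r z0) / (1 - \<gamma>))"
            using \<gamma> by (intro mult_right_mono) auto
          then have "C * E \<le> C * (norm (r z0) / (1 - \<gamma>))"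
            using C unfolding E_def by (intro mult_left_mono) auto
          with r0' show ?thesis by linarith
        qed
        have step': "z n - zs = (\<Sum>i\<le>mk. a i *\<^sub>R (H (w i) - zs))"
          using sum1 by (simp add: step scaleR_diff_right sum_subtractf flip: scaleR_sum_left)
        have zn: "norm (z n - zs) \<le> C * E"
          unfolding step'
        proof (rule weighted[OF _ E0])
          fix i assume "i \<le> mk"
          then have "norm (H (w i) - zs) \<le> \<gamma> * norm (w i - zs)" "norm (w i - zs) \<le> E"
            using H_bound w\<delta> wE by auto
          moreover have "\<gamma> * norm (w i - zs) \<le> 1 * norm (w i - zs)"
            using \<gamma> by (intro mult_right_mono) auto
          ultimately show "norm (H (w i) - zs) \<le> E" by linarith
        qed
        then have zn\<delta>: "norm (z n - zs) < \<delta>"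
          using CE by linarith
        \<comment> \<open>The same error is written twice, through \<open>H (w i)\<close> and
          through \<open>w i + r (w i)\<close>. Applying \<open>A\<close> to the second form and
          subtracting the first cancels the terms \<open>A (w i - zs)\<close> and leaves
          \<open>A\<close> of the combined residual.\<close>
        have "z n - zs = (\<Sum>i\<le>mk. a i *\<^sub>R (A (w i - zs) + R (w i)))"
          unfolding step' by (simp add: R_def)
        then have e1: "z n - zs = (\<Sum>i\<le>mk. a i *\<^sub>R A (w i - zs)) + (\<Sum>i\<le>mk. a i *\<^sub>R R (w i))"
          by (simp add: scaleR_add_right sum.distrib)
        have "z n - zs = (\<Sum>i\<le>mk. a i *\<^sub>R ((w i - zs) + r (w i)))"
          unfolding step' by (simp add: r_def)
        then have "z n - zs = (\<Sum>i\<le>mk. a i *\<^sub>R (w i - zs)) + (\<Sum>i\<le>mk. a i *\<^sub>R r (w i))"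
          by (simp only: scaleR_add_right sum.distrib)
        then have "A (z n - zs) = (\<Sum>i\<le>mk. a i *\<^sub>R A (w i - zs)) + A (\<Sum>i\<le>mk. a i *\<^sub>R r (w i))"
          by (simp only: A.add A.sum A.scaleR)
        moreover have "r (z n) = A (z n - zs) + R (z n) - (z n - zs)"
          by (simp add: r_def R_def)
        ultimately have "r (z n) = A (\<Sum>i\<le>mk. a i *\<^sub>R r (w i)) + R (z n) - (\<Sum>i\<le>mk. a i *\<^sub>R R (w i))"
          using e1 by simp
        then have n0: "norm (r (z n)) \<le> norm (A (\<Sum>i\<le>mk. a i *\<^sub>R r (w i))) + norm (R (z n)) + norm (\<Sum>i\<le>mk. a i *\<^sub>R R (w i))"
          using norm_triangle_ineq4[of "A (\<Sum>i\<le>mk. a i *\<^sub>R r (w i)) + R (z n)" "\<Sum>i\<le>mk. a i *\<^sub>R R (w i)"]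
            norm_triangle_ineq[of "A (\<Sum>i\<le>mk. a i *\<^sub>R r (w i))" "R (z n)"] by simp
        have n1: "norm (A (\<Sum>i\<le>mk. a i *\<^sub>R r (w i))) \<le> \<gamma> * (q ^ k * norm (r z0))"
        proof -
          \<comment> \<open>All weight on the newest index is a competitor in the least squares
            problem, so the optimal combination is no longer than the latest residual.\<close>
          have "(\<Sum>i\<le>mk. (if i = mk then 1 else 0) *\<^sub>R r (w i)) = r (w mk)"
            by (simp add: if_distrib[of "\<lambda>c. c *\<^sub>R _"] cong: if_cong)
          then have "(norm (\<Sum>i\<le>mk. a i *\<^sub>R r (w i)))\<^sup>2 \<le> (norm (r (w mk)))\<^sup>2"
            using opt[of "\<lambda>i. if i = mk then 1 else 0"] by simp
          then have "norm (\<Sum>i\<le>mk. a i *\<^sub>R r (w i)) \<le> norm (r (w mk))"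
            by (simp add: power2_le_iff_abs_le)
          also have "\<dots> \<le> q ^ k * norm (r z0)"
            using less.IH[of k] mk Suc by (simp add: w_def)
          finally have "\<gamma> * norm (\<Sum>i\<le>mk. a i *\<^sub>R r (w i)) \<le> \<gamma> * (q ^ k * norm (r z0))"
            using \<gamma> by (intro mult_left_mono) auto
          with A_bound show ?thesis by (rule order_trans)
        qed
        have n2: "norm (R (z n)) \<le> \<epsilon> * (C * E)"
          using zn \<epsilon>(1) by (intro order_trans[OF R[OF zn\<delta>]] mult_left_mono) auto
        have n3: "norm (\<Sum>i\<le>mk. a i *\<^sub>R R (w i)) \<le> C * (\<epsilon> * E)"
        proof (rule weighted)
          fix i assume i: "i \<le> mk"
          show "norm (R (w i)) \<le> \<epsilon> * E"
            using \<epsilon>(1) by (intro order_trans[OF R[OF w\<delta>[OF i]]] mult_left_mono wE[OF i]) auto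
        qed (use \<epsilon>(1) E0 in simp)
        have n4: "norm (r (z n)) \<le> \<gamma> * (q ^ k * norm (r z0)) + 2 * C * \<epsilon> * E"
          using n0 n1 n2 n3 by (simp add: mult.left_commute)
        have "2 * C * \<epsilon> * E = 2 * C * \<epsilon> / (1 - \<gamma>) * (q ^ (k - mk) * norm (r z0))"
          by (simp add: E_def)
        also have "\<dots> = (q - \<gamma>) * (q ^ m * q ^ (k - mk)) * norm (r z0)"
          unfolding \<epsilon>(2) by simp
        also have "\<dots> \<le> (q - \<gamma>) * q ^ k * norm (r z0)"
        proof -
          \<comment> \<open>As \<open>mk \<le> m\<close>, the factor \<open>q ^ m\<close> reserved
            in \<open>\<epsilon>\<close> raises the exponent of the oldest index from
            \<open>k - mk\<close> to at least \<open>k\<close>.\<close>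
          have "q ^ m * q ^ (k - mk) = q ^ (m + (k - mk))"
            by (simp add: power_add)
          also have "\<dots> \<le> q ^ k"
            using q mk by (intro power_decreasing) auto
          finally show ?thesis
            using q by (intro mult_right_mono mult_left_mono) auto
        qed
        finally have "norm (r (z n)) \<le> q ^ n * norm (r z0)"
          using n4 by (simp add: Suc algebra_simps)
        with zn\<delta> show ?thesis by blast
      qed
    qed
    have err: "norm (z k - zs) \<le> (1 + \<gamma>) / (1 - \<gamma>) * q ^ k * norm (z0 - zs)" for k
    proof -
      have "norm (z k - zs) \<le> norm (r (z k)) / (1 - \<gamma>)"
        unfolding r_def by (rule res_lower) (use inv in blast)
      also have "\<dots> \<le> (q ^ k * ((1 + \<gamma>) * norm (z0 - zs))) / (1 - \<gamma>)"
        using inv[of k] r0 q \<gamma> by (intro divide_right_mono order_trans[OF conjunct2[OF inv]] mult_left_mono) auto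
      finally show ?thesis
        by (simp add: ac_simps)
    qed
    have "(\<lambda>k. (1 + \<gamma>) / (1 - \<gamma>) * q ^ k * norm (z0 - zs)) \<longlonglongrightarrow> (1 + \<gamma>) / (1 - \<gamma>) * 0 * norm (z0 - zs)"
      using q by (intro tendsto_intros LIMSEQ_realpow_zero) auto
    then have "(\<lambda>k. (1 + \<gamma>) / (1 - \<gamma>) * q ^ k * norm (z0 - zs)) \<longlonglongrightarrow> 0"
      by simp
    then have "(\<lambda>k. z k - zs) \<longlonglongrightarrow> 0"
      by (rule Lim_null_comparison[OF always_eventually, rotated]) (use err in blast)
    then have "z \<longlonglongrightarrow> zs"
      by (rule LIM_zero_cancel)
    then show ?thesis
      using inv err by (simp add: r_def)
  qed
  then show ?thesis
    using q \<eta>(1) by blast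
qed

section \<open>Assembly at the fixed point of the Douglas-Rachford mapping\<close>

theorem theorem5p1:
  fixes f :: "real ^ 'n \<Rightarrow> real" and g :: "real ^ 'n \<Rightarrow> ereal"
    and F :: "real ^ 'n \<Rightarrow> ereal" and H :: "real ^ 'n \<Rightarrow> real ^ 'n"
    and \<beta> \<delta> \<sigma> Lf :: real
    and xstar zstar :: "real ^ 'n" and M :: "(real ^ 'n) set"
  assumes F_def: "F = (\<lambda>x. ereal (f x) + g x)"
    and F_closed: "closed_fun F"
    and F_level_bounded: "level_bounded F"
    and f_smooth: "C_smooth_on 2 UNIV f"
    and f_grad: "Lf-lipschitz_on UNIV (grad f)"
    and g_proper: "\<And>x. g x \<noteq> -\<infinity>"
    and g_closed: "closed_fun g"
    and sigma: "\<sigma> > 0"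
    and g_weakly_convex: "weakly_convex \<sigma> g"
    and beta_pos: "\<beta> > 0"
    and beta_less: "ereal \<beta> < min (inverse (ereal \<sigma>)) (inverse (ereal Lf))"
    and delta: "0 < \<delta>" "\<delta> < 2"
    and H_def: "H = DR_S \<beta> \<delta> f g"
    and critical: "critical_point F xstar"
    and fixed_point: "H zstar = zstar" "xstar = prox \<beta> (\<lambda>y. ereal (f y)) zstar"
    and active: "active_manifold 3 g M xstar"
    and f_smooth_near: "C_smooth_near 4 f xstar"
    and rint: "0 \<in> rel_interior (subdiff F xstar)"
  shows "(C_smooth_near 2 H zstar \<and>
           (\<exists>\<epsilon>>0. \<exists>L. L-lipschitz_on (ball zstar \<epsilon>) H) \<and>
           (\<exists>\<epsilon>>0. \<exists>L. \<exists>DH :: real ^ 'n \<Rightarrow> (real ^ 'n) \<Rightarrow>\<^sub>L (real ^ 'n).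
              (\<forall>z\<in>ball zstar \<epsilon>. (H has_derivative blinfun_apply (DH z)) (at z)) \<and>
              L-lipschitz_on (ball zstar \<epsilon>) DH))
       \<and> (\<forall>\<rho> \<gamma> M\<^sub>\<alpha> :: real. \<forall>m::nat.
           \<rho> > 0 \<and> 0 < \<gamma> \<and> \<gamma> < 1 \<and> m \<ge> 1 \<and>
           (\<forall>z\<in>cball zstar \<rho>. \<forall>z'\<in>cball zstar \<rho>. norm (H z - H z') \<le> \<gamma> * norm (z - z')) \<longrightarrow>
           (\<exists>\<gamma>'. \<gamma> < \<gamma>' \<and> \<gamma>' < 1 \<and>
             (\<exists>\<eta>>0. \<forall>z0 z \<alpha>.
               norm (z0 - zstar) < \<eta> \<and> anderson_run m H z0 z \<alpha> \<and>
               (\<forall>k. (\<Sum>i\<le>min m k. \<bar>\<alpha> k i\<bar>) \<le> M\<^sub>\<alpha>) \<longrightarrow>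
               z \<longlonglongrightarrow> zstar \<and>
               (\<forall>k. norm (H (z k) - z k) \<le> \<gamma>' ^ k * norm (H z0 - z0) \<and>
                    norm (z k - zstar) \<le> (1 + \<gamma>) / (1 - \<gamma>) * \<gamma>' ^ k * norm (z0 - zstar)))))"
proof -
  let ?pf = "prox \<beta> (\<lambda>y. ereal (f y))"
  have f: "GDERIV f x :> grad f x" for x
    by (rule C_smooth_on_GDERIV[OF f_smooth[unfolded numeral_2_eq_2]]) simp
  have "ereal \<beta> < ereal (1 / \<sigma>)" and \<beta>L: "ereal \<beta> < inverse (ereal Lf)"
    using beta_less sigma by (simp_all add: inverse_eq_divide)
  then have \<beta>\<sigma>: "\<beta> * \<sigma> < 1"
    using sigma by (simp add: field_simps)
  have "Lf \<ge> 0"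
    using f_grad by (rule lipschitz_on_nonneg)
  \<comment> \<open>For \<open>Lf = 0\<close> the inverse in \<open>ereal\<close> is infinite, and
    the bound holds trivially.\<close>
  then have \<beta>Lf: "\<beta> * Lf < 1"
    using \<beta>L by (cases "Lf = 0") (auto simp: field_simps)
  have "\<bar>F xstar\<bar> \<noteq> \<infinity>"
    using critical by (simp add: critical_point_def subdiff_def)
  then obtain a where a: "g xstar = ereal a"
    unfolding F_def using g_proper by (cases "g xstar") auto
  \<comment> \<open>Criticality makes this a subgradient of \<open>g\<close> at
    \<open>xstar\<close>; translation by \<open>grad f xstar\<close> carries the relative interior
    condition from \<open>F\<close> to \<open>g\<close>.\<close>
  define v where "v = - grad f xstar"
  have "subdiff F xstar = (+) (grad f xstar) ` subdiff g xstar"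
    unfolding F_def by (rule subdiff_add_differentiable_eq[where \<phi> = g and a = a, OF f a])
  then have "0 \<in> (+) (grad f xstar) ` rel_interior (subdiff g xstar)"
    using rint rel_interior_translation[of "grad f xstar" "subdiff g xstar"] by simp
  then have v: "v \<in> rel_interior (subdiff g xstar)"
    by (auto simp: v_def minus_unique)
  have "xstar + \<beta> *\<^sub>R grad f xstar = zstar"
    unfolding fixed_point(2) by (rule prox_add_scaleR_grad_prox[OF f f_grad beta_pos \<beta>Lf])
  \<comment> \<open>Since \<open>zstar\<close> is \<open>xstar + \<beta> grad f xstar\<close>, its
    reflection through \<open>xstar\<close> is the point at which \<open>prox \<beta> g\<close> is
    known to be smooth.\<close>
  then have w: "2 *\<^sub>R ?pf zstar - zstar = xstar + \<beta> *\<^sub>R v"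
    unfolding fixed_point(2)[symmetric] by (simp add: v_def scaleR_2 algebra_simps)
  have prox_g: "C_smooth_near 2 (prox \<beta> g) (2 *\<^sub>R ?pf zstar - zstar)"
    unfolding w using sigma
    by (intro active_manifold_prox_smooth[OF g_weakly_convex _ g_proper active v beta_pos \<beta>\<sigma>]) simp
  have "C_smooth_near (Suc (Suc 2)) f (?pf zstar)"
    using f_smooth_near unfolding fixed_point(2) by simp
  then have "C_smooth_near (Suc 2) ?pf zstar"
    by (rule prox_smooth_of_lipschitz_grad[OF f f_grad beta_pos \<beta>Lf])
  then have prox_f: "C_smooth_near 2 ?pf zstar"
    by (rule C_smooth_near_mono) simp
  have "C_smooth_near 2 (\<lambda>z. prox \<beta> g (2 *\<^sub>R ?pf z - z)) zstar"
    by (rule C_smooth_near_compose[OF C_smooth_near_diff[OF C_smooth_near_scaleR[OF prox_f] C_smooth_near_ident] prox_g])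
  then have H: "C_smooth_near 2 H zstar"
    unfolding H_def DR_S_def DR_R_def
    by (intro C_smooth_near_add C_smooth_near_scaleR C_smooth_near_diff C_smooth_near_ident prox_f)
  obtain DH :: "real ^ 'n \<Rightarrow> (real ^ 'n) \<Rightarrow>\<^sub>L (real ^ 'n)" where "(H has_derivative blinfun_apply (DH zstar)) (at zstar)"
    using C_smooth_near_lipschitz_derivative[OF H] by (metis centre_in_ball)
  note anderson = anderson_local_convergence[OF this fixed_point(1)]
  have lip: "\<exists>\<epsilon>>0. \<exists>L. L-lipschitz_on (ball zstar \<epsilon>) H"
    by (intro C_smooth_near_lipschitz C_smooth_near_mono[OF H]) simp
  show ?thesis
  proof (rule conjI[OF conjI[OF H conjI[OF lip C_smooth_near_lipschitz_derivative[OF H]]]], intro allI impI, elim conjE)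
    fix \<rho> \<gamma> M\<^sub>\<alpha> :: real and m :: nat
    assume "\<rho> > 0" "0 < \<gamma>" "\<gamma> < 1"
      "\<forall>z\<in>cball zstar \<rho>. \<forall>z'\<in>cball zstar \<rho>. norm (H z - H z') \<le> \<gamma> * norm (z - z')"
    then show "\<exists>\<gamma>'. \<gamma> < \<gamma>' \<and> \<gamma>' < 1 \<and>
             (\<exists>\<eta>>0. \<forall>z0 z \<alpha>.
               norm (z0 - zstar) < \<eta> \<and> anderson_run m H z0 z \<alpha> \<and>
               (\<forall>k. (\<Sum>i\<le>min m k. \<bar>\<alpha> k i\<bar>) \<le> M\<^sub>\<alpha>) \<longrightarrow>
               z \<longlonglongrightarrow> zstar \<and>
               (\<forall>k. norm (H (z k) - z k) \<le> \<gamma>' ^ k * norm (H z0 - z0) \<and>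
                    norm (z k - zstar) \<le> (1 + \<gamma>) / (1 - \<gamma>) * \<gamma>' ^ k * norm (z0 - zstar)))"
      by (intro anderson[of \<rho> \<gamma> m M\<^sub>\<alpha>]) auto
  qed
qed

end
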